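(* Let $\mathcal{C}$ be a pivotal finite tensor category and let $\mathcal{M}$ be a pivotal exact left $\mathcal{C}$-module category. For all $X\in\mathcal{C}$ and $M\in\mathcal{M}$, $$\mathrm{ch}_{\mathcal{C}}(X)\star\mathrm{ch}_{\mathcal{M}}(M)=\mathrm{ch}_{\mathcal{M}}(X\otimes M)\quad\text{in }\mathrm{CF}(\mathcal{M}).$$
   Context: $k$ is an algebraically closed field. A finite abelian category is a $k$-linear category equivalent to finite-dimensional left modules over a finite-dimensional $k$-algebra. A finite tensor category is a rigid monoidal category $\mathcal{C}$ that is finite abelian, with $k$-linear tensor product in each variable and simple unit $\mathbf{1}$. A finite left $\mathcal{C}$-module category is a left $\mathcal{C}$-module category that is finite abelian with action $\otimes$ $k$-linear and right exact in each variable; it is exact if $P\otimes M$ is projective for all projective $P\in\mathcal{C}$ and all $M$. Associativity constraints are suppressed. $(X^*,\mathrm{ev}_X:X^*\otimes X\to\mathbf{1},\mathrm{coev}_X:\mathbf{1}\to X\otimes X^* )$ is the left dual of $X$. Write $[M,N]=\underline{\mathrm{Hom}}(M,N)$: $[M,-]$ is right adjoint to $X\mapsto X\otimes M$, with unit $\underline{\mathrm{coev}}_{X,M}$ and counit $\underline{\mathrm{ev}}_{M,N}$. Let $\mathfrak{a}_{X,M,N}:X\otimes[M,N]\to[M,X\otimes N]$ correspond to $\mathrm{id}_X\otimes\underline{\mathrm{ev}}_{M,N}$, let $\mathfrak{b}^{\natural}_{X,M,N}:[X\otimes M,N]\otimes X\to[M,N]$ correspond to $\underline{\mathrm{ev}}_{X\otimes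 M,N}$, let $\mathfrak{b}_{Y,M,N}=(\mathfrak{b}^{\natural}_{Y,M,N}\otimes\mathrm{id}_{Y^*})\circ(\mathrm{id}\otimes\mathrm{coev}_Y):[Y\otimes M,N]\to[M,N]\otimes Y^*$, and let $\mathfrak{c}_{X,M,N,Y}=\mathfrak{b}_{Y,M,X\otimes N}^{-1}\circ(\mathfrak{a}_{X,M,N}\otimes\mathrm{id}_{Y^*}):X\otimes[M,N]\otimes Y^*\to[Y\otimes M,X\otimes N]$; $\mathfrak{a},\mathfrak{b},\mathfrak{c}$ are isomorphisms. Class functions: $A_{\mathcal{M}}=\int_{M\in\mathcal{M}}[M,M]$ with universal dinatural transformation $\pi_{\mathcal{M}}(M):A_{\mathcal{M}}\to[M,M]$, and $\mathrm{CF}(\mathcal{M})=\mathrm{Hom}_{\mathcal{C}}(A_{\mathcal{M}},\mathbf{1})$. $A_{\mathcal{M}}$ has a unique half-braiding $\sigma_{\mathcal{M}}(X):A_{\mathcal{M}}\otimes X\to X\otimes A_{\mathcal{M}}$ with $\mathfrak{a}_{X,M,M}\circ(\mathrm{id}_X\otimes\pi_{\mathcal{M}}(M))\circ\sigma_{\mathcal{M}}(X)=\mathfrak{b}^{\natural}_{X,M,X\otimes M}\circ(\pi_{\mathcal{M}}(X\otimes M)\otimes\mathrm{id}_X)$. Let $\mathsf{Z}(V)=\int_{X\in\mathcal{C}}X\otimes V\otimes X^*$ with universal dinatural transformation $\pi^{\mathsf{Z}}_V(X)$; for $\mathcal{M}=\mathcal{C}$, $[X,Y]=Y\otimes X^*$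 and $A_{\mathcal{C}}=\mathsf{Z}(\mathbf{1})$. Let $\delta_{\mathcal{M}}:A_{\mathcal{M}}\to\mathsf{Z}(A_{\mathcal{M}})$ be the unique morphism with $\pi^{\mathsf{Z}}_{A_{\mathcal{M}}}(X)\circ\delta_{\mathcal{M}}=(\sigma_{\mathcal{M}}(X)\otimes\mathrm{id}_{X^*})\circ(\mathrm{id}\otimes\mathrm{coev}_X)$ for all $X$. For $f\in\mathrm{CF}(\mathcal{C})$, $g\in\mathrm{CF}(\mathcal{M})$: $f\star g=f\circ\mathsf{Z}(g)\circ\delta_{\mathcal{M}}$. Pivotal structures: a pivotal structure of $\mathcal{C}$ is a monoidal natural isomorphism $j_X:X\to X^{**}$. For an exact $\mathcal{M}$, the relative Serre functor $\mathbb{S}=\mathbb{S}_{\mathcal{M}}:\mathcal{M}\to\mathcal{M}$ is the (unique) functor with a natural isomorphism $\mathfrak{d}_{M,N}:[M,N]^*\to[N,\mathbb{S}(M)]$. There is a unique natural isomorphism $\zeta_{X,M}:X^{**}\otimes\mathbb{S}(M)\to\mathbb{S}(X\otimes M)$ making $\mathbb{S}$ a $\mathcal{C}$-module functor from $\mathcal{M}$ to $\mathcal{M}$ with action twisted by $(-)^{**}$, such that $\mathfrak{d}$ is an isomorphism of $\mathcal{C}$-bimodule functors, i.e. $\mathfrak{d}_{Y\otimes M,X\otimes N}\circ(\mathfrak{c}_{X,M,N,Y}^* )^{-1}=[\mathrm{id}_{X\otimes N},\zeta_{Y,M}]\circ\mathfrak{c}_{Y^{**},N,\mathbb{S}(M),X}\circ(\mathrm{id}_{Y^{**}}\otimes\mathfrak{d}_{M,N}\otimes\mathrm{id}_{X^*})$.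 A pivotal structure of $\mathcal{M}$ is a natural isomorphism $j':\mathrm{id}_{\mathcal{M}}\to\mathbb{S}$ with $j'_{X\otimes M}=\zeta_{X,M}\circ(j_X\otimes j'_M)$ for all $X,M$; a pivotal left $\mathcal{C}$-module category is an exact one equipped with a pivotal structure. Characters: $\mathrm{tr}_{\mathcal{C}}(X)=\mathrm{ev}_{X^*}\circ(j_X\otimes\mathrm{id}_{X^*}):X\otimes X^*\to\mathbf{1}$ and $\mathrm{ch}_{\mathcal{C}}(X)=\mathrm{tr}_{\mathcal{C}}(X)\circ\pi_{\mathcal{C}}(X)\in\mathrm{CF}(\mathcal{C})$. The trace $\mathrm{tr}_{\mathcal{M}}(M):[M,M]\to\mathbf{1}$ corresponds to $j'_M$ under $\mathrm{Hom}_{\mathcal{M}}(M,\mathbb{S}(M))\cong\mathrm{Hom}_{\mathcal{C}}(\mathbf{1},[M,\mathbb{S}(M)])\cong\mathrm{Hom}_{\mathcal{C}}(\mathbf{1},[M,M]^* )\cong\mathrm{Hom}_{\mathcal{C}}([M,M],\mathbf{1})$, i.e. $\mathfrak{d}_{M,M}\circ\mathrm{tr}_{\mathcal{M}}(M)^*=[\mathrm{id}_M,j'_M]\circ\underline{\mathrm{coev}}_{\mathbf{1},M}$. The internal character of $M$ is $\mathrm{ch}_{\mathcal{M}}(M)=\mathrm{tr}_{\mathcal{M}}(M)\circ\pi_{\mathcal{M}}(M)\in\mathrm{CF}(\mathcal{M})$. *)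

theory Defs
  imports
    "HOL-Computational_Algebra.Polynomial"
    "HOL-Algebra.Module"
    "Jordan_Normal_Form.Matrix"
begin

section \<open>Linear categories\<close>

text \<open>
  The objects of a category are all elements of the type \<open>'o\<close>, its morphisms are all elements of
  the type \<open>'a\<close>, and each morphism has a source and a target. The type variables are free, so they
  range over arbitrary (nonempty) collections of objects and of morphisms. The composite
  \<open>g \<cdot> f\<close> (first \<open>f\<close>, then \<open>g\<close>) and the sum \<open>Add f g\<close> are constrained only when they make sense.
\<close>

record ('o, 'a, 'k) lin_cat =
  Src :: "'a \<Rightarrow> 'o"
  Tgt :: "'a \<Rightarrow> 'o"
  Idn :: "'o \<Rightarrow> 'a"
  Cmp :: "'a \<Rightarrow> 'a \<Rightarrow> 'a"  (infixr "\<cdot>\<index>" 55)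
  Zer :: "'o \<Rightarrow> 'o \<Rightarrow> 'a"
  Add :: "'a \<Rightarrow> 'a \<Rightarrow> 'a"
  Scl :: "'k \<Rightarrow> 'a \<Rightarrow> 'a"

definition Hom :: "('o, 'a, 'k, 'z) lin_cat_scheme \<Rightarrow> 'o \<Rightarrow> 'o \<Rightarrow> 'a set" where
  "Hom \<C> X Y = {f. Src \<C> f = X \<and> Tgt \<C> f = Y}"

definition scalar_ring :: "'k::field ring" where
  "scalar_ring = \<lparr>carrier = UNIV, mult = (*), one = 1, zero = 0, add = (+)\<rparr>"

text \<open>The multiplicative fields of a module record carry no meaning for a plain module.\<close>

definition hom_module :: "('o, 'a, 'k, 'z) lin_cat_scheme \<Rightarrow> 'o \<Rightarrow> 'o \<Rightarrow> ('k, 'a) module" where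
  "hom_module \<C> X Y =
    \<lparr>carrier = Hom \<C> X Y, mult = undefined, one = undefined,
     zero = Zer \<C> X Y, add = Add \<C>, smult = Scl \<C>\<rparr>"

locale linear_category =
  fixes \<C> :: "('o, 'a, 'k::field, 'z) lin_cat_scheme" (structure)
  assumes Idn_Hom: "Idn \<C> X \<in> Hom \<C> X X"
    and Cmp_Hom: "\<lbrakk>f \<in> Hom \<C> X Y; g \<in> Hom \<C> Y Z\<rbrakk> \<Longrightarrow> g \<cdot> f \<in> Hom \<C> X Z"
    and Idn_left: "f \<in> Hom \<C> X Y \<Longrightarrow> Idn \<C> Y \<cdot> f = f"
    and Idn_right: "f \<in> Hom \<C> X Y \<Longrightarrow> f \<cdot> Idn \<C> X = f"
    and Cmp_assoc: "\<lbrakk>f \<in> Hom \<C> W X; g \<in> Hom \<C> X Y; h \<in> Hom \<C> Y Z\<rbrakk> \<Longrightarrow> (h \<cdot> g) \<cdot> f = h \<cdot> (g \<cdot> f)"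
    and Hom_module: "module scalar_ring (hom_module \<C> X Y)"
    and Cmp_Add_left: "\<lbrakk>f \<in> Hom \<C> X Y; g \<in> Hom \<C> Y Z; g' \<in> Hom \<C> Y Z\<rbrakk> \<Longrightarrow>
      Add \<C> g g' \<cdot> f = Add \<C> (g \<cdot> f) (g' \<cdot> f)"
    and Cmp_Add_right: "\<lbrakk>f \<in> Hom \<C> X Y; f' \<in> Hom \<C> X Y; g \<in> Hom \<C> Y Z\<rbrakk> \<Longrightarrow>
      g \<cdot> Add \<C> f f' = Add \<C> (g \<cdot> f) (g \<cdot> f')"
    and Cmp_Scl_left: "\<lbrakk>f \<in> Hom \<C> X Y; g \<in> Hom \<C> Y Z\<rbrakk> \<Longrightarrow> Scl \<C> t g \<cdot> f = Scl \<C> t (g \<cdot> f)"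
    and Cmp_Scl_right: "\<lbrakk>f \<in> Hom \<C> X Y; g \<in> Hom \<C> Y Z\<rbrakk> \<Longrightarrow> g \<cdot> Scl \<C> t f = Scl \<C> t (g \<cdot> f)"


subsection \<open>Isomorphisms, epimorphisms, cokernels, projective and simple objects\<close>

definition is_inverse :: "('o, 'a, 'k, 'z) lin_cat_scheme \<Rightarrow> 'a \<Rightarrow> 'a \<Rightarrow> bool" where
  "is_inverse \<C> f g \<longleftrightarrow>
    g \<in> Hom \<C> (Tgt \<C> f) (Src \<C> f) \<and> g \<cdot> f = Idn \<C> (Src \<C> f) \<and> f \<cdot> g = Idn \<C> (Tgt \<C> f)"
  for \<C> (structure)

definition is_isomorphism :: "('o, 'a, 'k, 'z) lin_cat_scheme \<Rightarrow> 'a \<Rightarrow> bool" where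
  "is_isomorphism \<C> f \<longleftrightarrow> (\<exists>g. is_inverse \<C> f g)"

definition Inv :: "('o, 'a, 'k, 'z) lin_cat_scheme \<Rightarrow> 'a \<Rightarrow> 'a" where
  "Inv \<C> f = (THE g. is_inverse \<C> f g)"

definition is_epi :: "('o, 'a, 'k, 'z) lin_cat_scheme \<Rightarrow> 'a \<Rightarrow> bool" where
  "is_epi \<C> e \<longleftrightarrow> (\<forall>g h. Src \<C> g = Tgt \<C> e \<and> Src \<C> h = Tgt \<C> e \<and> g \<cdot> e = h \<cdot> e \<longrightarrow> g = h)"
  for \<C> (structure)

definition is_mono :: "('o, 'a, 'k, 'z) lin_cat_scheme \<Rightarrow> 'a \<Rightarrow> bool" where
  "is_mono \<C> m \<longleftrightarrow> (\<forall>g h. Tgt \<C> g = Src \<C> m \<and> Tgt \<C> h = Src \<C> m \<and> m \<cdot> g = m \<cdot> h \<longrightarrow> g = h)"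
  for \<C> (structure)

definition projective :: "('o, 'a, 'k, 'z) lin_cat_scheme \<Rightarrow> 'o \<Rightarrow> bool" where
  "projective \<C> P \<longleftrightarrow>
    (\<forall>e f. is_epi \<C> e \<and> Src \<C> f = P \<and> Tgt \<C> f = Tgt \<C> e \<longrightarrow> (\<exists>g \<in> Hom \<C> P (Src \<C> e). e \<cdot> g = f))"
  for \<C> (structure)

text \<open>The identity of an object vanishes iff the object is zero, and a monomorphism vanishes iff
  its source is zero.\<close>

definition simple_object :: "('o, 'a, 'k, 'z) lin_cat_scheme \<Rightarrow> 'o \<Rightarrow> bool" where
  "simple_object \<C> S \<longleftrightarrow>
    Idn \<C> S \<noteq> Zer \<C> S S \<and>
    (\<forall>m. is_mono \<C> m \<and> Tgt \<C> m = S \<longrightarrow> m = Zer \<C> (Src \<C> m) S \<or> is_isomorphism \<C> m)"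

definition is_cokernel :: "('o, 'a, 'k, 'z) lin_cat_scheme \<Rightarrow> 'a \<Rightarrow> 'a \<Rightarrow> bool" where
  "is_cokernel \<C> f q \<longleftrightarrow>
    Src \<C> q = Tgt \<C> f \<and> q \<cdot> f = Zer \<C> (Src \<C> f) (Tgt \<C> q) \<and>
    (\<forall>h. Src \<C> h = Tgt \<C> f \<and> h \<cdot> f = Zer \<C> (Src \<C> f) (Tgt \<C> h) \<longrightarrow>
      (\<exists>!u. u \<in> Hom \<C> (Tgt \<C> q) (Tgt \<C> h) \<and> u \<cdot> q = h))"
  for \<C> (structure)


subsection \<open>Functors, natural transformations, adjunctions\<close>

definition is_functor ::
  "('o, 'a, 'k, 'z) lin_cat_scheme \<Rightarrow> ('p, 'b, 'k, 'y) lin_cat_scheme \<Rightarrow> ('o \<Rightarrow> 'p) \<Rightarrow> ('a \<Rightarrow> 'b) \<Rightarrow> bool"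
  where
  "is_functor \<C> \<D> F0 F1 \<longleftrightarrow>
    (\<forall>f. F1 f \<in> Hom \<D> (F0 (Src \<C> f)) (F0 (Tgt \<C> f))) \<and>
    (\<forall>X. F1 (Idn \<C> X) = Idn \<D> (F0 X)) \<and>
    (\<forall>f g. Tgt \<C> f = Src \<C> g \<longrightarrow> F1 (g \<cdot>\<^bsub>\<C>\<^esub> f) = F1 g \<cdot>\<^bsub>\<D>\<^esub> F1 f)"

definition is_nat_trans ::
  "('o, 'a, 'k, 'z) lin_cat_scheme \<Rightarrow> ('p, 'b, 'k, 'y) lin_cat_scheme \<Rightarrow>
    ('o \<Rightarrow> 'p) \<Rightarrow> ('a \<Rightarrow> 'b) \<Rightarrow> ('o \<Rightarrow> 'p) \<Rightarrow> ('a \<Rightarrow> 'b) \<Rightarrow> ('o \<Rightarrow> 'b) \<Rightarrow> bool"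
  where
  "is_nat_trans \<C> \<D> F0 F1 G0 G1 \<eta> \<longleftrightarrow>
    (\<forall>X. \<eta> X \<in> Hom \<D> (F0 X) (G0 X)) \<and>
    (\<forall>f. G1 f \<cdot>\<^bsub>\<D>\<^esub> \<eta> (Src \<C> f) = \<eta> (Tgt \<C> f) \<cdot>\<^bsub>\<D>\<^esub> F1 f)"

definition is_nat_iso ::
  "('o, 'a, 'k, 'z) lin_cat_scheme \<Rightarrow> ('p, 'b, 'k, 'y) lin_cat_scheme \<Rightarrow>
    ('o \<Rightarrow> 'p) \<Rightarrow> ('a \<Rightarrow> 'b) \<Rightarrow> ('o \<Rightarrow> 'p) \<Rightarrow> ('a \<Rightarrow> 'b) \<Rightarrow> ('o \<Rightarrow> 'b) \<Rightarrow> bool"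
  where
  "is_nat_iso \<C> \<D> F0 F1 G0 G1 \<eta> \<longleftrightarrow>
    is_nat_trans \<C> \<D> F0 F1 G0 G1 \<eta> \<and> (\<forall>X. is_isomorphism \<D> (\<eta> X))"

definition is_adjunction ::
  "('o, 'a, 'k, 'z) lin_cat_scheme \<Rightarrow> ('p, 'b, 'k, 'y) lin_cat_scheme \<Rightarrow>
    ('o \<Rightarrow> 'p) \<Rightarrow> ('a \<Rightarrow> 'b) \<Rightarrow> ('p \<Rightarrow> 'o) \<Rightarrow> ('b \<Rightarrow> 'a) \<Rightarrow> ('o \<Rightarrow> 'a) \<Rightarrow> ('p \<Rightarrow> 'b) \<Rightarrow> bool"
  where
  "is_adjunction \<C> \<D> F0 F1 G0 G1 \<eta> \<epsilon> \<longleftrightarrow>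
    is_functor \<C> \<D> F0 F1 \<and> is_functor \<D> \<C> G0 G1 \<and>
    is_nat_trans \<C> \<C> (\<lambda>X. X) (\<lambda>f. f) (\<lambda>X. G0 (F0 X)) (\<lambda>f. G1 (F1 f)) \<eta> \<and>
    is_nat_trans \<D> \<D> (\<lambda>M. F0 (G0 M)) (\<lambda>f. F1 (G1 f)) (\<lambda>M. M) (\<lambda>f. f) \<epsilon> \<and>
    (\<forall>X. \<epsilon> (F0 X) \<cdot>\<^bsub>\<D>\<^esub> F1 (\<eta> X) = Idn \<D> (F0 X)) \<and>
    (\<forall>M. G1 (\<epsilon> M) \<cdot>\<^bsub>\<C>\<^esub> \<eta> (G0 M) = Idn \<C> (G0 M))"

definition right_exact ::
  "('o, 'a, 'k, 'z) lin_cat_scheme \<Rightarrow> ('p, 'b, 'k, 'y) lin_cat_scheme \<Rightarrow> ('a \<Rightarrow> 'b) \<Rightarrow> bool" where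
  "right_exact \<C> \<D> F1 \<longleftrightarrow> (\<forall>f q. is_cokernel \<C> f q \<longrightarrow> is_cokernel \<D> (F1 f) (F1 q))"

definition is_bifunctor ::
  "('o, 'a, 'k, 'z) lin_cat_scheme \<Rightarrow> ('p, 'b, 'k, 'y) lin_cat_scheme \<Rightarrow>
    ('q, 'c, 'k, 'x) lin_cat_scheme \<Rightarrow> ('o \<Rightarrow> 'p \<Rightarrow> 'q) \<Rightarrow> ('a \<Rightarrow> 'b \<Rightarrow> 'c) \<Rightarrow> bool"
  where
  "is_bifunctor \<C> \<D> \<E> F0 F1 \<longleftrightarrow>
    (\<forall>f g. F1 f g \<in> Hom \<E> (F0 (Src \<C> f) (Src \<D> g)) (F0 (Tgt \<C> f) (Tgt \<D> g))) \<and>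
    (\<forall>X Y. F1 (Idn \<C> X) (Idn \<D> Y) = Idn \<E> (F0 X Y)) \<and>
    (\<forall>f f' g g'. Tgt \<C> f = Src \<C> f' \<and> Tgt \<D> g = Src \<D> g' \<longrightarrow>
      F1 (f' \<cdot>\<^bsub>\<C>\<^esub> f) (g' \<cdot>\<^bsub>\<D>\<^esub> g) = F1 f' g' \<cdot>\<^bsub>\<E>\<^esub> F1 f g)"

definition is_bilinear ::
  "('o, 'a, 'k, 'z) lin_cat_scheme \<Rightarrow> ('p, 'b, 'k, 'y) lin_cat_scheme \<Rightarrow>
    ('q, 'c, 'k, 'x) lin_cat_scheme \<Rightarrow> ('a \<Rightarrow> 'b \<Rightarrow> 'c) \<Rightarrow> bool"
  where
  "is_bilinear \<C> \<D> \<E> F1 \<longleftrightarrow>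
    (\<forall>X Y. \<forall>f \<in> Hom \<C> X Y. \<forall>f' \<in> Hom \<C> X Y. \<forall>g. F1 (Add \<C> f f') g = Add \<E> (F1 f g) (F1 f' g)) \<and>
    (\<forall>X Y. \<forall>g \<in> Hom \<D> X Y. \<forall>g' \<in> Hom \<D> X Y. \<forall>f. F1 f (Add \<D> g g') = Add \<E> (F1 f g) (F1 f g')) \<and>
    (\<forall>t f g. F1 (Scl \<C> t f) g = Scl \<E> t (F1 f g)) \<and>
    (\<forall>t f g. F1 f (Scl \<D> t g) = Scl \<E> t (F1 f g))"


subsection \<open>Finite abelian categories\<close>

text \<open>
  A finite-dimensional algebra is presented on the vector space \<open>k\<^sup>d\<close>, a finite-dimensional left
  module on a space \<open>k\<^sup>n\<close>, with each algebra element acting by a matrix. Every finite-dimensional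
  algebra and every finite-dimensional module is isomorphic to one of this form, so the modules
  below form a category equivalent to the category of all finite-dimensional left modules. The
  algebra and the spaces \<open>k\<^sup>n\<close> may be zero.
\<close>

record 'k fd_alg =
  alg_dim :: nat
  alg_mult :: "'k vec \<Rightarrow> 'k vec \<Rightarrow> 'k vec"
  alg_one :: "'k vec"

definition fd_algebra :: "'k::field fd_alg \<Rightarrow> bool" where
  "fd_algebra A \<longleftrightarrow>
    (let V = carrier_vec (alg_dim A); m = alg_mult A; u = alg_one A in
      u \<in> V \<and> (\<forall>a\<in>V. \<forall>b\<in>V. m a b \<in> V) \<and>
      (\<forall>a\<in>V. \<forall>b\<in>V. \<forall>c\<in>V. m (a + b) c = m a c + m b c \<and> m c (a + b) = m c a + m c b) \<and>
      (\<forall>t. \<forall>a\<in>V. \<forall>b\<in>V. m (t \<cdot>\<^sub>v a) b = t \<cdot>\<^sub>v m a b \<and> m a (t \<cdot>\<^sub>v b) = t \<cdot>\<^sub>v m a b) \<and>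
      (\<forall>a\<in>V. \<forall>b\<in>V. \<forall>c\<in>V. m (m a b) c = m a (m b c)) \<and>
      (\<forall>a\<in>V. m u a = a \<and> m a u = a))"

type_synonym 'k fd_mod = "nat \<times> ('k vec \<Rightarrow> 'k mat)"

definition fd_module :: "'k::field fd_alg \<Rightarrow> 'k fd_mod \<Rightarrow> bool" where
  "fd_module A N \<longleftrightarrow>
    (let V = carrier_vec (alg_dim A); n = fst N; \<rho> = snd N in
      (\<forall>a\<in>V. \<rho> a \<in> carrier_mat n n) \<and>
      (\<forall>a\<in>V. \<forall>b\<in>V. \<rho> (a + b) = \<rho> a + \<rho> b) \<and>
      (\<forall>t. \<forall>a\<in>V. \<rho> (t \<cdot>\<^sub>v a) = t \<cdot>\<^sub>m \<rho> a) \<and>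
      (\<forall>a\<in>V. \<forall>b\<in>V. \<rho> (alg_mult A a b) = \<rho> a * \<rho> b) \<and>
      \<rho> (alg_one A) = 1\<^sub>m n)"

definition fd_module_homs :: "'k::field fd_alg \<Rightarrow> 'k fd_mod \<Rightarrow> 'k fd_mod \<Rightarrow> 'k mat set" where
  "fd_module_homs A N N' =
    {T \<in> carrier_mat (fst N') (fst N). \<forall>a \<in> carrier_vec (alg_dim A). T * snd N a = snd N' a * T}"

text \<open>A \<open>k\<close>-linear, fully faithful and essentially surjective functor to the category of
  finite-dimensional left \<open>A\<close>-modules.\<close>

definition equivalence_to_fd_modules ::
  "('o, 'a, 'k::field, 'z) lin_cat_scheme \<Rightarrow> 'k fd_alg \<Rightarrow> ('o \<Rightarrow> 'k fd_mod) \<Rightarrow> ('a \<Rightarrow> 'k mat) \<Rightarrow> bool"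
  where
  "equivalence_to_fd_modules \<C> A F0 F1 \<longleftrightarrow>
    (\<forall>X. fd_module A (F0 X)) \<and>
    (\<forall>X. F1 (Idn \<C> X) = 1\<^sub>m (fst (F0 X))) \<and>
    (\<forall>f g. Tgt \<C> f = Src \<C> g \<longrightarrow> F1 (g \<cdot>\<^bsub>\<C>\<^esub> f) = F1 g * F1 f) \<and>
    (\<forall>X Y. \<forall>f \<in> Hom \<C> X Y. \<forall>g \<in> Hom \<C> X Y. F1 (Add \<C> f g) = F1 f + F1 g) \<and>
    (\<forall>t f. F1 (Scl \<C> t f) = t \<cdot>\<^sub>m F1 f) \<and>
    (\<forall>X Y. bij_betw F1 (Hom \<C> X Y) (fd_module_homs A (F0 X) (F0 Y))) \<and>
    (\<forall>N. fd_module A N \<longrightarrow> (\<exists>X. \<exists>T \<in> fd_module_homs A (F0 X) N. invertible_mat T))"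

locale finite_abelian_category = linear_category +
  assumes equivalent_to_fd_modules:
    "\<exists>A F0 F1. fd_algebra A \<and> equivalence_to_fd_modules \<C> A F0 F1"


subsection \<open>Ends\<close>

text \<open>Here \<open>Q0 X Y\<close> and \<open>Q1 f g : Q0 (Tgt f) (Src g) \<rightarrow> Q0 (Src f) (Tgt g)\<close> describe a functor on
  \<open>\<D>\<^sup>o\<^sup>p \<times> \<D>\<close>: the first argument is the contravariant one.\<close>

definition is_dinatural ::
  "('p, 'b, 'k, 'y) lin_cat_scheme \<Rightarrow> ('o, 'a, 'k, 'z) lin_cat_scheme \<Rightarrow>
    ('p \<Rightarrow> 'p \<Rightarrow> 'o) \<Rightarrow> ('b \<Rightarrow> 'b \<Rightarrow> 'a) \<Rightarrow> 'o \<Rightarrow> ('p \<Rightarrow> 'a) \<Rightarrow> bool"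
  where
  "is_dinatural \<D> \<C> Q0 Q1 W p \<longleftrightarrow>
    (\<forall>X. p X \<in> Hom \<C> W (Q0 X X)) \<and>
    (\<forall>f. Q1 (Idn \<D> (Src \<D> f)) f \<cdot>\<^bsub>\<C>\<^esub> p (Src \<D> f) = Q1 f (Idn \<D> (Tgt \<D> f)) \<cdot>\<^bsub>\<C>\<^esub> p (Tgt \<D> f))"

definition is_end ::
  "('p, 'b, 'k, 'y) lin_cat_scheme \<Rightarrow> ('o, 'a, 'k, 'z) lin_cat_scheme \<Rightarrow>
    ('p \<Rightarrow> 'p \<Rightarrow> 'o) \<Rightarrow> ('b \<Rightarrow> 'b \<Rightarrow> 'a) \<Rightarrow> 'o \<Rightarrow> ('p \<Rightarrow> 'a) \<Rightarrow> bool"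
  where
  "is_end \<D> \<C> Q0 Q1 E \<pi> \<longleftrightarrow>
    is_dinatural \<D> \<C> Q0 Q1 E \<pi> \<and>
    (\<forall>W p. is_dinatural \<D> \<C> Q0 Q1 W p \<longrightarrow> (\<exists>!h. h \<in> Hom \<C> W E \<and> (\<forall>X. \<pi> X \<cdot>\<^bsub>\<C>\<^esub> h = p X)))"


section \<open>Pivotal finite tensor categories\<close>

record ('o, 'a, 'k) mon_cat = "('o, 'a, 'k) lin_cat" +
  TenO :: "'o \<Rightarrow> 'o \<Rightarrow> 'o"  (infix "\<otimes>\<^sub>o\<index>" 75)
  TenA :: "'a \<Rightarrow> 'a \<Rightarrow> 'a"  (infix "\<otimes>\<^sub>a\<index>" 75)
  Unit :: 'o
  Assoc :: "'o \<Rightarrow> 'o \<Rightarrow> 'o \<Rightarrow> 'a"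
  LUnit :: "'o \<Rightarrow> 'a"
  RUnit :: "'o \<Rightarrow> 'a"

locale monoidal_category = linear_category \<C>
  for \<C> :: "('o, 'a, 'k::field, 'z) mon_cat_scheme" (structure) +
  assumes Ten_bifunctor: "is_bifunctor \<C> \<C> \<C> (TenO \<C>) (TenA \<C>)"
    and Assoc_Hom: "Assoc \<C> X Y Z \<in> Hom \<C> ((X \<otimes>\<^sub>o Y) \<otimes>\<^sub>o Z) (X \<otimes>\<^sub>o (Y \<otimes>\<^sub>o Z))"
    and Assoc_iso: "is_isomorphism \<C> (Assoc \<C> X Y Z)"
    and Assoc_natural:
      "Assoc \<C> (Tgt \<C> f) (Tgt \<C> g) (Tgt \<C> h) \<cdot> ((f \<otimes>\<^sub>a g) \<otimes>\<^sub>a h) =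
       (f \<otimes>\<^sub>a (g \<otimes>\<^sub>a h)) \<cdot> Assoc \<C> (Src \<C> f) (Src \<C> g) (Src \<C> h)"
    and LUnit_nat_iso:
      "is_nat_iso \<C> \<C> (\<lambda>X. Unit \<C> \<otimes>\<^sub>o X) (\<lambda>f. Idn \<C> (Unit \<C>) \<otimes>\<^sub>a f) (\<lambda>X. X) (\<lambda>f. f) (LUnit \<C>)"
    and RUnit_nat_iso:
      "is_nat_iso \<C> \<C> (\<lambda>X. X \<otimes>\<^sub>o Unit \<C>) (\<lambda>f. f \<otimes>\<^sub>a Idn \<C> (Unit \<C>)) (\<lambda>X. X) (\<lambda>f. f) (RUnit \<C>)"
    and pentagon:
      "(Idn \<C> W \<otimes>\<^sub>a Assoc \<C> X Y Z) \<cdot> Assoc \<C> W (X \<otimes>\<^sub>o Y) Z \<cdot> (Assoc \<C> W X Y \<otimes>\<^sub>a Idn \<C> Z) =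
       Assoc \<C> W X (Y \<otimes>\<^sub>o Z) \<cdot> Assoc \<C> (W \<otimes>\<^sub>o X) Y Z"
    and triangle:
      "(Idn \<C> X \<otimes>\<^sub>a LUnit \<C> Y) \<cdot> Assoc \<C> X (Unit \<C>) Y = RUnit \<C> X \<otimes>\<^sub>a Idn \<C> Y"

text \<open>\<open>D\<close> is a left dual of \<open>X\<close> with evaluation \<open>e : D \<otimes> X \<rightarrow> 1\<close> and coevaluation
  \<open>c : 1 \<rightarrow> X \<otimes> D\<close>; equivalently, \<open>X\<close> is a right dual of \<open>D\<close>.\<close>

definition is_left_dual :: "('o, 'a, 'k, 'z) mon_cat_scheme \<Rightarrow> 'o \<Rightarrow> 'o \<Rightarrow> 'a \<Rightarrow> 'a \<Rightarrow> bool" where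
  "is_left_dual \<C> X D e c \<longleftrightarrow>
    e \<in> Hom \<C> (D \<otimes>\<^sub>o X) (Unit \<C>) \<and> c \<in> Hom \<C> (Unit \<C>) (X \<otimes>\<^sub>o D) \<and>
    RUnit \<C> X \<cdot> (Idn \<C> X \<otimes>\<^sub>a e) \<cdot> Assoc \<C> X D X \<cdot> (c \<otimes>\<^sub>a Idn \<C> X) = LUnit \<C> X \<and>
    LUnit \<C> D \<cdot> (e \<otimes>\<^sub>a Idn \<C> D) \<cdot> Inv \<C> (Assoc \<C> D X D) \<cdot> (Idn \<C> D \<otimes>\<^sub>a c) = RUnit \<C> D"
  for \<C> (structure)

record ('o, 'a, 'k) rigid_cat = "('o, 'a, 'k) mon_cat" +
  Dual :: "'o \<Rightarrow> 'o"
  Ev :: "'o \<Rightarrow> 'a"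
  Coev :: "'o \<Rightarrow> 'a"

locale finite_tensor_category =
  finite_abelian_category \<C> + monoidal_category \<C>
  for \<C> :: "('o, 'a, 'k::field, 'z) rigid_cat_scheme" (structure) +
  assumes Ten_bilinear: "is_bilinear \<C> \<C> \<C> (TenA \<C>)"
    and left_dual: "is_left_dual \<C> X (Dual \<C> X) (Ev \<C> X) (Coev \<C> X)"
    and right_dual: "\<exists>D e c. is_left_dual \<C> D X e c"
    and Unit_simple: "simple_object \<C> (Unit \<C>)"

text \<open>The morphism \<open>D \<rightarrow> X\<^sup>*\<close> corresponding to \<open>e : D \<otimes> X \<rightarrow> 1\<close>.\<close>

definition to_dual :: "('o, 'a, 'k, 'z) rigid_cat_scheme \<Rightarrow> 'o \<Rightarrow> 'o \<Rightarrow> 'a \<Rightarrow> 'a" where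
  "to_dual \<C> D X e =
    LUnit \<C> (Dual \<C> X) \<cdot> (e \<otimes>\<^sub>a Idn \<C> (Dual \<C> X)) \<cdot> Inv \<C> (Assoc \<C> D X (Dual \<C> X)) \<cdot>
    (Idn \<C> D \<otimes>\<^sub>a Coev \<C> X) \<cdot> Inv \<C> (RUnit \<C> D)"
  for \<C> (structure)

definition DualA :: "('o, 'a, 'k, 'z) rigid_cat_scheme \<Rightarrow> 'a \<Rightarrow> 'a" where
  "DualA \<C> f =
    to_dual \<C> (Dual \<C> (Tgt \<C> f)) (Src \<C> f) (Ev \<C> (Tgt \<C> f) \<cdot> (Idn \<C> (Dual \<C> (Tgt \<C> f)) \<otimes>\<^sub>a f))"
  for \<C> (structure)

text \<open>The canonical isomorphism \<open>Y\<^sup>* \<otimes> X\<^sup>* \<rightarrow> (X \<otimes> Y)\<^sup>*\<close>.\<close>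

definition dual_ten :: "('o, 'a, 'k, 'z) rigid_cat_scheme \<Rightarrow> 'o \<Rightarrow> 'o \<Rightarrow> 'a" where
  "dual_ten \<C> X Y =
    to_dual \<C> (Dual \<C> Y \<otimes>\<^sub>o Dual \<C> X) (X \<otimes>\<^sub>o Y)
      (Ev \<C> Y \<cdot>
       (Idn \<C> (Dual \<C> Y) \<otimes>\<^sub>a
         (LUnit \<C> Y \<cdot> (Ev \<C> X \<otimes>\<^sub>a Idn \<C> Y) \<cdot> Inv \<C> (Assoc \<C> (Dual \<C> X) X Y))) \<cdot>
       Assoc \<C> (Dual \<C> Y) (Dual \<C> X) (X \<otimes>\<^sub>o Y))"
  for \<C> (structure)

text \<open>The canonical isomorphism \<open>1 \<rightarrow> 1\<^sup>*\<close>.\<close>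

definition dual_unit :: "('o, 'a, 'k, 'z) rigid_cat_scheme \<Rightarrow> 'a" where
  "dual_unit \<C> = to_dual \<C> (Unit \<C>) (Unit \<C>) (LUnit \<C> (Unit \<C>))"

text \<open>The monoidal structure \<open>X\<^sup>*\<^sup>* \<otimes> Y\<^sup>*\<^sup>* \<rightarrow> (X \<otimes> Y)\<^sup>*\<^sup>*\<close> and \<open>1 \<rightarrow> 1\<^sup>*\<^sup>*\<close> of the double dual.\<close>

definition ddual_ten :: "('o, 'a, 'k, 'z) rigid_cat_scheme \<Rightarrow> 'o \<Rightarrow> 'o \<Rightarrow> 'a" where
  "ddual_ten \<C> X Y = Inv \<C> (DualA \<C> (dual_ten \<C> X Y)) \<cdot> dual_ten \<C> (Dual \<C> Y) (Dual \<C> X)"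
  for \<C> (structure)

definition ddual_unit :: "('o, 'a, 'k, 'z) rigid_cat_scheme \<Rightarrow> 'a" where
  "ddual_unit \<C> = Inv \<C> (DualA \<C> (dual_unit \<C>)) \<cdot> dual_unit \<C>"
  for \<C> (structure)

record ('o, 'a, 'k) pivotal_cat = "('o, 'a, 'k) rigid_cat" +
  Piv :: "'o \<Rightarrow> 'a"

locale pivotal_finite_tensor_category = finite_tensor_category \<C>
  for \<C> :: "('o, 'a, 'k::field, 'z) pivotal_cat_scheme" (structure) +
  assumes Piv_nat_iso:
      "is_nat_iso \<C> \<C> (\<lambda>X. X) (\<lambda>f. f) (\<lambda>X. Dual \<C> (Dual \<C> X)) (\<lambda>f. DualA \<C> (DualA \<C> f)) (Piv \<C>)"
    and Piv_ten: "Piv \<C> (X \<otimes>\<^sub>o Y) = ddual_ten \<C> X Y \<cdot> (Piv \<C> X \<otimes>\<^sub>a Piv \<C> Y)"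
    and Piv_unit: "Piv \<C> (Unit \<C>) = ddual_unit \<C>"


section \<open>Exact module categories and internal Homs\<close>

record ('p, 'b, 'k, 'o, 'a) mod_cat = "('p, 'b, 'k) lin_cat" +
  ActO :: "'o \<Rightarrow> 'p \<Rightarrow> 'p"  (infix "\<rhd>\<^sub>o\<index>" 75)
  ActA :: "'a \<Rightarrow> 'b \<Rightarrow> 'b"  (infix "\<rhd>\<^sub>a\<index>" 75)
  MAssoc :: "'o \<Rightarrow> 'o \<Rightarrow> 'p \<Rightarrow> 'b"
  MUnit :: "'p \<Rightarrow> 'b"

locale module_category =
  \<C>: monoidal_category \<C> + \<M>: linear_category \<M>
  for \<C> :: "('o, 'a, 'k::field, 'z) mon_cat_scheme" (structure)
    and \<M> :: "('p, 'b, 'k, 'o, 'a, 'y) mod_cat_scheme" (structure) +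
  assumes Act_bifunctor: "is_bifunctor \<C> \<M> \<M> (ActO \<M>) (ActA \<M>)"
    and MAssoc_Hom: "MAssoc \<M> X Y M \<in> Hom \<M> ((X \<otimes>\<^sub>o Y) \<rhd>\<^sub>o\<^bsub>\<M>\<^esub> M) (X \<rhd>\<^sub>o\<^bsub>\<M>\<^esub> (Y \<rhd>\<^sub>o\<^bsub>\<M>\<^esub> M))"
    and MAssoc_iso: "is_isomorphism \<M> (MAssoc \<M> X Y M)"
    and MAssoc_natural:
      "MAssoc \<M> (Tgt \<C> f) (Tgt \<C> g) (Tgt \<M> h) \<cdot>\<^bsub>\<M>\<^esub> ((f \<otimes>\<^sub>a g) \<rhd>\<^sub>a\<^bsub>\<M>\<^esub> h) =
       (f \<rhd>\<^sub>a\<^bsub>\<M>\<^esub> (g \<rhd>\<^sub>a\<^bsub>\<M>\<^esub> h)) \<cdot>\<^bsub>\<M>\<^esub> MAssoc \<M> (Src \<C> f) (Src \<C> g) (Src \<M> h)"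
    and MUnit_nat_iso:
      "is_nat_iso \<M> \<M> (\<lambda>M. Unit \<C> \<rhd>\<^sub>o\<^bsub>\<M>\<^esub> M) (\<lambda>f. Idn \<C> (Unit \<C>) \<rhd>\<^sub>a\<^bsub>\<M>\<^esub> f) (\<lambda>M. M) (\<lambda>f. f) (MUnit \<M>)"
    and module_pentagon:
      "(Idn \<C> X \<rhd>\<^sub>a\<^bsub>\<M>\<^esub> MAssoc \<M> Y Z M) \<cdot>\<^bsub>\<M>\<^esub> MAssoc \<M> X (Y \<otimes>\<^sub>o Z) M \<cdot>\<^bsub>\<M>\<^esub>
         (Assoc \<C> X Y Z \<rhd>\<^sub>a\<^bsub>\<M>\<^esub> Idn \<M> M) =
       MAssoc \<M> X Y (Z \<rhd>\<^sub>o\<^bsub>\<M>\<^esub> M) \<cdot>\<^bsub>\<M>\<^esub> MAssoc \<M> (X \<otimes>\<^sub>o Y) Z M"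
    and module_triangle:
      "(Idn \<C> X \<rhd>\<^sub>a\<^bsub>\<M>\<^esub> MUnit \<M> M) \<cdot>\<^bsub>\<M>\<^esub> MAssoc \<M> X (Unit \<C>) M = RUnit \<C> X \<rhd>\<^sub>a\<^bsub>\<M>\<^esub> Idn \<M> M"

locale finite_module_category =
  \<C>: finite_tensor_category \<C> + \<M>: finite_abelian_category \<M> + module_category \<C> \<M>
  for \<C> :: "('o, 'a, 'k::field, 'z) rigid_cat_scheme" (structure)
    and \<M> :: "('p, 'b, 'k, 'o, 'a, 'y) mod_cat_scheme" (structure) +
  assumes Act_bilinear: "is_bilinear \<C> \<M> \<M> (ActA \<M>)"
    and Act_right_exact_left: "right_exact \<C> \<M> (\<lambda>f. f \<rhd>\<^sub>a\<^bsub>\<M>\<^esub> Idn \<M> M)"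
    and Act_right_exact_right: "right_exact \<M> \<M> (\<lambda>f. Idn \<C> X \<rhd>\<^sub>a\<^bsub>\<M>\<^esub> f)"

locale exact_module_category = finite_module_category \<C> \<M>
  for \<C> :: "('o, 'a, 'k::field, 'z) rigid_cat_scheme" (structure)
    and \<M> :: "('p, 'b, 'k, 'o, 'a, 'y) mod_cat_scheme" (structure) +
  assumes Act_projective: "projective \<C> P \<Longrightarrow> projective \<M> (P \<rhd>\<^sub>o\<^bsub>\<M>\<^esub> M)"

text \<open>
  A choice of internal Homs: \<open>IHom M\<close>, \<open>IHomA M\<close> are the object and morphism parts of \<open>[M, -]\<close>, a
  right adjoint of \<open>X \<mapsto> X \<rhd> M\<close> with unit \<open>ICoev X M : X \<rightarrow> [M, X \<rhd> M]\<close> and counit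
  \<open>IEv M N : [M, N] \<rhd> M \<rightarrow> N\<close>.
\<close>

record ('p, 'b, 'k, 'o, 'a) ihom_mod_cat = "('p, 'b, 'k, 'o, 'a) mod_cat" +
  IHom :: "'p \<Rightarrow> 'p \<Rightarrow> 'o"
  IHomA :: "'p \<Rightarrow> 'b \<Rightarrow> 'a"
  ICoev :: "'o \<Rightarrow> 'p \<Rightarrow> 'a"
  IEv :: "'p \<Rightarrow> 'p \<Rightarrow> 'b"

definition has_internal_homs ::
  "('o, 'a, 'k, 'z) mon_cat_scheme \<Rightarrow> ('p, 'b, 'k, 'o, 'a, 'y) ihom_mod_cat_scheme \<Rightarrow> bool" where
  "has_internal_homs \<C> \<M> \<longleftrightarrow>
    (\<forall>M. is_adjunction \<C> \<M> (\<lambda>X. X \<rhd>\<^sub>o\<^bsub>\<M>\<^esub> M) (\<lambda>f. f \<rhd>\<^sub>a\<^bsub>\<M>\<^esub> Idn \<M> M) (IHom \<M> M) (IHomA \<M> M)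
      (\<lambda>X. ICoev \<M> X M) (IEv \<M> M))"

text \<open>The morphism \<open>X \<rightarrow> [M, N]\<close> corresponding to \<open>f : X \<rhd> M \<rightarrow> N\<close>.\<close>

definition imate ::
  "('o, 'a, 'k, 'z) mon_cat_scheme \<Rightarrow> ('p, 'b, 'k, 'o, 'a, 'y) ihom_mod_cat_scheme \<Rightarrow>
    'o \<Rightarrow> 'p \<Rightarrow> 'b \<Rightarrow> 'a" where
  "imate \<C> \<M> X M f = IHomA \<M> M f \<cdot> ICoev \<M> X M"
  for \<C> (structure)

text \<open>The bifunctor \<open>[f, g] : [M', N] \<rightarrow> [M, N']\<close> for \<open>f : M \<rightarrow> M'\<close> and \<open>g : N \<rightarrow> N'\<close>; its
  contravariant part \<open>[f, N]\<close> corresponds to \<open>ev \<circ> (id \<rhd> f) : [M', N] \<rhd> M \<rightarrow> N\<close>.\<close>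

definition IHomBi ::
  "('o, 'a, 'k, 'z) mon_cat_scheme \<Rightarrow> ('p, 'b, 'k, 'o, 'a, 'y) ihom_mod_cat_scheme \<Rightarrow>
    'b \<Rightarrow> 'b \<Rightarrow> 'a" where
  "IHomBi \<C> \<M> f g =
    IHomA \<M> (Src \<M> f) g \<cdot>
    imate \<C> \<M> (IHom \<M> (Tgt \<M> f) (Src \<M> g)) (Src \<M> f)
      (IEv \<M> (Tgt \<M> f) (Src \<M> g) \<cdot>\<^bsub>\<M>\<^esub> (Idn \<C> (IHom \<M> (Tgt \<M> f) (Src \<M> g)) \<rhd>\<^sub>a\<^bsub>\<M>\<^esub> f))"
  for \<C> (structure)

text \<open>\<open>X \<otimes> [M, N] \<rightarrow> [M, X \<rhd> N]\<close>\<close>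

definition ihom_a ::
  "('o, 'a, 'k, 'z) mon_cat_scheme \<Rightarrow> ('p, 'b, 'k, 'o, 'a, 'y) ihom_mod_cat_scheme \<Rightarrow>
    'o \<Rightarrow> 'p \<Rightarrow> 'p \<Rightarrow> 'a" where
  "ihom_a \<C> \<M> X M N =
    imate \<C> \<M> (X \<otimes>\<^sub>o IHom \<M> M N) M ((Idn \<C> X \<rhd>\<^sub>a\<^bsub>\<M>\<^esub> IEv \<M> M N) \<cdot>\<^bsub>\<M>\<^esub> MAssoc \<M> X (IHom \<M> M N) M)"
  for \<C> (structure)

text \<open>\<open>[X \<rhd> M, N] \<otimes> X \<rightarrow> [M, N]\<close>\<close>

definition ihom_b_nat ::
  "('o, 'a, 'k, 'z) mon_cat_scheme \<Rightarrow> ('p, 'b, 'k, 'o, 'a, 'y) ihom_mod_cat_scheme \<Rightarrow>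
    'o \<Rightarrow> 'p \<Rightarrow> 'p \<Rightarrow> 'a" where
  "ihom_b_nat \<C> \<M> X M N =
    imate \<C> \<M> (IHom \<M> (X \<rhd>\<^sub>o\<^bsub>\<M>\<^esub> M) N \<otimes>\<^sub>o X) M
      (IEv \<M> (X \<rhd>\<^sub>o\<^bsub>\<M>\<^esub> M) N \<cdot>\<^bsub>\<M>\<^esub> MAssoc \<M> (IHom \<M> (X \<rhd>\<^sub>o\<^bsub>\<M>\<^esub> M) N) X M)"
  for \<C> (structure)

text \<open>\<open>[Y \<rhd> M, N] \<rightarrow> [M, N] \<otimes> Y\<^sup>*\<close>\<close>

definition ihom_b ::
  "('o, 'a, 'k, 'z) rigid_cat_scheme \<Rightarrow> ('p, 'b, 'k, 'o, 'a, 'y) ihom_mod_cat_scheme \<Rightarrow>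
    'o \<Rightarrow> 'p \<Rightarrow> 'p \<Rightarrow> 'a" where
  "ihom_b \<C> \<M> Y M N =
    (let H = IHom \<M> (Y \<rhd>\<^sub>o\<^bsub>\<M>\<^esub> M) N in
      (ihom_b_nat \<C> \<M> Y M N \<otimes>\<^sub>a Idn \<C> (Dual \<C> Y)) \<cdot> Inv \<C> (Assoc \<C> H Y (Dual \<C> Y)) \<cdot>
      (Idn \<C> H \<otimes>\<^sub>a Coev \<C> Y) \<cdot> Inv \<C> (RUnit \<C> H))"
  for \<C> (structure)

text \<open>\<open>(X \<otimes> [M, N]) \<otimes> Y\<^sup>* \<rightarrow> [Y \<rhd> M, X \<rhd> N]\<close>\<close>

definition ihom_c ::
  "('o, 'a, 'k, 'z) rigid_cat_scheme \<Rightarrow> ('p, 'b, 'k, 'o, 'a, 'y) ihom_mod_cat_scheme \<Rightarrow>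
    'o \<Rightarrow> 'p \<Rightarrow> 'p \<Rightarrow> 'o \<Rightarrow> 'a" where
  "ihom_c \<C> \<M> X M N Y =
    Inv \<C> (ihom_b \<C> \<M> Y M (X \<rhd>\<^sub>o\<^bsub>\<M>\<^esub> N)) \<cdot> (ihom_a \<C> \<M> X M N \<otimes>\<^sub>a Idn \<C> (Dual \<C> Y))"
  for \<C> (structure)


section \<open>Relative Serre functors and pivotal module categories\<close>

text \<open>
  The fields hold the relative Serre functor \<open>S\<close> (\<open>SerO\<close>, \<open>SerA\<close>), the isomorphism
  \<open>SerD M N : [M, N]\<^sup>* \<rightarrow> [N, S M]\<close>, the twisted module structure
  \<open>SerZ X M : X\<^sup>*\<^sup>* \<rhd> S M \<rightarrow> S (X \<rhd> M)\<close> and the pivotal structure \<open>MPiv M : M \<rightarrow> S M\<close>.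
\<close>

record ('p, 'b, 'k, 'o, 'a) pivotal_mod_cat = "('p, 'b, 'k, 'o, 'a) ihom_mod_cat" +
  SerO :: "'p \<Rightarrow> 'p"
  SerA :: "'b \<Rightarrow> 'b"
  SerD :: "'p \<Rightarrow> 'p \<Rightarrow> 'a"
  SerZ :: "'o \<Rightarrow> 'p \<Rightarrow> 'b"
  MPiv :: "'p \<Rightarrow> 'b"

text \<open>The bracketed form \<open>(Y\<^sup>*\<^sup>* \<otimes> H\<^sup>*) \<otimes> X\<^sup>* \<rightarrow> ((X \<otimes> H) \<otimes> Y\<^sup>*)\<^sup>*\<close> of the canonical isomorphism
  between the dual of a product and the product of the duals.\<close>

definition dual_ten3 :: "('o, 'a, 'k, 'z) rigid_cat_scheme \<Rightarrow> 'o \<Rightarrow> 'o \<Rightarrow> 'o \<Rightarrow> 'a" where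
  "dual_ten3 \<C> X H Y =
    dual_ten \<C> (X \<otimes>\<^sub>o H) (Dual \<C> Y) \<cdot>
    (Idn \<C> (Dual \<C> (Dual \<C> Y)) \<otimes>\<^sub>a dual_ten \<C> X H) \<cdot>
    Assoc \<C> (Dual \<C> (Dual \<C> Y)) (Dual \<C> H) (Dual \<C> X)"
  for \<C> (structure)

locale relative_serre_functor = exact_module_category \<C> \<M>
  for \<C> :: "('o, 'a, 'k::field, 'z) rigid_cat_scheme" (structure)
    and \<M> :: "('p, 'b, 'k, 'o, 'a, 'y) pivotal_mod_cat_scheme" (structure) +
  assumes internal_homs: "has_internal_homs \<C> \<M>"
    and Ser_functor: "is_functor \<M> \<M> (SerO \<M>) (SerA \<M>)"
    and SerD_Hom: "SerD \<M> M N \<in> Hom \<C> (Dual \<C> (IHom \<M> M N)) (IHom \<M> N (SerO \<M> M))"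
    and SerD_iso: "is_isomorphism \<C> (SerD \<M> M N)"
    and SerD_natural:
      "SerD \<M> (Tgt \<M> f) (Src \<M> g) \<cdot> DualA \<C> (IHomBi \<C> \<M> f g) =
       IHomBi \<C> \<M> g (SerA \<M> f) \<cdot> SerD \<M> (Src \<M> f) (Tgt \<M> g)"
    and SerZ_Hom:
      "SerZ \<M> X M \<in> Hom \<M> (Dual \<C> (Dual \<C> X) \<rhd>\<^sub>o\<^bsub>\<M>\<^esub> SerO \<M> M) (SerO \<M> (X \<rhd>\<^sub>o\<^bsub>\<M>\<^esub> M))"
    and SerZ_iso: "is_isomorphism \<M> (SerZ \<M> X M)"
    and SerZ_natural:
      "SerZ \<M> (Tgt \<C> h) (Tgt \<M> g) \<cdot>\<^bsub>\<M>\<^esub> (DualA \<C> (DualA \<C> h) \<rhd>\<^sub>a\<^bsub>\<M>\<^esub> SerA \<M> g) =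
       SerA \<M> (h \<rhd>\<^sub>a\<^bsub>\<M>\<^esub> g) \<cdot>\<^bsub>\<M>\<^esub> SerZ \<M> (Src \<C> h) (Src \<M> g)"
    and SerZ_ten:
      "SerA \<M> (MAssoc \<M> X Y M) \<cdot>\<^bsub>\<M>\<^esub> SerZ \<M> (X \<otimes>\<^sub>o Y) M \<cdot>\<^bsub>\<M>\<^esub>
         (ddual_ten \<C> X Y \<rhd>\<^sub>a\<^bsub>\<M>\<^esub> Idn \<M> (SerO \<M> M)) =
       SerZ \<M> X (Y \<rhd>\<^sub>o\<^bsub>\<M>\<^esub> M) \<cdot>\<^bsub>\<M>\<^esub> (Idn \<C> (Dual \<C> (Dual \<C> X)) \<rhd>\<^sub>a\<^bsub>\<M>\<^esub> SerZ \<M> Y M) \<cdot>\<^bsub>\<M>\<^esub>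
         MAssoc \<M> (Dual \<C> (Dual \<C> X)) (Dual \<C> (Dual \<C> Y)) (SerO \<M> M)"
    and SerZ_unit:
      "SerA \<M> (MUnit \<M> M) \<cdot>\<^bsub>\<M>\<^esub> SerZ \<M> (Unit \<C>) M \<cdot>\<^bsub>\<M>\<^esub> (ddual_unit \<C> \<rhd>\<^sub>a\<^bsub>\<M>\<^esub> Idn \<M> (SerO \<M> M)) =
       MUnit \<M> (SerO \<M> M)"
    and SerD_bimodule:
      "SerD \<M> (Y \<rhd>\<^sub>o\<^bsub>\<M>\<^esub> M) (X \<rhd>\<^sub>o\<^bsub>\<M>\<^esub> N) \<cdot> Inv \<C> (DualA \<C> (ihom_c \<C> \<M> X M N Y)) \<cdot>
         dual_ten3 \<C> X (IHom \<M> M N) Y =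
       IHomBi \<C> \<M> (Idn \<M> (X \<rhd>\<^sub>o\<^bsub>\<M>\<^esub> N)) (SerZ \<M> Y M) \<cdot>
         ihom_c \<C> \<M> (Dual \<C> (Dual \<C> Y)) N (SerO \<M> M) X \<cdot>
         ((Idn \<C> (Dual \<C> (Dual \<C> Y)) \<otimes>\<^sub>a SerD \<M> M N) \<otimes>\<^sub>a Idn \<C> (Dual \<C> X))"

locale pivotal_module_category =
  \<C>: pivotal_finite_tensor_category \<C> + relative_serre_functor \<C> \<M>
  for \<C> :: "('o, 'a, 'k::field, 'z) pivotal_cat_scheme" (structure)
    and \<M> :: "('p, 'b, 'k, 'o, 'a, 'y) pivotal_mod_cat_scheme" (structure) +
  assumes MPiv_nat_iso: "is_nat_iso \<M> \<M> (\<lambda>M. M) (\<lambda>f. f) (SerO \<M>) (SerA \<M>) (MPiv \<M>)"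
    and MPiv_act: "MPiv \<M> (X \<rhd>\<^sub>o\<^bsub>\<M>\<^esub> M) = SerZ \<M> X M \<cdot>\<^bsub>\<M>\<^esub> (Piv \<C> X \<rhd>\<^sub>a\<^bsub>\<M>\<^esub> MPiv \<M> M)"


section \<open>Class functions and internal characters\<close>

text \<open>A choice of the ends \<open>Z V = \<integral>\<^sub>X (X \<otimes> V) \<otimes> X\<^sup>*\<close> with universal dinatural transformations
  \<open>\<pi>Z V X\<close>.\<close>

definition is_central_end ::
  "('o, 'a, 'k, 'z) rigid_cat_scheme \<Rightarrow> ('o \<Rightarrow> 'o) \<Rightarrow> ('o \<Rightarrow> 'o \<Rightarrow> 'a) \<Rightarrow> bool" where
  "is_central_end \<C> Z \<pi>Z \<longleftrightarrow>
    (\<forall>V. is_end \<C> \<C> (\<lambda>X Y. (Y \<otimes>\<^sub>o V) \<otimes>\<^sub>o Dual \<C> X) (\<lambda>f g. (g \<otimes>\<^sub>a Idn \<C> V) \<otimes>\<^sub>a DualA \<C> f) (Z V) (\<pi>Z V))"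
  for \<C> (structure)

definition ZA ::
  "('o, 'a, 'k, 'z) rigid_cat_scheme \<Rightarrow> ('o \<Rightarrow> 'o) \<Rightarrow> ('o \<Rightarrow> 'o \<Rightarrow> 'a) \<Rightarrow> 'a \<Rightarrow> 'a" where
  "ZA \<C> Z \<pi>Z g =
    (THE h. h \<in> Hom \<C> (Z (Src \<C> g)) (Z (Tgt \<C> g)) \<and>
      (\<forall>X. \<pi>Z (Tgt \<C> g) X \<cdot> h = ((Idn \<C> X \<otimes>\<^sub>a g) \<otimes>\<^sub>a Idn \<C> (Dual \<C> X)) \<cdot> \<pi>Z (Src \<C> g) X))"
  for \<C> (structure)

definition half_braiding ::
  "('o, 'a, 'k, 'z) mon_cat_scheme \<Rightarrow> 'o \<Rightarrow> ('o \<Rightarrow> 'a) \<Rightarrow> bool" where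
  "half_braiding \<C> A \<sigma> \<longleftrightarrow>
    is_nat_iso \<C> \<C> (\<lambda>X. A \<otimes>\<^sub>o X) (\<lambda>f. Idn \<C> A \<otimes>\<^sub>a f) (\<lambda>X. X \<otimes>\<^sub>o A) (\<lambda>f. f \<otimes>\<^sub>a Idn \<C> A) \<sigma> \<and>
    (\<forall>X Y. \<sigma> (X \<otimes>\<^sub>o Y) =
      Inv \<C> (Assoc \<C> X Y A) \<cdot> (Idn \<C> X \<otimes>\<^sub>a \<sigma> Y) \<cdot> Assoc \<C> X A Y \<cdot> (\<sigma> X \<otimes>\<^sub>a Idn \<C> Y) \<cdot>
      Inv \<C> (Assoc \<C> A X Y))"
  for \<C> (structure)

text \<open>A choice of the end \<open>A = \<integral>\<^sub>M [M, M]\<close> with universal dinatural transformation \<open>\<pi>\<close>, together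
  with its canonical half-braiding \<open>\<sigma>\<close>, which is uniquely determined by \<open>\<pi>\<close>.\<close>

definition is_class_function_end ::
  "('o, 'a, 'k, 'z) rigid_cat_scheme \<Rightarrow> ('p, 'b, 'k, 'o, 'a, 'y) ihom_mod_cat_scheme \<Rightarrow>
    'o \<Rightarrow> ('p \<Rightarrow> 'a) \<Rightarrow> ('o \<Rightarrow> 'a) \<Rightarrow> bool" where
  "is_class_function_end \<C> \<M> A \<pi> \<sigma> \<longleftrightarrow>
    is_end \<M> \<C> (IHom \<M>) (IHomBi \<C> \<M>) A \<pi> \<and>
    half_braiding \<C> A \<sigma> \<and>
    (\<forall>X M. ihom_a \<C> \<M> X M M \<cdot> (Idn \<C> X \<otimes>\<^sub>a \<pi> M) \<cdot> \<sigma> X =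
      ihom_b_nat \<C> \<M> X M (X \<rhd>\<^sub>o\<^bsub>\<M>\<^esub> M) \<cdot> (\<pi> (X \<rhd>\<^sub>o\<^bsub>\<M>\<^esub> M) \<otimes>\<^sub>a Idn \<C> X))"
  for \<C> (structure)

text \<open>\<open>CF \<C> A\<close> is the space of class functions on the module category whose end is \<open>A\<close>.\<close>

definition CF :: "('o, 'a, 'k, 'z) mon_cat_scheme \<Rightarrow> 'o \<Rightarrow> 'a set" where
  "CF \<C> A = Hom \<C> A (Unit \<C>)"

definition cf_delta ::
  "('o, 'a, 'k, 'z) rigid_cat_scheme \<Rightarrow> ('o \<Rightarrow> 'o) \<Rightarrow> ('o \<Rightarrow> 'o \<Rightarrow> 'a) \<Rightarrow> 'o \<Rightarrow> ('o \<Rightarrow> 'a) \<Rightarrow> 'a" where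
  "cf_delta \<C> Z \<pi>Z A \<sigma> =
    (THE h. h \<in> Hom \<C> A (Z A) \<and>
      (\<forall>X. \<pi>Z A X \<cdot> h =
        (\<sigma> X \<otimes>\<^sub>a Idn \<C> (Dual \<C> X)) \<cdot> Inv \<C> (Assoc \<C> A X (Dual \<C> X)) \<cdot>
        (Idn \<C> A \<otimes>\<^sub>a Coev \<C> X) \<cdot> Inv \<C> (RUnit \<C> A)))"
  for \<C> (structure)

text \<open>The product of \<open>f \<in> Hom (Z 1) 1\<close> and \<open>g \<in> Hom A 1\<close>.\<close>

definition cf_star ::
  "('o, 'a, 'k, 'z) rigid_cat_scheme \<Rightarrow> ('o \<Rightarrow> 'o) \<Rightarrow> ('o \<Rightarrow> 'o \<Rightarrow> 'a) \<Rightarrow> 'o \<Rightarrow> ('o \<Rightarrow> 'a) \<Rightarrow>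
    'a \<Rightarrow> 'a \<Rightarrow> 'a" where
  "cf_star \<C> Z \<pi>Z A \<sigma> f g = f \<cdot> ZA \<C> Z \<pi>Z g \<cdot> cf_delta \<C> Z \<pi>Z A \<sigma>"
  for \<C> (structure)

definition tr_C :: "('o, 'a, 'k, 'z) pivotal_cat_scheme \<Rightarrow> 'o \<Rightarrow> 'a" where
  "tr_C \<C> X = Ev \<C> (Dual \<C> X) \<cdot> (Piv \<C> X \<otimes>\<^sub>a Idn \<C> (Dual \<C> X))"
  for \<C> (structure)

text \<open>For the regular module category \<open>[X, Y] = Y \<otimes> X\<^sup>*\<close>, and the end \<open>\<integral>\<^sub>X [X, X]\<close> is \<open>Z 1\<close> with
  dinatural transformation \<open>Z 1 \<rightarrow> (X \<otimes> 1) \<otimes> X\<^sup>* \<rightarrow> X \<otimes> X\<^sup>*\<close>.\<close>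

definition pi_C :: "('o, 'a, 'k, 'z) rigid_cat_scheme \<Rightarrow> ('o \<Rightarrow> 'o \<Rightarrow> 'a) \<Rightarrow> 'o \<Rightarrow> 'a" where
  "pi_C \<C> \<pi>Z X = (RUnit \<C> X \<otimes>\<^sub>a Idn \<C> (Dual \<C> X)) \<cdot> \<pi>Z (Unit \<C>) X"
  for \<C> (structure)

definition ch_C :: "('o, 'a, 'k, 'z) pivotal_cat_scheme \<Rightarrow> ('o \<Rightarrow> 'o \<Rightarrow> 'a) \<Rightarrow> 'o \<Rightarrow> 'a" where
  "ch_C \<C> \<pi>Z X = tr_C \<C> X \<cdot> pi_C \<C> \<pi>Z X"
  for \<C> (structure)

text \<open>The dual of a morphism \<open>t : [M, M] \<rightarrow> 1\<close> starts at \<open>1\<^sup>*\<close>, and the unit at \<open>1\<close> of the internal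
  Hom adjunction ends at \<open>[M, 1 \<rhd> M]\<close>; \<open>dual_unit\<close> and \<open>MUnit\<close> make the two sides comparable.\<close>

definition tr_M ::
  "('o, 'a, 'k, 'z) rigid_cat_scheme \<Rightarrow> ('p, 'b, 'k, 'o, 'a, 'y) pivotal_mod_cat_scheme \<Rightarrow> 'p \<Rightarrow> 'a"
  where
  "tr_M \<C> \<M> M =
    (THE t. t \<in> Hom \<C> (IHom \<M> M M) (Unit \<C>) \<and>
      SerD \<M> M M \<cdot> DualA \<C> t \<cdot> dual_unit \<C> =
      IHomBi \<C> \<M> (Idn \<M> M) (MPiv \<M> M) \<cdot> IHomA \<M> M (MUnit \<M> M) \<cdot> ICoev \<M> (Unit \<C>) M)"
  for \<C> (structure)

definition ch_M ::
  "('o, 'a, 'k, 'z) rigid_cat_scheme \<Rightarrow> ('p, 'b, 'k, 'o, 'a, 'y) pivotal_mod_cat_scheme \<Rightarrow>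
    ('p \<Rightarrow> 'a) \<Rightarrow> 'p \<Rightarrow> 'a"
  where
  "ch_M \<C> \<M> \<pi> M = tr_M \<C> \<M> M \<cdot> \<pi> M"
  for \<C> (structure)

end

theory Submission
  imports Defs
begin

text \<open>
  The identity reduces to one between traces. The internal Homs identify
  \<open>X \<otimes> [M, M] \<otimes> X\<^sup>*\<close> with \<open>[X \<rhd> M, X \<rhd> M]\<close> through the isomorphism \<open>\<cc>\<close> (\<open>ihom_c\<close>), and under this
  identification the trace of \<open>X \<rhd> M\<close> is the nested trace: first apply the trace of \<open>M\<close> to the middle
  factor, then the trace of \<open>X\<close> to \<open>X \<otimes> X\<^sup>*\<close> (\<open>tr_M_act\<close>).

  To see this, dualize: a functional on \<open>H\<close> is the same as a point \<open>1 \<rightarrow> H\<^sup>*\<close>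
  (\<open>dual_functional_unique\<close>), and the trace of \<open>M\<close> is by definition the functional whose point is
  carried by \<open>\<dd> : [M, M]\<^sup>* \<simeq> [M, S M]\<close> to the point of the pivotal structure \<open>M \<rightarrow> S M\<close>. The point of
  the nested trace consists of \<open>coev_X\<close>, with the pivotal structure of \<open>X\<close> on its left leg, and the
  point of the trace of \<open>M\<close> between its legs (\<open>dual_ten_functional\<close>, \<open>dual_ten_Coev\<close>). As \<open>\<dd>\<close> is a map
  of bimodule functors, it sends this to the same picture with the point of \<open>M \<rightarrow> S M\<close> in the middle,
  mapped into \<open>[X \<rhd> M, S (X \<rhd> M)]\<close> by \<open>\<cc>\<close> and \<open>\<zeta>\<close>. The result is the point of
  \<open>\<zeta> \<cdot> (j_X \<rhd> j'_M)\<close> (\<open>ihom_c_point\<close>), which is \<open>j'\<close> at \<open>X \<rhd> M\<close> because the module category is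
  pivotal.

  For the product of characters, the universal properties of the ends express the star product with
  \<open>ch_C X\<close> as a composite: \<open>coev_X\<close> and the half-braiding \<open>\<sigma> X\<close> map \<open>A\<close> to \<open>X \<otimes> A \<otimes> X\<^sup>*\<close>, then \<open>\<pi> M\<close> maps
  this to \<open>X \<otimes> [M, M] \<otimes> X\<^sup>*\<close>, and the nested trace is applied (\<open>cf_star_component\<close>). The equation that
  determines \<open>\<sigma>\<close> says that \<open>\<cc>\<close> turns what precedes the trace into \<open>\<pi> (X \<rhd> M)\<close>, and the trace of
  \<open>X \<rhd> M\<close> remains.

  The foundation is the adjunction between acting by \<open>X\<^sup>*\<close> and acting by \<open>X\<close> on a module category
  (\<open>lunmate_lmate\<close>, \<open>lmate_lunmate\<close>). Applied to the regular module of the category it gives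
  transposition from the left, and applied to the reversed category, transposition from the right.
  Together with the internal Hom adjunction it shows that \<open>ihom_a\<close> and \<open>ihom_b\<close>, and hence \<open>\<cc>\<close>, are
  isomorphisms.
\<close>

section \<open>Calculus of composites and inverses\<close>

context linear_category
begin

lemma HomI: "\<lbrakk>Src \<C> f = X; Tgt \<C> f = Y\<rbrakk> \<Longrightarrow> f \<in> Hom \<C> X Y"
  by (simp add: Hom_def)

lemma Src_Idn [simp]: "Src \<C> (Idn \<C> X) = X" and Tgt_Idn [simp]: "Tgt \<C> (Idn \<C> X) = X"
  using Idn_Hom by (auto simp: Hom_def)

lemma Src_Cmp [simp]: "Tgt \<C> f = Src \<C> g \<Longrightarrow> Src \<C> (g \<cdot> f) = Src \<C> f"
  and Tgt_Cmp [simp]: "Tgt \<C> f = Src \<C> g \<Longrightarrow> Tgt \<C> (g \<cdot> f) = Tgt \<C> g"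
  using Cmp_Hom[of f _ _ g] by (auto simp: Hom_def)

lemma Idn_Cmp [simp]: "Tgt \<C> f = Y \<Longrightarrow> Idn \<C> Y \<cdot> f = f"
  and Cmp_Idn [simp]: "Src \<C> f = X \<Longrightarrow> f \<cdot> Idn \<C> X = f"
  using Idn_left Idn_right by (auto simp: Hom_def)

lemma Cmp_assoc_right [simp]:
  "\<lbrakk>Tgt \<C> f = Src \<C> g; Tgt \<C> g = Src \<C> h\<rbrakk> \<Longrightarrow> (h \<cdot> g) \<cdot> f = h \<cdot> g \<cdot> f"
  using Cmp_assoc by (auto simp: Hom_def)

text \<open>Composites are kept nested to the right; this makes an equation between composites of two
  morphisms applicable in the middle of a longer composite.\<close>

lemma Cmp_reassoc:
  "\<lbrakk>g \<cdot> f = g' \<cdot> f'; Tgt \<C> k = Src \<C> f; Src \<C> f' = Src \<C> f; Tgt \<C> f = Src \<C> g; Tgt \<C> f' = Src \<C> g'\<rbrakk>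
    \<Longrightarrow> g \<cdot> f \<cdot> k = g' \<cdot> f' \<cdot> k"
  by (metis Cmp_assoc_right)

lemma Cmp_reassoc1:
  "\<lbrakk>g \<cdot> f = h; Tgt \<C> k = Src \<C> f; Tgt \<C> f = Src \<C> g\<rbrakk> \<Longrightarrow> g \<cdot> f \<cdot> k = h \<cdot> k"
  by (metis Cmp_assoc_right)

lemma is_inverse_unique:
  assumes "is_inverse \<C> f g" and "is_inverse \<C> f g'"
  shows "g = g'"
proof -
  have "g = g \<cdot> f \<cdot> g'"
    using assms by (simp add: is_inverse_def Hom_def)
  also have "\<dots> = g'"
    using assms by (subst Cmp_assoc_right[symmetric]) (auto simp: is_inverse_def Hom_def)
  finally show ?thesis .
qed

lemma Inv_eqI: "is_inverse \<C> f g \<Longrightarrow> Inv \<C> f = g"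
  unfolding Inv_def using is_inverse_unique by blast

lemma is_inverse_Inv: "is_isomorphism \<C> f \<Longrightarrow> is_inverse \<C> f (Inv \<C> f)"
  using Inv_eqI by (auto simp: is_isomorphism_def)

lemma
  assumes "is_isomorphism \<C> f"
  shows Src_Inv: "Src \<C> (Inv \<C> f) = Tgt \<C> f" and Tgt_Inv: "Tgt \<C> (Inv \<C> f) = Src \<C> f"
    and Inv_Cmp: "Inv \<C> f \<cdot> f = Idn \<C> (Src \<C> f)" and Cmp_Inv: "f \<cdot> Inv \<C> f = Idn \<C> (Tgt \<C> f)"
  using is_inverse_Inv[OF assms] by (auto simp: is_inverse_def Hom_def)

lemma
  assumes "is_isomorphism \<C> f"
  shows Inv_Cmp_Cmp: "Tgt \<C> k = Src \<C> f \<Longrightarrow> Inv \<C> f \<cdot> f \<cdot> k = k"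
    and Cmp_Inv_Cmp: "Tgt \<C> k = Tgt \<C> f \<Longrightarrow> f \<cdot> Inv \<C> f \<cdot> k = k"
  using assms
  by (auto simp: Src_Inv Tgt_Inv Inv_Cmp Cmp_Inv simp flip: Cmp_assoc_right)

lemmas iso_simps = Src_Inv Tgt_Inv Inv_Cmp Cmp_Inv Inv_Cmp_Cmp Cmp_Inv_Cmp

lemma is_inverse_isomorphism: "is_inverse \<C> f g \<Longrightarrow> is_isomorphism \<C> f"
  by (auto simp: is_isomorphism_def)

lemma is_inverse_sym: "is_inverse \<C> f g \<Longrightarrow> is_inverse \<C> g f"
  by (auto simp: is_inverse_def Hom_def)

lemma iso_Inv: "is_isomorphism \<C> f \<Longrightarrow> is_isomorphism \<C> (Inv \<C> f)"
  using is_inverse_Inv is_inverse_sym is_inverse_isomorphism by blast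

lemma Inv_Inv: "is_isomorphism \<C> f \<Longrightarrow> Inv \<C> (Inv \<C> f) = f"
  using is_inverse_Inv is_inverse_sym Inv_eqI by blast

lemma
  assumes "is_isomorphism \<C> f" "is_isomorphism \<C> g" "Tgt \<C> f = Src \<C> g"
  shows Inv_Cmp_distrib: "Inv \<C> (g \<cdot> f) = Inv \<C> f \<cdot> Inv \<C> g"
    and iso_Cmp: "is_isomorphism \<C> (g \<cdot> f)"
proof -
  have "is_inverse \<C> (g \<cdot> f) (Inv \<C> f \<cdot> Inv \<C> g)"
    using assms by (simp add: is_inverse_def HomI iso_simps)
  then show "Inv \<C> (g \<cdot> f) = Inv \<C> f \<cdot> Inv \<C> g" "is_isomorphism \<C> (g \<cdot> f)"
    by (simp_all add: Inv_eqI is_inverse_isomorphism)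
qed

lemma iso_cancel_left:
  assumes "is_isomorphism \<C> f" "f \<cdot> g = f \<cdot> h" "Tgt \<C> g = Src \<C> f" "Tgt \<C> h = Src \<C> f"
  shows "g = h"
  by (metis assms Inv_Cmp_Cmp)

lemma iso_cancel_right:
  assumes "is_isomorphism \<C> f" "g \<cdot> f = h \<cdot> f" "Src \<C> g = Tgt \<C> f" "Src \<C> h = Tgt \<C> f"
  shows "g = h"
proof -
  have "g = (g \<cdot> f) \<cdot> Inv \<C> f" "h = (h \<cdot> f) \<cdot> Inv \<C> f"
    using assms(1,3,4) by (simp_all add: iso_simps)
  then show ?thesis using assms(2) by simp
qed

lemma nat_Inv:
  assumes "is_isomorphism \<C> f" "is_isomorphism \<C> f'" "f' \<cdot> g = h \<cdot> f"
    "Src \<C> g = Src \<C> f" "Tgt \<C> g = Src \<C> f'" "Src \<C> h = Tgt \<C> f" "Tgt \<C> h = Tgt \<C> f'"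
  shows "Inv \<C> f' \<cdot> h = g \<cdot> Inv \<C> f"
proof (rule iso_cancel_right[OF assms(1)])
  show "(Inv \<C> f' \<cdot> h) \<cdot> f = (g \<cdot> Inv \<C> f) \<cdot> f"
    using assms by (simp add: iso_simps flip: assms(3))
qed (use assms in \<open>simp_all add: iso_simps\<close>)

text \<open>A right inverse \<open>g\<close> is an inverse as soon as \<open>f \<cdot> h = f\<close> forces \<open>h = id\<close>, because
  \<open>f \<cdot> (g \<cdot> f) = f\<close>. This suits morphisms \<open>f\<close> that are known through the maps \<open>h \<mapsto> f \<cdot> h\<close>.\<close>

lemma iso_of_right_inverse:
  assumes "Src \<C> g = Tgt \<C> f" "Tgt \<C> g = Src \<C> f" "f \<cdot> g = Idn \<C> (Tgt \<C> f)"
    and "\<And>h. \<lbrakk>Src \<C> h = Src \<C> f; Tgt \<C> h = Src \<C> f; f \<cdot> h = f\<rbrakk> \<Longrightarrow> h = Idn \<C> (Src \<C> f)"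
  shows "is_isomorphism \<C> f"
proof -
  have "f \<cdot> g \<cdot> f = f"
    using assms(1-3) by (simp flip: Cmp_assoc_right)
  then have "g \<cdot> f = Idn \<C> (Src \<C> f)"
    using assms by simp
  then show ?thesis
    using assms by (intro is_inverse_isomorphism[of f g]) (simp add: is_inverse_def HomI)
qed

end

section \<open>Monoidal categories and their reversal\<close>

context monoidal_category
begin

lemma Src_Ten [simp]: "Src \<C> (f \<otimes>\<^sub>a g) = Src \<C> f \<otimes>\<^sub>o Src \<C> g"
  and Tgt_Ten [simp]: "Tgt \<C> (f \<otimes>\<^sub>a g) = Tgt \<C> f \<otimes>\<^sub>o Tgt \<C> g"
  and Ten_Idn [simp]: "Idn \<C> X \<otimes>\<^sub>a Idn \<C> Y = Idn \<C> (X \<otimes>\<^sub>o Y)"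
  using Ten_bifunctor by (auto simp: is_bifunctor_def Hom_def)

lemma Ten_Cmp:
  "\<lbrakk>Tgt \<C> f = Src \<C> f'; Tgt \<C> g = Src \<C> g'\<rbrakk> \<Longrightarrow> (f' \<otimes>\<^sub>a g') \<cdot> (f \<otimes>\<^sub>a g) = (f' \<cdot> f) \<otimes>\<^sub>a (g' \<cdot> g)"
  using Ten_bifunctor by (auto simp: is_bifunctor_def)

lemma Ten_Cmp_Cmp:
  "\<lbrakk>Tgt \<C> f = Src \<C> f'; Tgt \<C> g = Src \<C> g'; Tgt \<C> k = Src \<C> f \<otimes>\<^sub>o Src \<C> g\<rbrakk> \<Longrightarrow>
    (f' \<otimes>\<^sub>a g') \<cdot> (f \<otimes>\<^sub>a g) \<cdot> k = ((f' \<cdot> f) \<otimes>\<^sub>a (g' \<cdot> g)) \<cdot> k"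
  by (simp add: Cmp_reassoc1 Ten_Cmp)

lemma Src_Assoc [simp]: "Src \<C> (Assoc \<C> X Y Z) = (X \<otimes>\<^sub>o Y) \<otimes>\<^sub>o Z"
  and Tgt_Assoc [simp]: "Tgt \<C> (Assoc \<C> X Y Z) = X \<otimes>\<^sub>o (Y \<otimes>\<^sub>o Z)"
  using Assoc_Hom by (auto simp: Hom_def)

lemma Src_LUnit [simp]: "Src \<C> (LUnit \<C> X) = Unit \<C> \<otimes>\<^sub>o X"
  and Tgt_LUnit [simp]: "Tgt \<C> (LUnit \<C> X) = X"
  and LUnit_natural: "f \<cdot> LUnit \<C> (Src \<C> f) = LUnit \<C> (Tgt \<C> f) \<cdot> (Idn \<C> (Unit \<C>) \<otimes>\<^sub>a f)"
  and LUnit_iso: "is_isomorphism \<C> (LUnit \<C> X)"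
  using LUnit_nat_iso by (auto simp: is_nat_iso_def is_nat_trans_def Hom_def)

lemma Src_RUnit [simp]: "Src \<C> (RUnit \<C> X) = X \<otimes>\<^sub>o Unit \<C>"
  and Tgt_RUnit [simp]: "Tgt \<C> (RUnit \<C> X) = X"
  and RUnit_natural: "f \<cdot> RUnit \<C> (Src \<C> f) = RUnit \<C> (Tgt \<C> f) \<cdot> (f \<otimes>\<^sub>a Idn \<C> (Unit \<C>))"
  and RUnit_iso: "is_isomorphism \<C> (RUnit \<C> X)"
  using RUnit_nat_iso by (auto simp: is_nat_iso_def is_nat_trans_def Hom_def)

lemmas unit_iso_simps [simp] =
  iso_simps[OF Assoc_iso, simplified] iso_simps[OF LUnit_iso, simplified]
  iso_simps[OF RUnit_iso, simplified]

lemma Inv_Assoc_natural: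
  "Inv \<C> (Assoc \<C> (Tgt \<C> f) (Tgt \<C> g) (Tgt \<C> h)) \<cdot> (f \<otimes>\<^sub>a (g \<otimes>\<^sub>a h)) =
    ((f \<otimes>\<^sub>a g) \<otimes>\<^sub>a h) \<cdot> Inv \<C> (Assoc \<C> (Src \<C> f) (Src \<C> g) (Src \<C> h))"
  by (rule nat_Inv[OF Assoc_iso Assoc_iso Assoc_natural]) simp_all

lemma
  assumes "is_isomorphism \<C> f" "is_isomorphism \<C> g"
  shows iso_Ten: "is_isomorphism \<C> (f \<otimes>\<^sub>a g)"
    and Inv_Ten: "Inv \<C> (f \<otimes>\<^sub>a g) = Inv \<C> f \<otimes>\<^sub>a Inv \<C> g"
proof -
  have "is_inverse \<C> (f \<otimes>\<^sub>a g) (Inv \<C> f \<otimes>\<^sub>a Inv \<C> g)"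
    using assms by (simp add: is_inverse_def HomI iso_simps Ten_Cmp)
  then show "is_isomorphism \<C> (f \<otimes>\<^sub>a g)" "Inv \<C> (f \<otimes>\<^sub>a g) = Inv \<C> f \<otimes>\<^sub>a Inv \<C> g"
    by (simp_all add: Inv_eqI is_inverse_isomorphism)
qed

lemma iso_Idn: "is_isomorphism \<C> (Idn \<C> X)" and Inv_Idn: "Inv \<C> (Idn \<C> X) = Idn \<C> X"
  using is_inverse_isomorphism[of "Idn \<C> X" "Idn \<C> X"] Inv_eqI[of "Idn \<C> X" "Idn \<C> X"]
  by (simp_all add: is_inverse_def HomI)

end

text \<open>Reversing the tensor product turns statements about tensoring from the left into statements about
  tensoring from the right, so coherence and duality have to be treated on one side only.\<close>

definition reversed :: "('o, 'a, 'k, 'z) mon_cat_scheme \<Rightarrow> ('o, 'a, 'k) mon_cat" where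
  "reversed \<C> = \<lparr>Src = Src \<C>, Tgt = Tgt \<C>, Idn = Idn \<C>, Cmp = Cmp \<C>, Zer = Zer \<C>, Add = Add \<C>,
     Scl = Scl \<C>, TenO = (\<lambda>X Y. TenO \<C> Y X), TenA = (\<lambda>f g. TenA \<C> g f), Unit = Unit \<C>,
     Assoc = (\<lambda>X Y Z. Inv \<C> (Assoc \<C> Z Y X)), LUnit = RUnit \<C>, RUnit = LUnit \<C>\<rparr>"

definition regular_module :: "('o, 'a, 'k, 'z) mon_cat_scheme \<Rightarrow> ('o, 'a, 'k, 'o, 'a) mod_cat" where
  "regular_module \<C> = \<lparr>Src = Src \<C>, Tgt = Tgt \<C>, Idn = Idn \<C>, Cmp = Cmp \<C>, Zer = Zer \<C>,
     Add = Add \<C>, Scl = Scl \<C>, ActO = TenO \<C>, ActA = TenA \<C>, MAssoc = Assoc \<C>, MUnit = LUnit \<C>\<rparr>"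

lemma reversed_sel [simp]:
  "Src (reversed \<C>) = Src \<C>" "Tgt (reversed \<C>) = Tgt \<C>" "Idn (reversed \<C>) = Idn \<C>"
  "Cmp (reversed \<C>) = Cmp \<C>" "Zer (reversed \<C>) = Zer \<C>" "Add (reversed \<C>) = Add \<C>"
  "Scl (reversed \<C>) = Scl \<C>" "TenO (reversed \<C>) X Y = TenO \<C> Y X"
  "TenA (reversed \<C>) f g = TenA \<C> g f" "Unit (reversed \<C>) = Unit \<C>"
  "Assoc (reversed \<C>) X Y Z = Inv \<C> (Assoc \<C> Z Y X)"
  "LUnit (reversed \<C>) = RUnit \<C>" "RUnit (reversed \<C>) = LUnit \<C>"
  by (simp_all add: reversed_def)

lemma regular_module_sel [simp]:
  "Src (regular_module \<C>) = Src \<C>" "Tgt (regular_module \<C>) = Tgt \<C>"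
  "Idn (regular_module \<C>) = Idn \<C>" "Cmp (regular_module \<C>) = Cmp \<C>"
  "Zer (regular_module \<C>) = Zer \<C>" "Add (regular_module \<C>) = Add \<C>"
  "Scl (regular_module \<C>) = Scl \<C>" "ActO (regular_module \<C>) = TenO \<C>"
  "ActA (regular_module \<C>) = TenA \<C>" "MAssoc (regular_module \<C>) = Assoc \<C>"
  "MUnit (regular_module \<C>) = LUnit \<C>"
  by (simp_all add: regular_module_def)

lemma reversed_linear [simp]:
  "Hom (reversed \<C>) = Hom \<C>" "is_isomorphism (reversed \<C>) = is_isomorphism \<C>"
  "Inv (reversed \<C>) = Inv \<C>"
  by (simp_all add: Hom_def is_inverse_def is_isomorphism_def Inv_def fun_eq_iff)

lemma regular_module_linear [simp]:
  "Hom (regular_module \<C>) = Hom \<C>" "is_isomorphism (regular_module \<C>) = is_isomorphism \<C>"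
  "Inv (regular_module \<C>) = Inv \<C>"
  by (simp_all add: Hom_def is_inverse_def is_isomorphism_def Inv_def fun_eq_iff)

context linear_category
begin

lemma linear_category_cong:
  assumes "Src \<D> = Src \<C>" "Tgt \<D> = Tgt \<C>" "Idn \<D> = Idn \<C>" "Cmp \<D> = Cmp \<C>"
    "Zer \<D> = Zer \<C>" "Add \<D> = Add \<C>" "Scl \<D> = Scl \<C>"
  shows "linear_category \<D>"
proof -
  have [simp]: "Hom \<D> = Hom \<C>" "hom_module \<D> = hom_module \<C>"
    using assms by (simp_all add: Hom_def hom_module_def fun_eq_iff)
  show ?thesis
    by (intro linear_category.intro)
      (simp_all add: assms Idn_Hom Cmp_Hom Idn_left Idn_right Cmp_assoc Hom_module Cmp_Add_left
        Cmp_Add_right Cmp_Scl_left Cmp_Scl_right)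
qed

end

context monoidal_category
begin

lemma module_category_regular: "module_category \<C> (regular_module \<C>)"
proof -
  interpret R: linear_category "regular_module \<C>"
    by (rule linear_category_cong) simp_all
  show ?thesis
  proof unfold_locales
    show "is_bifunctor \<C> (regular_module \<C>) (regular_module \<C>) (ActO (regular_module \<C>))
        (ActA (regular_module \<C>))"
      using Ten_bifunctor by (simp add: is_bifunctor_def)
    show "is_nat_iso (regular_module \<C>) (regular_module \<C>)
       (\<lambda>M. Unit \<C> \<rhd>\<^sub>o\<^bsub>regular_module \<C>\<^esub> M)
       (\<lambda>f. Idn \<C> (Unit \<C>) \<rhd>\<^sub>a\<^bsub>regular_module \<C>\<^esub> f) (\<lambda>M. M) (\<lambda>f. f) (MUnit (regular_module \<C>))"
      using LUnit_nat_iso by (simp add: is_nat_iso_def is_nat_trans_def)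
  qed (simp_all only: regular_module_sel regular_module_linear Assoc_Hom Assoc_iso Assoc_natural
      pentagon triangle)
qed

lemma monoidal_category_reversed: "monoidal_category (reversed \<C>)"
proof -
  interpret R: linear_category "reversed \<C>"
    by (rule linear_category_cong) simp_all
  show ?thesis
  proof unfold_locales
    show "is_bifunctor (reversed \<C>) (reversed \<C>) (reversed \<C>) (TenO (reversed \<C>))
        (TenA (reversed \<C>))"
      using Ten_bifunctor by (simp add: is_bifunctor_def)
    show "is_nat_iso (reversed \<C>) (reversed \<C>) (\<lambda>X. Unit (reversed \<C>) \<otimes>\<^sub>o\<^bsub>reversed \<C>\<^esub> X)
       (\<lambda>f. Idn (reversed \<C>) (Unit (reversed \<C>)) \<otimes>\<^sub>a\<^bsub>reversed \<C>\<^esub> f) (\<lambda>X. X) (\<lambda>f. f) (LUnit (reversed \<C>))"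
      using RUnit_nat_iso by (simp add: is_nat_iso_def is_nat_trans_def)
    show "is_nat_iso (reversed \<C>) (reversed \<C>) (\<lambda>X. X \<otimes>\<^sub>o\<^bsub>reversed \<C>\<^esub> Unit (reversed \<C>))
       (\<lambda>f. f \<otimes>\<^sub>a\<^bsub>reversed \<C>\<^esub> Idn (reversed \<C>) (Unit (reversed \<C>))) (\<lambda>X. X) (\<lambda>f. f) (RUnit (reversed \<C>))"
      using LUnit_nat_iso by (simp add: is_nat_iso_def is_nat_trans_def)
    fix X Y Z W
    show "Assoc (reversed \<C>) X Y Z \<in> Hom (reversed \<C>) ((X \<otimes>\<^sub>o\<^bsub>reversed \<C>\<^esub> Y) \<otimes>\<^sub>o\<^bsub>reversed \<C>\<^esub> Z)
        (X \<otimes>\<^sub>o\<^bsub>reversed \<C>\<^esub> (Y \<otimes>\<^sub>o\<^bsub>reversed \<C>\<^esub> Z))"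
      by (simp add: HomI)
    show "is_isomorphism (reversed \<C>) (Assoc (reversed \<C>) X Y Z)"
      by (simp add: iso_Inv Assoc_iso)
    have "Inv \<C> ((Idn \<C> Z \<otimes>\<^sub>a Assoc \<C> Y X W) \<cdot> Assoc \<C> Z (Y \<otimes>\<^sub>o X) W \<cdot> (Assoc \<C> Z Y X \<otimes>\<^sub>a Idn \<C> W)) =
       Inv \<C> (Assoc \<C> Z Y (X \<otimes>\<^sub>o W) \<cdot> Assoc \<C> (Z \<otimes>\<^sub>o Y) X W)"
      by (simp add: pentagon)
    then show "(Idn (reversed \<C>) W \<otimes>\<^sub>a\<^bsub>reversed \<C>\<^esub> Assoc (reversed \<C>) X Y Z) \<cdot>\<^bsub>reversed \<C>\<^esub>
       Assoc (reversed \<C>) W (X \<otimes>\<^sub>o\<^bsub>reversed \<C>\<^esub> Y) Z \<cdot>\<^bsub>reversed \<C>\<^esub>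
       (Assoc (reversed \<C>) W X Y \<otimes>\<^sub>a\<^bsub>reversed \<C>\<^esub> Idn (reversed \<C>) Z) =
       Assoc (reversed \<C>) W X (Y \<otimes>\<^sub>o\<^bsub>reversed \<C>\<^esub> Z) \<cdot>\<^bsub>reversed \<C>\<^esub>
       Assoc (reversed \<C>) (W \<otimes>\<^sub>o\<^bsub>reversed \<C>\<^esub> X) Y Z"
      by (simp add: Inv_Cmp_distrib iso_Cmp iso_Ten Assoc_iso iso_Idn Inv_Ten Inv_Idn)
    show "(Idn (reversed \<C>) X \<otimes>\<^sub>a\<^bsub>reversed \<C>\<^esub> LUnit (reversed \<C>) Y) \<cdot>\<^bsub>reversed \<C>\<^esub>
       Assoc (reversed \<C>) X (Unit (reversed \<C>)) Y =
       RUnit (reversed \<C>) X \<otimes>\<^sub>a\<^bsub>reversed \<C>\<^esub> Idn (reversed \<C>) Y"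
      by (simp flip: triangle)
  next
    fix f g h
    show "Assoc (reversed \<C>) (Tgt (reversed \<C>) f) (Tgt (reversed \<C>) g) (Tgt (reversed \<C>) h) \<cdot>\<^bsub>reversed \<C>\<^esub>
       ((f \<otimes>\<^sub>a\<^bsub>reversed \<C>\<^esub> g) \<otimes>\<^sub>a\<^bsub>reversed \<C>\<^esub> h) =
       (f \<otimes>\<^sub>a\<^bsub>reversed \<C>\<^esub> (g \<otimes>\<^sub>a\<^bsub>reversed \<C>\<^esub> h)) \<cdot>\<^bsub>reversed \<C>\<^esub>
       Assoc (reversed \<C>) (Src (reversed \<C>) f) (Src (reversed \<C>) g) (Src (reversed \<C>) h)"
      by (simp add: Inv_Assoc_natural)
  qed
qed

end

section \<open>Transposition along a dual pair\<close>

context module_category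
begin

abbreviation mcmp (infixr "\<diamond>" 55) where "g \<diamond> f \<equiv> g \<cdot>\<^bsub>\<M>\<^esub> f"
abbreviation act_obj (infix "\<rhd>" 75) where "X \<rhd> M \<equiv> X \<rhd>\<^sub>o\<^bsub>\<M>\<^esub> M"
abbreviation act_arr (infix "\<triangleright>" 75) where "f \<triangleright> g \<equiv> f \<rhd>\<^sub>a\<^bsub>\<M>\<^esub> g"

lemma Src_Act [simp]: "Src \<M> (f \<triangleright> g) = Src \<C> f \<rhd> Src \<M> g"
  and Tgt_Act [simp]: "Tgt \<M> (f \<triangleright> g) = Tgt \<C> f \<rhd> Tgt \<M> g"
  and Act_Idn [simp]: "Idn \<C> X \<triangleright> Idn \<M> M = Idn \<M> (X \<rhd> M)"
  using Act_bifunctor by (auto simp: is_bifunctor_def Hom_def)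

lemma Act_Cmp:
  "\<lbrakk>Tgt \<C> f = Src \<C> f'; Tgt \<M> g = Src \<M> g'\<rbrakk> \<Longrightarrow> (f' \<triangleright> g') \<diamond> (f \<triangleright> g) = (f' \<cdot> f) \<triangleright> (g' \<diamond> g)"
  using Act_bifunctor by (auto simp: is_bifunctor_def)

lemma Act_Cmp_Cmp:
  "\<lbrakk>Tgt \<C> f = Src \<C> f'; Tgt \<M> g = Src \<M> g'; Tgt \<M> k = Src \<C> f \<rhd> Src \<M> g\<rbrakk> \<Longrightarrow>
    (f' \<triangleright> g') \<diamond> (f \<triangleright> g) \<diamond> k = ((f' \<cdot> f) \<triangleright> (g' \<diamond> g)) \<diamond> k"
  by (simp add: \<M>.Cmp_reassoc1 Act_Cmp)

lemma Src_MAssoc [simp]: "Src \<M> (MAssoc \<M> X Y M) = (X \<otimes>\<^sub>o Y) \<rhd> M"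
  and Tgt_MAssoc [simp]: "Tgt \<M> (MAssoc \<M> X Y M) = X \<rhd> (Y \<rhd> M)"
  using MAssoc_Hom by (auto simp: Hom_def)

lemma Src_MUnit [simp]: "Src \<M> (MUnit \<M> M) = Unit \<C> \<rhd> M"
  and Tgt_MUnit [simp]: "Tgt \<M> (MUnit \<M> M) = M"
  and MUnit_natural: "f \<diamond> MUnit \<M> (Src \<M> f) = MUnit \<M> (Tgt \<M> f) \<diamond> (Idn \<C> (Unit \<C>) \<triangleright> f)"
  and MUnit_iso: "is_isomorphism \<M> (MUnit \<M> M)"
  using MUnit_nat_iso by (auto simp: is_nat_iso_def is_nat_trans_def Hom_def)

lemmas module_iso_simps [simp] =
  \<M>.iso_simps[OF MAssoc_iso, simplified] \<M>.iso_simps[OF MUnit_iso, simplified]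

lemma Inv_MAssoc_natural:
  "Inv \<M> (MAssoc \<M> (Tgt \<C> f) (Tgt \<C> g) (Tgt \<M> h)) \<diamond> (f \<triangleright> (g \<triangleright> h)) =
    ((f \<otimes>\<^sub>a g) \<triangleright> h) \<diamond> Inv \<M> (MAssoc \<M> (Src \<C> f) (Src \<C> g) (Src \<M> h))"
  by (rule \<M>.nat_Inv[OF MAssoc_iso MAssoc_iso MAssoc_natural]) simp_all

lemma Inv_MUnit_natural:
  "Inv \<M> (MUnit \<M> (Tgt \<M> f)) \<diamond> f = (Idn \<C> (Unit \<C>) \<triangleright> f) \<diamond> Inv \<M> (MUnit \<M> (Src \<M> f))"
  by (rule \<M>.nat_Inv[OF MUnit_iso MUnit_iso MUnit_natural[symmetric]]) simp_all

lemma
  assumes "is_isomorphism \<C> f" "is_isomorphism \<M> g"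
  shows iso_Act: "is_isomorphism \<M> (f \<triangleright> g)"
    and Inv_Act: "Inv \<M> (f \<triangleright> g) = Inv \<C> f \<triangleright> Inv \<M> g"
proof -
  have "is_inverse \<M> (f \<triangleright> g) (Inv \<C> f \<triangleright> Inv \<M> g)"
    using assms by (simp add: is_inverse_def \<M>.HomI \<C>.iso_simps \<M>.iso_simps Act_Cmp)
  then show "is_isomorphism \<M> (f \<triangleright> g)" "Inv \<M> (f \<triangleright> g) = Inv \<C> f \<triangleright> Inv \<M> g"
    by (simp_all add: \<M>.Inv_eqI \<M>.is_inverse_isomorphism)
qed

lemma iso_Idn_module: "is_isomorphism \<M> (Idn \<M> M)" and Inv_Idn_module: "Inv \<M> (Idn \<M> M) = Idn \<M> M"
  using \<M>.is_inverse_isomorphism[of "Idn \<M> M" "Idn \<M> M"] \<M>.Inv_eqI[of "Idn \<M> M" "Idn \<M> M"]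
  by (simp_all add: is_inverse_def \<M>.HomI)

lemma Unit_act_faithful:
  assumes "Idn \<C> (Unit \<C>) \<triangleright> f = Idn \<C> (Unit \<C>) \<triangleright> g" "Src \<M> f = Src \<M> g" "Tgt \<M> f = Tgt \<M> g"
  shows "f = g"
proof (rule \<M>.iso_cancel_right)
  show "f \<diamond> MUnit \<M> (Src \<M> f) = g \<diamond> MUnit \<M> (Src \<M> f)"
    by (metis MUnit_natural assms)
qed (simp_all add: assms MUnit_iso)

text \<open>Kelly's argument: acting by the unit object is faithful, and after acting by it the claim
  follows from the pentagon and the two triangles.\<close>

lemma MUnit_MAssoc:
  "MUnit \<M> (W \<rhd> M) \<diamond> MAssoc \<M> (Unit \<C>) W M = LUnit \<C> W \<triangleright> Idn \<M> M"
proof (rule Unit_act_faithful)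
  let ?I = "Unit \<C>"
  let ?p = "MAssoc \<M> ?I (?I \<otimes>\<^sub>o W) M \<diamond> (Assoc \<C> ?I ?I W \<triangleright> Idn \<M> M)"
  have "(Idn \<C> ?I \<triangleright> (MUnit \<M> (W \<rhd> M) \<diamond> MAssoc \<M> ?I W M)) \<diamond> ?p
      = (Idn \<C> ?I \<triangleright> MUnit \<M> (W \<rhd> M)) \<diamond> (Idn \<C> ?I \<triangleright> MAssoc \<M> ?I W M) \<diamond> ?p"
    by (simp add: Act_Cmp_Cmp)
  also have "\<dots> = ((Idn \<C> ?I \<triangleright> MUnit \<M> (W \<rhd> M)) \<diamond> MAssoc \<M> ?I ?I (W \<rhd> M)) \<diamond> MAssoc \<M> (?I \<otimes>\<^sub>o ?I) W M"
    by (simp add: module_pentagon)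
  also have "\<dots> = (RUnit \<C> ?I \<triangleright> Idn \<M> (W \<rhd> M)) \<diamond> MAssoc \<M> (?I \<otimes>\<^sub>o ?I) W M"
    by (simp only: module_triangle)
  also have "\<dots> = MAssoc \<M> ?I W M \<diamond> ((RUnit \<C> ?I \<otimes>\<^sub>a Idn \<C> W) \<triangleright> Idn \<M> M)"
    using MAssoc_natural[of "RUnit \<C> ?I" "Idn \<C> W" "Idn \<M> M"] by simp
  also have "\<dots> = MAssoc \<M> ?I W M \<diamond> ((Idn \<C> ?I \<otimes>\<^sub>a LUnit \<C> W) \<triangleright> Idn \<M> M) \<diamond> (Assoc \<C> ?I ?I W \<triangleright> Idn \<M> M)"
    by (simp add: Act_Cmp \<C>.triangle)
  also have "\<dots> = (Idn \<C> ?I \<triangleright> (LUnit \<C> W \<triangleright> Idn \<M> M)) \<diamond> ?p"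
    by (simp add: \<M>.Cmp_reassoc[OF MAssoc_natural[of "Idn \<C> ?I" "LUnit \<C> W" "Idn \<M> M", simplified]])
  finally show "Idn \<C> ?I \<triangleright> (MUnit \<M> (W \<rhd> M) \<diamond> MAssoc \<M> ?I W M) = Idn \<C> ?I \<triangleright> (LUnit \<C> W \<triangleright> Idn \<M> M)"
    by (rule \<M>.iso_cancel_right[rotated])
      (simp_all add: \<M>.iso_Cmp iso_Act MAssoc_iso \<C>.Assoc_iso iso_Idn_module)
qed simp_all

text \<open>If \<open>c : 1 \<rightarrow> X \<otimes> D\<close> and \<open>e : D \<otimes> X \<rightarrow> 1\<close> make \<open>D\<close> a left dual of \<open>X\<close>, acting by \<open>D\<close> is left
  adjoint to acting by \<open>X\<close>; the two functions below are the bijections between the morphisms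
  \<open>D \<rhd> N' \<rightarrow> N\<close> and \<open>N' \<rightarrow> X \<rhd> N\<close>.\<close>

definition lmate :: "'o \<Rightarrow> 'o \<Rightarrow> 'a \<Rightarrow> 'p \<Rightarrow> 'b \<Rightarrow> 'b" where
  "lmate X D c N' g =
    (Idn \<C> X \<triangleright> g) \<diamond> MAssoc \<M> X D N' \<diamond> (c \<triangleright> Idn \<M> N') \<diamond> Inv \<M> (MUnit \<M> N')"

definition lunmate :: "'o \<Rightarrow> 'o \<Rightarrow> 'a \<Rightarrow> 'p \<Rightarrow> 'b \<Rightarrow> 'b" where
  "lunmate X D e N h =
    MUnit \<M> N \<diamond> (e \<triangleright> Idn \<M> N) \<diamond> Inv \<M> (MAssoc \<M> D X N) \<diamond> (Idn \<C> D \<triangleright> h)"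

context
  fixes X D e c
  assumes dual: "is_left_dual \<C> X D e c"
begin

lemma dual_simps [simp]:
  "Src \<C> e = D \<otimes>\<^sub>o X" "Tgt \<C> e = Unit \<C>" "Src \<C> c = Unit \<C>" "Tgt \<C> c = X \<otimes>\<^sub>o D"
  using dual by (auto simp: is_left_dual_def Hom_def)

lemma zigzags:
  "RUnit \<C> X \<cdot> (Idn \<C> X \<otimes>\<^sub>a e) \<cdot> Assoc \<C> X D X \<cdot> (c \<otimes>\<^sub>a Idn \<C> X) = LUnit \<C> X"
  "LUnit \<C> D \<cdot> (e \<otimes>\<^sub>a Idn \<C> D) \<cdot> Inv \<C> (Assoc \<C> D X D) \<cdot> (Idn \<C> D \<otimes>\<^sub>a c) = RUnit \<C> D"
  using dual by (auto simp: is_left_dual_def)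

text \<open>The triangle identities of the adjunction are the two zigzag identities acting on \<open>N\<close>: the pentagon
  and the unit laws move all constraint isomorphisms of the module category out of the way.\<close>

lemma acting_zigzag_D:
  "MUnit \<M> (D \<rhd> N) \<diamond> (e \<triangleright> Idn \<M> (D \<rhd> N)) \<diamond> Inv \<M> (MAssoc \<M> D X (D \<rhd> N)) \<diamond>
    (Idn \<C> D \<triangleright> MAssoc \<M> X D N) \<diamond> (Idn \<C> D \<triangleright> (c \<triangleright> Idn \<M> N)) \<diamond> (Idn \<C> D \<triangleright> Inv \<M> (MUnit \<M> N))
    = Idn \<M> (D \<rhd> N)"
proof -
  have pent: "Inv \<M> (MAssoc \<M> D X (D \<rhd> N)) \<diamond> (Idn \<C> D \<triangleright> MAssoc \<M> X D N)
      = MAssoc \<M> (D \<otimes>\<^sub>o X) D N \<diamond> (Inv \<C> (Assoc \<C> D X D) \<triangleright> Idn \<M> N) \<diamond> Inv \<M> (MAssoc \<M> D (X \<otimes>\<^sub>o D) N)"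
  proof (rule \<M>.iso_cancel_right)
    let ?p = "MAssoc \<M> D (X \<otimes>\<^sub>o D) N \<diamond> (Assoc \<C> D X D \<triangleright> Idn \<M> N)"
    show "is_isomorphism \<M> ?p"
      by (simp add: \<M>.iso_Cmp iso_Act MAssoc_iso \<C>.Assoc_iso iso_Idn_module)
    show "(Inv \<M> (MAssoc \<M> D X (D \<rhd> N)) \<diamond> (Idn \<C> D \<triangleright> MAssoc \<M> X D N)) \<diamond> ?p =
        (MAssoc \<M> (D \<otimes>\<^sub>o X) D N \<diamond> (Inv \<C> (Assoc \<C> D X D) \<triangleright> Idn \<M> N) \<diamond> Inv \<M> (MAssoc \<M> D (X \<otimes>\<^sub>o D) N)) \<diamond> ?p"
      by (simp add: module_pentagon Act_Cmp)
  qed simp_all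
  have tri: "Inv \<M> (MAssoc \<M> D (Unit \<C>) N) \<diamond> (Idn \<C> D \<triangleright> Inv \<M> (MUnit \<M> N)) = Inv \<C> (RUnit \<C> D) \<triangleright> Idn \<M> N"
    using arg_cong[OF module_triangle[of D N], of "Inv \<M>"]
    by (simp add: \<M>.Inv_Cmp_distrib iso_Act Inv_Act MAssoc_iso MUnit_iso \<C>.RUnit_iso
        \<C>.iso_Idn \<C>.Inv_Idn iso_Idn_module Inv_Idn_module)
  have "MUnit \<M> (D \<rhd> N) \<diamond> (e \<triangleright> Idn \<M> (D \<rhd> N)) \<diamond> Inv \<M> (MAssoc \<M> D X (D \<rhd> N)) \<diamond>
      (Idn \<C> D \<triangleright> MAssoc \<M> X D N) \<diamond> (Idn \<C> D \<triangleright> (c \<triangleright> Idn \<M> N)) \<diamond> (Idn \<C> D \<triangleright> Inv \<M> (MUnit \<M> N))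
    = MUnit \<M> (D \<rhd> N) \<diamond> (e \<triangleright> Idn \<M> (D \<rhd> N)) \<diamond> MAssoc \<M> (D \<otimes>\<^sub>o X) D N \<diamond>
      (Inv \<C> (Assoc \<C> D X D) \<triangleright> Idn \<M> N) \<diamond> Inv \<M> (MAssoc \<M> D (X \<otimes>\<^sub>o D) N) \<diamond>
      (Idn \<C> D \<triangleright> (c \<triangleright> Idn \<M> N)) \<diamond> (Idn \<C> D \<triangleright> Inv \<M> (MUnit \<M> N))"
    by (simp add: \<M>.Cmp_reassoc1[OF pent])
  also have "\<dots> = MUnit \<M> (D \<rhd> N) \<diamond> (e \<triangleright> Idn \<M> (D \<rhd> N)) \<diamond> MAssoc \<M> (D \<otimes>\<^sub>o X) D N \<diamond>
      (Inv \<C> (Assoc \<C> D X D) \<triangleright> Idn \<M> N) \<diamond> ((Idn \<C> D \<otimes>\<^sub>a c) \<triangleright> Idn \<M> N) \<diamond> (Inv \<C> (RUnit \<C> D) \<triangleright> Idn \<M> N)"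
    by (simp add: \<M>.Cmp_reassoc[OF Inv_MAssoc_natural[of "Idn \<C> D" c "Idn \<M> N", simplified]] tri)
  also have "\<dots> = MUnit \<M> (D \<rhd> N) \<diamond> MAssoc \<M> (Unit \<C>) D N \<diamond> ((e \<otimes>\<^sub>a Idn \<C> D) \<triangleright> Idn \<M> N) \<diamond>
      (Inv \<C> (Assoc \<C> D X D) \<triangleright> Idn \<M> N) \<diamond> ((Idn \<C> D \<otimes>\<^sub>a c) \<triangleright> Idn \<M> N) \<diamond> (Inv \<C> (RUnit \<C> D) \<triangleright> Idn \<M> N)"
    by (simp add: \<M>.Cmp_reassoc[OF MAssoc_natural[of e "Idn \<C> D" "Idn \<M> N", simplified]])
  also have "\<dots> = (LUnit \<C> D \<cdot> (e \<otimes>\<^sub>a Idn \<C> D) \<cdot> Inv \<C> (Assoc \<C> D X D) \<cdot> (Idn \<C> D \<otimes>\<^sub>a c) \<cdot> Inv \<C> (RUnit \<C> D))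
      \<triangleright> Idn \<M> N"
    by (simp add: \<M>.Cmp_reassoc1[OF MUnit_MAssoc[of D N]] Act_Cmp Act_Cmp_Cmp)
  also have "LUnit \<C> D \<cdot> (e \<otimes>\<^sub>a Idn \<C> D) \<cdot> Inv \<C> (Assoc \<C> D X D) \<cdot> (Idn \<C> D \<otimes>\<^sub>a c) \<cdot> Inv \<C> (RUnit \<C> D)
      = (LUnit \<C> D \<cdot> (e \<otimes>\<^sub>a Idn \<C> D) \<cdot> Inv \<C> (Assoc \<C> D X D) \<cdot> (Idn \<C> D \<otimes>\<^sub>a c)) \<cdot> Inv \<C> (RUnit \<C> D)"
    by simp
  also have "\<dots> = Idn \<C> D"
    by (simp only: zigzags) simp
  finally show ?thesis
    by simp
qed

lemma acting_zigzag_X: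
  "(Idn \<C> X \<triangleright> MUnit \<M> N) \<diamond> (Idn \<C> X \<triangleright> (e \<triangleright> Idn \<M> N)) \<diamond> (Idn \<C> X \<triangleright> Inv \<M> (MAssoc \<M> D X N)) \<diamond>
    MAssoc \<M> X D (X \<rhd> N) \<diamond> (c \<triangleright> Idn \<M> (X \<rhd> N)) \<diamond> Inv \<M> (MUnit \<M> (X \<rhd> N))
    = Idn \<M> (X \<rhd> N)"
proof -
  have pent: "(Idn \<C> X \<triangleright> Inv \<M> (MAssoc \<M> D X N)) \<diamond> MAssoc \<M> X D (X \<rhd> N)
      = MAssoc \<M> X (D \<otimes>\<^sub>o X) N \<diamond> (Assoc \<C> X D X \<triangleright> Idn \<M> N) \<diamond> Inv \<M> (MAssoc \<M> (X \<otimes>\<^sub>o D) X N)"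
  proof (rule \<M>.iso_cancel_left)
    show "is_isomorphism \<M> (Idn \<C> X \<triangleright> MAssoc \<M> D X N)"
      by (simp add: iso_Act MAssoc_iso \<C>.iso_Idn)
    show "(Idn \<C> X \<triangleright> MAssoc \<M> D X N) \<diamond> (Idn \<C> X \<triangleright> Inv \<M> (MAssoc \<M> D X N)) \<diamond> MAssoc \<M> X D (X \<rhd> N)
        = (Idn \<C> X \<triangleright> MAssoc \<M> D X N) \<diamond> MAssoc \<M> X (D \<otimes>\<^sub>o X) N \<diamond> (Assoc \<C> X D X \<triangleright> Idn \<M> N) \<diamond>
          Inv \<M> (MAssoc \<M> (X \<otimes>\<^sub>o D) X N)"
      using arg_cong[OF module_pentagon[of X D X N], of "\<lambda>k. k \<diamond> Inv \<M> (MAssoc \<M> (X \<otimes>\<^sub>o D) X N)"]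
      by (simp add: Act_Cmp_Cmp)
  qed simp_all
  have unit: "Inv \<M> (MAssoc \<M> (Unit \<C>) X N) \<diamond> Inv \<M> (MUnit \<M> (X \<rhd> N)) = Inv \<C> (LUnit \<C> X) \<triangleright> Idn \<M> N"
    using arg_cong[OF MUnit_MAssoc[of X N], of "Inv \<M>"]
    by (simp add: \<M>.Inv_Cmp_distrib Inv_Act MAssoc_iso MUnit_iso \<C>.LUnit_iso
        iso_Idn_module Inv_Idn_module)
  have "(Idn \<C> X \<triangleright> MUnit \<M> N) \<diamond> (Idn \<C> X \<triangleright> (e \<triangleright> Idn \<M> N)) \<diamond> (Idn \<C> X \<triangleright> Inv \<M> (MAssoc \<M> D X N)) \<diamond>
      MAssoc \<M> X D (X \<rhd> N) \<diamond> (c \<triangleright> Idn \<M> (X \<rhd> N)) \<diamond> Inv \<M> (MUnit \<M> (X \<rhd> N))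
    = (Idn \<C> X \<triangleright> MUnit \<M> N) \<diamond> (Idn \<C> X \<triangleright> (e \<triangleright> Idn \<M> N)) \<diamond> MAssoc \<M> X (D \<otimes>\<^sub>o X) N \<diamond>
      (Assoc \<C> X D X \<triangleright> Idn \<M> N) \<diamond> Inv \<M> (MAssoc \<M> (X \<otimes>\<^sub>o D) X N) \<diamond>
      (c \<triangleright> Idn \<M> (X \<rhd> N)) \<diamond> Inv \<M> (MUnit \<M> (X \<rhd> N))"
    by (simp add: \<M>.Cmp_reassoc1[OF pent])
  also have "\<dots> = (Idn \<C> X \<triangleright> MUnit \<M> N) \<diamond> (Idn \<C> X \<triangleright> (e \<triangleright> Idn \<M> N)) \<diamond> MAssoc \<M> X (D \<otimes>\<^sub>o X) N \<diamond>
      (Assoc \<C> X D X \<triangleright> Idn \<M> N) \<diamond> ((c \<otimes>\<^sub>a Idn \<C> X) \<triangleright> Idn \<M> N) \<diamond> (Inv \<C> (LUnit \<C> X) \<triangleright> Idn \<M> N)"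
    by (simp add: \<M>.Cmp_reassoc[OF Inv_MAssoc_natural[of c "Idn \<C> X" "Idn \<M> N", simplified]] unit)
  also have "\<dots> = (Idn \<C> X \<triangleright> MUnit \<M> N) \<diamond> MAssoc \<M> X (Unit \<C>) N \<diamond> ((Idn \<C> X \<otimes>\<^sub>a e) \<triangleright> Idn \<M> N) \<diamond>
      (Assoc \<C> X D X \<triangleright> Idn \<M> N) \<diamond> ((c \<otimes>\<^sub>a Idn \<C> X) \<triangleright> Idn \<M> N) \<diamond> (Inv \<C> (LUnit \<C> X) \<triangleright> Idn \<M> N)"
    by (simp add: \<M>.Cmp_reassoc[OF MAssoc_natural[of "Idn \<C> X" e "Idn \<M> N", simplified]])
  also have "\<dots> = (RUnit \<C> X \<cdot> (Idn \<C> X \<otimes>\<^sub>a e) \<cdot> Assoc \<C> X D X \<cdot> (c \<otimes>\<^sub>a Idn \<C> X) \<cdot> Inv \<C> (LUnit \<C> X))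
      \<triangleright> Idn \<M> N"
    by (simp add: \<M>.Cmp_reassoc1[OF module_triangle[of X N]] Act_Cmp Act_Cmp_Cmp)
  also have "RUnit \<C> X \<cdot> (Idn \<C> X \<otimes>\<^sub>a e) \<cdot> Assoc \<C> X D X \<cdot> (c \<otimes>\<^sub>a Idn \<C> X) \<cdot> Inv \<C> (LUnit \<C> X)
      = (RUnit \<C> X \<cdot> (Idn \<C> X \<otimes>\<^sub>a e) \<cdot> Assoc \<C> X D X \<cdot> (c \<otimes>\<^sub>a Idn \<C> X)) \<cdot> Inv \<C> (LUnit \<C> X)"
    by simp
  also have "\<dots> = Idn \<C> X"
    by (simp only: zigzags) simp
  finally show ?thesis
    by simp
qed

lemma lunmate_lmate:
  assumes "Src \<M> g = D \<rhd> N'" "Tgt \<M> g = N"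
  shows "lunmate X D e N (lmate X D c N' g) = g"
proof -
  let ?q = "(Idn \<C> D \<triangleright> MAssoc \<M> X D N') \<diamond> (Idn \<C> D \<triangleright> (c \<triangleright> Idn \<M> N')) \<diamond> (Idn \<C> D \<triangleright> Inv \<M> (MUnit \<M> N'))"
  have "lunmate X D e N (lmate X D c N' g)
      = MUnit \<M> N \<diamond> (e \<triangleright> Idn \<M> N) \<diamond> Inv \<M> (MAssoc \<M> D X N) \<diamond> (Idn \<C> D \<triangleright> (Idn \<C> X \<triangleright> g)) \<diamond> ?q"
    using assms by (simp add: lunmate_def lmate_def Act_Cmp Act_Cmp_Cmp)
  also have "\<dots> = MUnit \<M> N \<diamond> (e \<triangleright> Idn \<M> N) \<diamond> (Idn \<C> (D \<otimes>\<^sub>o X) \<triangleright> g) \<diamond> Inv \<M> (MAssoc \<M> D X (D \<rhd> N')) \<diamond> ?q"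
    using assms by (simp add: \<M>.Cmp_reassoc[OF Inv_MAssoc_natural[of "Idn \<C> D" "Idn \<C> X" g, simplified, unfolded assms]])
  also have "\<dots> = MUnit \<M> N \<diamond> (Idn \<C> (Unit \<C>) \<triangleright> g) \<diamond> (e \<triangleright> Idn \<M> (D \<rhd> N')) \<diamond> Inv \<M> (MAssoc \<M> D X (D \<rhd> N')) \<diamond> ?q"
    using assms by (simp add: Act_Cmp Act_Cmp_Cmp)
  also have "\<dots> = g \<diamond> MUnit \<M> (D \<rhd> N') \<diamond> (e \<triangleright> Idn \<M> (D \<rhd> N')) \<diamond> Inv \<M> (MAssoc \<M> D X (D \<rhd> N')) \<diamond> ?q"
    using assms by (simp add: \<M>.Cmp_reassoc[OF MUnit_natural[of g, symmetric, unfolded assms]])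
  also have "\<dots> = g"
    using assms by (simp add: acting_zigzag_D)
  finally show ?thesis .
qed

lemma lmate_lunmate:
  assumes "Src \<M> h = N'" "Tgt \<M> h = X \<rhd> N"
  shows "lmate X D c N' (lunmate X D e N h) = h"
proof -
  let ?q = "(Idn \<C> X \<triangleright> MUnit \<M> N) \<diamond> (Idn \<C> X \<triangleright> (e \<triangleright> Idn \<M> N)) \<diamond> (Idn \<C> X \<triangleright> Inv \<M> (MAssoc \<M> D X N))"
  have "lmate X D c N' (lunmate X D e N h)
      = ?q \<diamond> (Idn \<C> X \<triangleright> (Idn \<C> D \<triangleright> h)) \<diamond> MAssoc \<M> X D N' \<diamond> (c \<triangleright> Idn \<M> N') \<diamond> Inv \<M> (MUnit \<M> N')"
    using assms by (simp add: lunmate_def lmate_def Act_Cmp Act_Cmp_Cmp)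
  also have "\<dots> = ?q \<diamond> MAssoc \<M> X D (X \<rhd> N) \<diamond> (Idn \<C> (X \<otimes>\<^sub>o D) \<triangleright> h) \<diamond> (c \<triangleright> Idn \<M> N') \<diamond> Inv \<M> (MUnit \<M> N')"
    using assms by (simp add: \<M>.Cmp_reassoc[OF MAssoc_natural[of "Idn \<C> X" "Idn \<C> D" h, simplified, unfolded assms]])
  also have "\<dots> = ?q \<diamond> MAssoc \<M> X D (X \<rhd> N) \<diamond> (c \<triangleright> Idn \<M> (X \<rhd> N)) \<diamond> (Idn \<C> (Unit \<C>) \<triangleright> h) \<diamond> Inv \<M> (MUnit \<M> N')"
    using assms by (simp add: Act_Cmp Act_Cmp_Cmp)
  also have "\<dots> = (?q \<diamond> MAssoc \<M> X D (X \<rhd> N) \<diamond> (c \<triangleright> Idn \<M> (X \<rhd> N)) \<diamond> Inv \<M> (MUnit \<M> (X \<rhd> N))) \<diamond> h"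
    using assms Inv_MUnit_natural[of h] by simp
  also have "\<dots> = h"
    using assms acting_zigzag_X[of N] by simp
  finally show ?thesis .
qed

end

text \<open>Acting on a fixed object \<open>M\<close> commutes with transposition, by the pentagon and the left unit law. This
  is what relates duals in the category to the counit of the internal Hom adjunction.\<close>

lemma lmate_act:
  assumes dual: "is_left_dual \<C> X D e c"
    and [simp]: "Src \<C> g = D \<otimes>\<^sub>o W" "Tgt \<C> g = V" "Src \<M> h = V \<rhd> M"
  shows "(Idn \<C> X \<triangleright> h) \<diamond> MAssoc \<M> X V M \<diamond>
      (((Idn \<C> X \<otimes>\<^sub>a g) \<cdot> Assoc \<C> X D W \<cdot> (c \<otimes>\<^sub>a Idn \<C> W) \<cdot> Inv \<C> (LUnit \<C> W)) \<triangleright> Idn \<M> M) =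
    lmate X D c (W \<rhd> M) (h \<diamond> (g \<triangleright> Idn \<M> M) \<diamond> Inv \<M> (MAssoc \<M> D W M))"
proof -
  note [simp] = dual_simps[OF dual]
  let ?u = "Inv \<C> (LUnit \<C> W) \<triangleright> Idn \<M> M"
  let ?k = "h \<diamond> (g \<triangleright> Idn \<M> M) \<diamond> Inv \<M> (MAssoc \<M> D W M)"
  have unit: "MAssoc \<M> (Unit \<C>) W M \<diamond> ?u = Inv \<M> (MUnit \<M> (W \<rhd> M))"
  proof (rule \<M>.iso_cancel_left[OF MUnit_iso])
    show "MUnit \<M> (W \<rhd> M) \<diamond> MAssoc \<M> (Unit \<C>) W M \<diamond> ?u = MUnit \<M> (W \<rhd> M) \<diamond> Inv \<M> (MUnit \<M> (W \<rhd> M))"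
      by (simp add: \<M>.Cmp_reassoc1[OF MUnit_MAssoc] Act_Cmp)
  qed simp_all
  have pent: "MAssoc \<M> X (D \<otimes>\<^sub>o W) M \<diamond> (Assoc \<C> X D W \<triangleright> Idn \<M> M)
      = (Idn \<C> X \<triangleright> Inv \<M> (MAssoc \<M> D W M)) \<diamond> MAssoc \<M> X D (W \<rhd> M) \<diamond> MAssoc \<M> (X \<otimes>\<^sub>o D) W M"
    by (simp add: Act_Cmp_Cmp flip: module_pentagon)
  have "(Idn \<C> X \<triangleright> h) \<diamond> MAssoc \<M> X V M \<diamond>
      (((Idn \<C> X \<otimes>\<^sub>a g) \<cdot> Assoc \<C> X D W \<cdot> (c \<otimes>\<^sub>a Idn \<C> W) \<cdot> Inv \<C> (LUnit \<C> W)) \<triangleright> Idn \<M> M)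
    = (Idn \<C> X \<triangleright> h) \<diamond> MAssoc \<M> X V M \<diamond> ((Idn \<C> X \<otimes>\<^sub>a g) \<triangleright> Idn \<M> M) \<diamond> (Assoc \<C> X D W \<triangleright> Idn \<M> M) \<diamond>
      ((c \<otimes>\<^sub>a Idn \<C> W) \<triangleright> Idn \<M> M) \<diamond> ?u"
    by (simp add: Act_Cmp)
  also have "\<dots> = (Idn \<C> X \<triangleright> h) \<diamond> (Idn \<C> X \<triangleright> (g \<triangleright> Idn \<M> M)) \<diamond>
      (MAssoc \<M> X (D \<otimes>\<^sub>o W) M \<diamond> (Assoc \<C> X D W \<triangleright> Idn \<M> M)) \<diamond> ((c \<otimes>\<^sub>a Idn \<C> W) \<triangleright> Idn \<M> M) \<diamond> ?u"
    by (simp add: \<M>.Cmp_reassoc[OF MAssoc_natural[of "Idn \<C> X" g "Idn \<M> M", simplified]])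
  also have "\<dots> = (Idn \<C> X \<triangleright> ?k) \<diamond> MAssoc \<M> X D (W \<rhd> M) \<diamond> MAssoc \<M> (X \<otimes>\<^sub>o D) W M \<diamond>
      ((c \<otimes>\<^sub>a Idn \<C> W) \<triangleright> Idn \<M> M) \<diamond> ?u"
    by (simp only: pent) (simp add: Act_Cmp_Cmp)
  also have "\<dots> = (Idn \<C> X \<triangleright> ?k) \<diamond> MAssoc \<M> X D (W \<rhd> M) \<diamond> (c \<triangleright> Idn \<M> (W \<rhd> M)) \<diamond>
      MAssoc \<M> (Unit \<C>) W M \<diamond> ?u"
    by (simp add: \<M>.Cmp_reassoc[OF MAssoc_natural[of c "Idn \<C> W" "Idn \<M> M", simplified]])
  also have "\<dots> = lmate X D c (W \<rhd> M) ?k"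
    by (simp only: unit lmate_def)
  finally show ?thesis .
qed

end

section \<open>Transposition in a monoidal category\<close>

context monoidal_category
begin

text \<open>These are the coherence law of the previous section for the regular module of the category and for
  that of its reversal.\<close>

lemma LUnit_Assoc: "LUnit \<C> (W \<otimes>\<^sub>o Y) \<cdot> Assoc \<C> (Unit \<C>) W Y = LUnit \<C> W \<otimes>\<^sub>a Idn \<C> Y"
  using module_category.MUnit_MAssoc[OF module_category_regular] by simp

lemma RUnit_Assoc: "RUnit \<C> (W \<otimes>\<^sub>o Y) \<cdot> Inv \<C> (Assoc \<C> W Y (Unit \<C>)) = Idn \<C> W \<otimes>\<^sub>a RUnit \<C> Y"
  using module_category.MUnit_MAssoc
      [OF monoidal_category.module_category_regular[OF monoidal_category_reversed]] by simp

lemma LUnit_Unit: "LUnit \<C> (Unit \<C>) = RUnit \<C> (Unit \<C>)"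
proof -
  let ?I = "Unit \<C>"
  \<comment> \<open>Tensoring with the unit object is faithful, so it suffices to compare after doing so.\<close>
  have faithful: "f = g"
    if "f \<otimes>\<^sub>a Idn \<C> ?I = g \<otimes>\<^sub>a Idn \<C> ?I" "Src \<C> f = Src \<C> g" "Tgt \<C> f = Tgt \<C> g" for f g
  proof (rule iso_cancel_right)
    show "f \<cdot> RUnit \<C> (Src \<C> f) = g \<cdot> RUnit \<C> (Src \<C> f)"
      by (metis RUnit_natural that)
  qed (simp_all add: that RUnit_iso)
  have "LUnit \<C> (?I \<otimes>\<^sub>o ?I) = Idn \<C> ?I \<otimes>\<^sub>a LUnit \<C> ?I"
    by (rule iso_cancel_left[OF LUnit_iso[of ?I]]) (simp_all add: LUnit_natural[of "LUnit \<C> ?I", simplified])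
  then have "LUnit \<C> ?I \<otimes>\<^sub>a Idn \<C> ?I = RUnit \<C> ?I \<otimes>\<^sub>a Idn \<C> ?I"
    using LUnit_Assoc[of ?I ?I] triangle[of ?I ?I] by simp
  then show ?thesis
    by (rule faithful) simp_all
qed

text \<open>Reversal exchanges the two zigzag identities, hence the roles of an object and its dual.\<close>

lemma is_left_dual_reversed: "is_left_dual \<C> Y D e c \<Longrightarrow> is_left_dual (reversed \<C>) D Y e c"
  by (simp add: is_left_dual_def Inv_Inv Assoc_iso)

lemma left_transpose_inverse:
  assumes "is_left_dual \<C> X D e c" "Src \<C> h = W" "Tgt \<C> h = X \<otimes>\<^sub>o V"
  shows "(Idn \<C> X \<otimes>\<^sub>a (LUnit \<C> V \<cdot> (e \<otimes>\<^sub>a Idn \<C> V) \<cdot> Inv \<C> (Assoc \<C> D X V) \<cdot> (Idn \<C> D \<otimes>\<^sub>a h))) \<cdot>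
    Assoc \<C> X D W \<cdot> (c \<otimes>\<^sub>a Idn \<C> W) \<cdot> Inv \<C> (LUnit \<C> W) = h"
  using module_category.lmate_lunmate[OF module_category_regular assms(1), of h W V] assms(2,3)
  by (simp add: module_category.lmate_def[OF module_category_regular]
      module_category.lunmate_def[OF module_category_regular])

text \<open>If \<open>D\<close> is a left dual of \<open>Y\<close>, tensoring with \<open>Y\<close> from the right is left adjoint to tensoring
  with \<open>D\<close> from the right. This is the adjunction of the previous section for the reversed tensor
  product, in which \<open>Y\<close> is a left dual of \<open>D\<close>.\<close>

definition rmate :: "'o \<Rightarrow> 'o \<Rightarrow> 'a \<Rightarrow> 'o \<Rightarrow> 'a \<Rightarrow> 'a" where
  "rmate Y D c W g =
    (g \<otimes>\<^sub>a Idn \<C> D) \<cdot> Inv \<C> (Assoc \<C> W Y D) \<cdot> (Idn \<C> W \<otimes>\<^sub>a c) \<cdot> Inv \<C> (RUnit \<C> W)"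

definition runmate :: "'o \<Rightarrow> 'o \<Rightarrow> 'a \<Rightarrow> 'o \<Rightarrow> 'a \<Rightarrow> 'a" where
  "runmate Y D e V h = RUnit \<C> V \<cdot> (Idn \<C> V \<otimes>\<^sub>a e) \<cdot> Assoc \<C> V D Y \<cdot> (h \<otimes>\<^sub>a Idn \<C> Y)"

lemma
  assumes "is_left_dual \<C> Y D e c"
  shows runmate_rmate:
      "\<lbrakk>Src \<C> g = W \<otimes>\<^sub>o Y; Tgt \<C> g = V\<rbrakk> \<Longrightarrow> runmate Y D e V (rmate Y D c W g) = g"
    and rmate_runmate:
      "\<lbrakk>Src \<C> h = W; Tgt \<C> h = V \<otimes>\<^sub>o D\<rbrakk> \<Longrightarrow> rmate Y D c W (runmate Y D e V h) = h"
proof -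
  note R = monoidal_category.module_category_regular[OF monoidal_category_reversed]
  note defs = module_category.lmate_def[OF R] module_category.lunmate_def[OF R]
  note dual = is_left_dual_reversed[OF assms]
  show "runmate Y D e V (rmate Y D c W g) = g" if "Src \<C> g = W \<otimes>\<^sub>o Y" "Tgt \<C> g = V"
    using module_category.lunmate_lmate[OF R dual, of g W V] that
    by (simp add: defs rmate_def runmate_def Inv_Inv Assoc_iso)
  show "rmate Y D c W (runmate Y D e V h) = h" if "Src \<C> h = W" "Tgt \<C> h = V \<otimes>\<^sub>o D"
    using module_category.lmate_lunmate[OF R dual, of h W V] that
    by (simp add: defs rmate_def runmate_def Inv_Inv Assoc_iso)
qed

lemma runmate_inject:
  assumes "is_left_dual \<C> Y D e c" "runmate Y D e V h = runmate Y D e V h'"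
    "Src \<C> h = Src \<C> h'" "Tgt \<C> h = V \<otimes>\<^sub>o D" "Tgt \<C> h' = V \<otimes>\<^sub>o D"
  shows "h = h'"
  by (metis assms rmate_runmate)

lemma
  assumes [simp]: "Src \<C> c = Unit \<C>" "Tgt \<C> c = Y \<otimes>\<^sub>o D" "Src \<C> g = W \<otimes>\<^sub>o Y"
  shows Src_rmate [simp]: "Src \<C> (rmate Y D c W g) = W"
    and Tgt_rmate [simp]: "Tgt \<C> (rmate Y D c W g) = Tgt \<C> g \<otimes>\<^sub>o D"
    and rmate_Cmp: "Tgt \<C> f = W \<Longrightarrow> rmate Y D c W g \<cdot> f = rmate Y D c (Src \<C> f) (g \<cdot> (f \<otimes>\<^sub>a Idn \<C> Y))"
    and Cmp_rmate: "Src \<C> v = Tgt \<C> g \<Longrightarrow> (v \<otimes>\<^sub>a Idn \<C> D) \<cdot> rmate Y D c W g = rmate Y D c W (v \<cdot> g)"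
proof -
  show "Src \<C> (rmate Y D c W g) = W" "Tgt \<C> (rmate Y D c W g) = Tgt \<C> g \<otimes>\<^sub>o D"
    by (simp_all add: rmate_def)
  show "(v \<otimes>\<^sub>a Idn \<C> D) \<cdot> rmate Y D c W g = rmate Y D c W (v \<cdot> g)" if "Src \<C> v = Tgt \<C> g"
    using that by (simp add: rmate_def Ten_Cmp_Cmp)
  assume f [simp]: "Tgt \<C> f = W"
  have unit: "Inv \<C> (RUnit \<C> W) \<cdot> f = (f \<otimes>\<^sub>a Idn \<C> (Unit \<C>)) \<cdot> Inv \<C> (RUnit \<C> (Src \<C> f))"
    by (rule nat_Inv[OF RUnit_iso RUnit_iso]) (simp_all add: RUnit_natural)
  have "rmate Y D c W g \<cdot> f = (g \<otimes>\<^sub>a Idn \<C> D) \<cdot> Inv \<C> (Assoc \<C> W Y D) \<cdot> (Idn \<C> W \<otimes>\<^sub>a c) \<cdot>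
      (f \<otimes>\<^sub>a Idn \<C> (Unit \<C>)) \<cdot> Inv \<C> (RUnit \<C> (Src \<C> f))"
    by (simp add: rmate_def unit)
  also have "\<dots> = (g \<otimes>\<^sub>a Idn \<C> D) \<cdot> Inv \<C> (Assoc \<C> W Y D) \<cdot> (f \<otimes>\<^sub>a Idn \<C> (Y \<otimes>\<^sub>o D)) \<cdot>
      (Idn \<C> (Src \<C> f) \<otimes>\<^sub>a c) \<cdot> Inv \<C> (RUnit \<C> (Src \<C> f))"
    by (simp add: Ten_Cmp_Cmp)
  also have "\<dots> = (g \<otimes>\<^sub>a Idn \<C> D) \<cdot> ((f \<otimes>\<^sub>a Idn \<C> Y) \<otimes>\<^sub>a Idn \<C> D) \<cdot> Inv \<C> (Assoc \<C> (Src \<C> f) Y D) \<cdot>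
      (Idn \<C> (Src \<C> f) \<otimes>\<^sub>a c) \<cdot> Inv \<C> (RUnit \<C> (Src \<C> f))"
    by (simp add: Cmp_reassoc[OF Inv_Assoc_natural[of f "Idn \<C> Y" "Idn \<C> D", simplified]])
  also have "\<dots> = rmate Y D c (Src \<C> f) (g \<cdot> (f \<otimes>\<^sub>a Idn \<C> Y))"
    by (simp add: rmate_def Ten_Cmp_Cmp)
  finally show "rmate Y D c W g \<cdot> f = rmate Y D c (Src \<C> f) (g \<cdot> (f \<otimes>\<^sub>a Idn \<C> Y))" .
qed

lemma rmate_LUnit:
  assumes [simp]: "Src \<C> c = Unit \<C>" "Tgt \<C> c = Y \<otimes>\<^sub>o D"
  shows "rmate Y D c (Unit \<C>) (LUnit \<C> Y) = c"
proof -
  have "rmate Y D c (Unit \<C>) (LUnit \<C> Y) =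
      (LUnit \<C> (Y \<otimes>\<^sub>o D) \<cdot> (Idn \<C> (Unit \<C>) \<otimes>\<^sub>a c)) \<cdot> Inv \<C> (RUnit \<C> (Unit \<C>))"
    by (simp add: rmate_def flip: LUnit_Assoc)
  also have "\<dots> = c \<cdot> LUnit \<C> (Unit \<C>) \<cdot> Inv \<C> (RUnit \<C> (Unit \<C>))"
    by (simp add: Cmp_reassoc[OF LUnit_natural[of c, symmetric, simplified]])
  finally show ?thesis
    by (simp add: LUnit_Unit)
qed

end

section \<open>Dual objects and dual morphisms\<close>

context finite_tensor_category
begin

lemma Src_Ev [simp]: "Src \<C> (Ev \<C> X) = Dual \<C> X \<otimes>\<^sub>o X" and Tgt_Ev [simp]: "Tgt \<C> (Ev \<C> X) = Unit \<C>"
  and Src_Coev [simp]: "Src \<C> (Coev \<C> X) = Unit \<C>" and Tgt_Coev [simp]: "Tgt \<C> (Coev \<C> X) = X \<otimes>\<^sub>o Dual \<C> X"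
  using left_dual[of X] by (auto simp: is_left_dual_def Hom_def)

lemma zigzag: "RUnit \<C> X \<cdot> (Idn \<C> X \<otimes>\<^sub>a Ev \<C> X) \<cdot> Assoc \<C> X (Dual \<C> X) X \<cdot> (Coev \<C> X \<otimes>\<^sub>a Idn \<C> X) = LUnit \<C> X"
  using left_dual[of X] by (simp add: is_left_dual_def)

lemma to_dual_rmate: "to_dual \<C> D X e = LUnit \<C> (Dual \<C> X) \<cdot> rmate X (Dual \<C> X) (Coev \<C> X) D e"
  by (simp add: to_dual_def rmate_def)

lemma
  assumes "Src \<C> e = D \<otimes>\<^sub>o X" "Tgt \<C> e = Unit \<C>"
  shows Src_to_dual: "Src \<C> (to_dual \<C> D X e) = D" and Tgt_to_dual: "Tgt \<C> (to_dual \<C> D X e) = Dual \<C> X"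
  using assms by (simp_all add: to_dual_def)

lemma Ev_LUnit:
  "RUnit \<C> (Unit \<C>) \<cdot> (Idn \<C> (Unit \<C>) \<otimes>\<^sub>a Ev \<C> X) \<cdot> Assoc \<C> (Unit \<C>) (Dual \<C> X) X =
    Ev \<C> X \<cdot> (LUnit \<C> (Dual \<C> X) \<otimes>\<^sub>a Idn \<C> X)"
  using Cmp_reassoc[OF LUnit_natural[of "Ev \<C> X", symmetric, simplified], of "Assoc \<C> (Unit \<C>) (Dual \<C> X) X"]
  by (simp add: LUnit_Unit LUnit_Assoc)

text \<open>Up to the unit constraint, the pairing \<open>ev \<cdot> (\<phi> \<otimes> id) : D \<otimes> X \<rightarrow> 1\<close> is the transpose of
  \<open>\<phi> : D \<rightarrow> X\<^sup>*\<close>, so it determines \<open>\<phi>\<close>. Morphisms into dual objects are compared through their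
  pairings.\<close>

lemma runmate_pairing:
  assumes "Src \<C> \<phi> = D" "Tgt \<C> \<phi> = Dual \<C> X"
  shows "runmate X (Dual \<C> X) (Ev \<C> X) (Unit \<C>) (Inv \<C> (LUnit \<C> (Dual \<C> X)) \<cdot> \<phi>) = Ev \<C> X \<cdot> (\<phi> \<otimes>\<^sub>a Idn \<C> X)"
proof -
  let ?k = "(Inv \<C> (LUnit \<C> (Dual \<C> X)) \<cdot> \<phi>) \<otimes>\<^sub>a Idn \<C> X"
  have "runmate X (Dual \<C> X) (Ev \<C> X) (Unit \<C>) (Inv \<C> (LUnit \<C> (Dual \<C> X)) \<cdot> \<phi>)
      = (RUnit \<C> (Unit \<C>) \<cdot> (Idn \<C> (Unit \<C>) \<otimes>\<^sub>a Ev \<C> X) \<cdot> Assoc \<C> (Unit \<C>) (Dual \<C> X) X) \<cdot> ?k"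
    using assms by (simp add: runmate_def)
  also have "\<dots> = (Ev \<C> X \<cdot> (LUnit \<C> (Dual \<C> X) \<otimes>\<^sub>a Idn \<C> X)) \<cdot> ?k"
    by (simp only: Ev_LUnit)
  also have "\<dots> = Ev \<C> X \<cdot> (\<phi> \<otimes>\<^sub>a Idn \<C> X)"
    using assms by (simp add: Ten_Cmp)
  finally show ?thesis .
qed

lemma to_dual_pairing:
  assumes "Src \<C> \<phi> = D" "Tgt \<C> \<phi> = Dual \<C> X"
  shows "to_dual \<C> D X (Ev \<C> X \<cdot> (\<phi> \<otimes>\<^sub>a Idn \<C> X)) = \<phi>"
  using assms by (simp add: to_dual_rmate runmate_pairing[symmetric] rmate_runmate[OF left_dual])

lemma dual_eqI:
  assumes "Ev \<C> X \<cdot> (\<phi> \<otimes>\<^sub>a Idn \<C> X) = Ev \<C> X \<cdot> (\<psi> \<otimes>\<^sub>a Idn \<C> X)"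
    "Src \<C> \<phi> = Src \<C> \<psi>" "Tgt \<C> \<phi> = Dual \<C> X" "Tgt \<C> \<psi> = Dual \<C> X"
  shows "\<phi> = \<psi>"
  by (metis assms to_dual_pairing)

lemma pairing_to_dual:
  assumes "Src \<C> e = D \<otimes>\<^sub>o X" "Tgt \<C> e = Unit \<C>"
  shows "Ev \<C> X \<cdot> (to_dual \<C> D X e \<otimes>\<^sub>a Idn \<C> X) = e"
proof -
  have "Inv \<C> (LUnit \<C> (Dual \<C> X)) \<cdot> to_dual \<C> D X e = rmate X (Dual \<C> X) (Coev \<C> X) D e"
    using assms by (simp add: to_dual_rmate rmate_def)
  then show ?thesis
    using runmate_pairing[of "to_dual \<C> D X e" D X] assms
    by (simp add: Src_to_dual Tgt_to_dual runmate_rmate[OF left_dual])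
qed

lemma Src_DualA [simp]: "Src \<C> (DualA \<C> f) = Dual \<C> (Tgt \<C> f)"
  and Tgt_DualA [simp]: "Tgt \<C> (DualA \<C> f) = Dual \<C> (Src \<C> f)"
  by (simp_all add: DualA_def Src_to_dual Tgt_to_dual)

lemma Ev_DualA:
  assumes "Tgt \<C> \<phi> = Dual \<C> (Tgt \<C> f)" "Tgt \<C> h = Src \<C> f"
  shows "Ev \<C> (Src \<C> f) \<cdot> ((DualA \<C> f \<cdot> \<phi>) \<otimes>\<^sub>a h) = Ev \<C> (Tgt \<C> f) \<cdot> (\<phi> \<otimes>\<^sub>a (f \<cdot> h))"
proof -
  have "Ev \<C> (Src \<C> f) \<cdot> ((DualA \<C> f \<cdot> \<phi>) \<otimes>\<^sub>a h) = (Ev \<C> (Src \<C> f) \<cdot> (DualA \<C> f \<otimes>\<^sub>a Idn \<C> (Src \<C> f))) \<cdot> (\<phi> \<otimes>\<^sub>a h)"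
    using assms by (simp add: Ten_Cmp)
  also have "\<dots> = (Ev \<C> (Tgt \<C> f) \<cdot> (Idn \<C> (Dual \<C> (Tgt \<C> f)) \<otimes>\<^sub>a f)) \<cdot> (\<phi> \<otimes>\<^sub>a h)"
    by (simp add: DualA_def pairing_to_dual)
  also have "\<dots> = Ev \<C> (Tgt \<C> f) \<cdot> (\<phi> \<otimes>\<^sub>a (f \<cdot> h))"
    using assms by (simp add: Ten_Cmp)
  finally show ?thesis .
qed

lemma Ev_DualA_Idn:
  "Tgt \<C> h = Src \<C> f \<Longrightarrow>
    Ev \<C> (Src \<C> f) \<cdot> (DualA \<C> f \<otimes>\<^sub>a h) = Ev \<C> (Tgt \<C> f) \<cdot> (Idn \<C> (Dual \<C> (Tgt \<C> f)) \<otimes>\<^sub>a (f \<cdot> h))"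
  using Ev_DualA[of "Idn \<C> (Dual \<C> (Tgt \<C> f))" f h] by simp

lemma DualA_Idn: "DualA \<C> (Idn \<C> X) = Idn \<C> (Dual \<C> X)"
  by (rule dual_eqI) (use Ev_DualA_Idn[of "Idn \<C> X" "Idn \<C> X"] in simp_all)

lemma DualA_Cmp:
  assumes "Tgt \<C> f = Src \<C> g"
  shows "DualA \<C> (g \<cdot> f) = DualA \<C> f \<cdot> DualA \<C> g"
proof (rule dual_eqI)
  show "Ev \<C> (Src \<C> f) \<cdot> (DualA \<C> (g \<cdot> f) \<otimes>\<^sub>a Idn \<C> (Src \<C> f)) =
      Ev \<C> (Src \<C> f) \<cdot> ((DualA \<C> f \<cdot> DualA \<C> g) \<otimes>\<^sub>a Idn \<C> (Src \<C> f))"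
    using assms Ev_DualA_Idn[of "Idn \<C> (Src \<C> f)" "g \<cdot> f"] Ev_DualA_Idn[of f g]
    by (simp add: Ev_DualA)
qed (use assms in simp_all)

lemma iso_DualA:
  assumes "is_isomorphism \<C> f"
  shows "is_isomorphism \<C> (DualA \<C> f)"
proof (rule is_inverse_isomorphism)
  show "is_inverse \<C> (DualA \<C> f) (DualA \<C> (Inv \<C> f))"
    using assms by (simp add: is_inverse_def HomI iso_simps DualA_Idn flip: DualA_Cmp)
qed

text \<open>By transposition it suffices to compare the morphisms \<open>1 \<otimes> X \<rightarrow> Y\<close> that correspond to the two sides;
  the zigzag identities of \<open>X\<close> and of \<open>Y\<close> turn both of them into \<open>f\<close>.\<close>

lemma Coev_DualA:
  "(Idn \<C> (Tgt \<C> f) \<otimes>\<^sub>a DualA \<C> f) \<cdot> Coev \<C> (Tgt \<C> f) = (f \<otimes>\<^sub>a Idn \<C> (Dual \<C> (Src \<C> f))) \<cdot> Coev \<C> (Src \<C> f)"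
proof -
  define X where "X = Src \<C> f"
  define Y where "Y = Tgt \<C> f"
  have f [simp]: "Src \<C> f = X" "Tgt \<C> f = Y"
    by (simp_all add: X_def Y_def)
  let ?r = "runmate X (Dual \<C> X) (Ev \<C> X) Y"
  have "?r ((Idn \<C> Y \<otimes>\<^sub>a DualA \<C> f) \<cdot> Coev \<C> Y)
      = RUnit \<C> Y \<cdot> (Idn \<C> Y \<otimes>\<^sub>a Ev \<C> X) \<cdot> Assoc \<C> Y (Dual \<C> X) X \<cdot>
        ((Idn \<C> Y \<otimes>\<^sub>a DualA \<C> f) \<otimes>\<^sub>a Idn \<C> X) \<cdot> (Coev \<C> Y \<otimes>\<^sub>a Idn \<C> X)"
    by (simp add: runmate_def Ten_Cmp)
  also have "\<dots> = RUnit \<C> Y \<cdot> (Idn \<C> Y \<otimes>\<^sub>a (Ev \<C> X \<cdot> (DualA \<C> f \<otimes>\<^sub>a Idn \<C> X))) \<cdot> Assoc \<C> Y (Dual \<C> Y) X \<cdot>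
        (Coev \<C> Y \<otimes>\<^sub>a Idn \<C> X)"
    by (simp add: Cmp_reassoc[OF Assoc_natural[of "Idn \<C> Y" "DualA \<C> f" "Idn \<C> X", simplified]] Ten_Cmp_Cmp)
  also have "Ev \<C> X \<cdot> (DualA \<C> f \<otimes>\<^sub>a Idn \<C> X) = Ev \<C> Y \<cdot> (Idn \<C> (Dual \<C> Y) \<otimes>\<^sub>a f)"
    using Ev_DualA_Idn[of "Idn \<C> X" f] by simp
  also have "RUnit \<C> Y \<cdot> (Idn \<C> Y \<otimes>\<^sub>a (Ev \<C> Y \<cdot> (Idn \<C> (Dual \<C> Y) \<otimes>\<^sub>a f))) \<cdot> Assoc \<C> Y (Dual \<C> Y) X \<cdot>
        (Coev \<C> Y \<otimes>\<^sub>a Idn \<C> X)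
      = RUnit \<C> Y \<cdot> (Idn \<C> Y \<otimes>\<^sub>a Ev \<C> Y) \<cdot> (Idn \<C> Y \<otimes>\<^sub>a (Idn \<C> (Dual \<C> Y) \<otimes>\<^sub>a f)) \<cdot> Assoc \<C> Y (Dual \<C> Y) X \<cdot>
        (Coev \<C> Y \<otimes>\<^sub>a Idn \<C> X)"
    by (simp add: Ten_Cmp_Cmp)
  also have "\<dots> = RUnit \<C> Y \<cdot> (Idn \<C> Y \<otimes>\<^sub>a Ev \<C> Y) \<cdot> Assoc \<C> Y (Dual \<C> Y) Y \<cdot> (Idn \<C> (Y \<otimes>\<^sub>o Dual \<C> Y) \<otimes>\<^sub>a f) \<cdot>
        (Coev \<C> Y \<otimes>\<^sub>a Idn \<C> X)"
    by (simp add: Cmp_reassoc[OF Assoc_natural[of "Idn \<C> Y" "Idn \<C> (Dual \<C> Y)" f, symmetric, simplified]])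
  also have "\<dots> = (RUnit \<C> Y \<cdot> (Idn \<C> Y \<otimes>\<^sub>a Ev \<C> Y) \<cdot> Assoc \<C> Y (Dual \<C> Y) Y \<cdot> (Coev \<C> Y \<otimes>\<^sub>a Idn \<C> Y)) \<cdot>
        (Idn \<C> (Unit \<C>) \<otimes>\<^sub>a f)"
    by (simp add: Ten_Cmp)
  also have "\<dots> = f \<cdot> LUnit \<C> X"
    using LUnit_natural[of f] by (simp only: zigzag f)
  also have "\<dots> = f \<cdot> RUnit \<C> X \<cdot> (Idn \<C> X \<otimes>\<^sub>a Ev \<C> X) \<cdot> Assoc \<C> X (Dual \<C> X) X \<cdot> (Coev \<C> X \<otimes>\<^sub>a Idn \<C> X)"
    by (simp only: zigzag)
  also have "\<dots> = RUnit \<C> Y \<cdot> (f \<otimes>\<^sub>a Idn \<C> (Unit \<C>)) \<cdot> (Idn \<C> X \<otimes>\<^sub>a Ev \<C> X) \<cdot> Assoc \<C> X (Dual \<C> X) X \<cdot>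
        (Coev \<C> X \<otimes>\<^sub>a Idn \<C> X)"
    by (simp add: Cmp_reassoc[OF RUnit_natural[of f, unfolded f]])
  also have "\<dots> = RUnit \<C> Y \<cdot> (Idn \<C> Y \<otimes>\<^sub>a Ev \<C> X) \<cdot> (f \<otimes>\<^sub>a Idn \<C> (Dual \<C> X \<otimes>\<^sub>o X)) \<cdot> Assoc \<C> X (Dual \<C> X) X \<cdot>
        (Coev \<C> X \<otimes>\<^sub>a Idn \<C> X)"
    by (simp add: Ten_Cmp_Cmp)
  also have "\<dots> = RUnit \<C> Y \<cdot> (Idn \<C> Y \<otimes>\<^sub>a Ev \<C> X) \<cdot> Assoc \<C> Y (Dual \<C> X) X \<cdot>
        ((f \<otimes>\<^sub>a Idn \<C> (Dual \<C> X)) \<otimes>\<^sub>a Idn \<C> X) \<cdot> (Coev \<C> X \<otimes>\<^sub>a Idn \<C> X)"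
    by (simp add: Cmp_reassoc[OF Assoc_natural[of f "Idn \<C> (Dual \<C> X)" "Idn \<C> X", symmetric, simplified]])
  also have "\<dots> = ?r ((f \<otimes>\<^sub>a Idn \<C> (Dual \<C> X)) \<cdot> Coev \<C> X)"
    by (simp add: runmate_def Ten_Cmp)
  finally show ?thesis
    unfolding f by (rule runmate_inject[OF left_dual]) simp_all
qed

lemma Src_dual_unit [simp]: "Src \<C> (dual_unit \<C>) = Unit \<C>"
  and Tgt_dual_unit [simp]: "Tgt \<C> (dual_unit \<C>) = Dual \<C> (Unit \<C>)"
  by (simp_all add: dual_unit_def Src_to_dual Tgt_to_dual)

text \<open>Moving \<open>t\<close> across the evaluation leaves \<open>ev_1\<close>, which \<open>dual_unit\<close> turns into the unit constraint. So a
  functional \<open>t\<close> can be read off from its point \<open>1 \<rightarrow> H\<^sup>*\<close>.\<close>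

lemma Ev_dual_functional:
  assumes "Src \<C> t = H" "Tgt \<C> t = Unit \<C>"
  shows "Ev \<C> H \<cdot> ((DualA \<C> t \<cdot> dual_unit \<C>) \<otimes>\<^sub>a Idn \<C> H) = t \<cdot> LUnit \<C> H"
proof -
  have "Ev \<C> H \<cdot> ((DualA \<C> t \<cdot> dual_unit \<C>) \<otimes>\<^sub>a Idn \<C> H) = Ev \<C> (Unit \<C>) \<cdot> (dual_unit \<C> \<otimes>\<^sub>a t)"
    using assms Ev_DualA[of "dual_unit \<C>" t "Idn \<C> H"] by simp
  also have "\<dots> = (Ev \<C> (Unit \<C>) \<cdot> (dual_unit \<C> \<otimes>\<^sub>a Idn \<C> (Unit \<C>))) \<cdot> (Idn \<C> (Unit \<C>) \<otimes>\<^sub>a t)"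
    using assms by (simp add: Ten_Cmp)
  also have "\<dots> = t \<cdot> LUnit \<C> H"
    using assms LUnit_natural[of t] by (simp add: dual_unit_def pairing_to_dual)
  finally show ?thesis .
qed

lemma dual_functional_unique:
  assumes "Src \<C> \<phi> = Unit \<C>" "Tgt \<C> \<phi> = Dual \<C> H"
  shows "\<exists>!t. t \<in> Hom \<C> H (Unit \<C>) \<and> DualA \<C> t \<cdot> dual_unit \<C> = \<phi>"
proof (rule ex1I)
  let ?t = "Ev \<C> H \<cdot> (\<phi> \<otimes>\<^sub>a Idn \<C> H) \<cdot> Inv \<C> (LUnit \<C> H)"
  have "DualA \<C> ?t \<cdot> dual_unit \<C> = \<phi>"
    by (rule dual_eqI[of H]) (simp_all add: assms Ev_dual_functional)
  then show "?t \<in> Hom \<C> H (Unit \<C>) \<and> DualA \<C> ?t \<cdot> dual_unit \<C> = \<phi>"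
    using assms by (simp add: HomI)
next
  fix t assume t: "t \<in> Hom \<C> H (Unit \<C>) \<and> DualA \<C> t \<cdot> dual_unit \<C> = \<phi>"
  then have "t \<cdot> LUnit \<C> H = Ev \<C> H \<cdot> (\<phi> \<otimes>\<^sub>a Idn \<C> H)"
    using Ev_dual_functional[of t H] by (simp add: Hom_def)
  then have "(t \<cdot> LUnit \<C> H) \<cdot> Inv \<C> (LUnit \<C> H) = (Ev \<C> H \<cdot> (\<phi> \<otimes>\<^sub>a Idn \<C> H)) \<cdot> Inv \<C> (LUnit \<C> H)"
    by simp
  then show "t = Ev \<C> H \<cdot> (\<phi> \<otimes>\<^sub>a Idn \<C> H) \<cdot> Inv \<C> (LUnit \<C> H)"
    using t assms by (simp add: Hom_def)
qed

lemma
  shows Src_dual_ten [simp]: "Src \<C> (dual_ten \<C> X Y) = Dual \<C> Y \<otimes>\<^sub>o Dual \<C> X"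
    and Tgt_dual_ten [simp]: "Tgt \<C> (dual_ten \<C> X Y) = Dual \<C> (X \<otimes>\<^sub>o Y)"
    and Ev_dual_ten: "Ev \<C> (X \<otimes>\<^sub>o Y) \<cdot> (dual_ten \<C> X Y \<otimes>\<^sub>a Idn \<C> (X \<otimes>\<^sub>o Y)) =
      Ev \<C> Y \<cdot>
       (Idn \<C> (Dual \<C> Y) \<otimes>\<^sub>a
         (LUnit \<C> Y \<cdot> (Ev \<C> X \<otimes>\<^sub>a Idn \<C> Y) \<cdot> Inv \<C> (Assoc \<C> (Dual \<C> X) X Y))) \<cdot>
       Assoc \<C> (Dual \<C> Y) (Dual \<C> X) (X \<otimes>\<^sub>o Y)"
  by (simp_all add: dual_ten_def Src_to_dual Tgt_to_dual pairing_to_dual)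

text \<open>Inserting the point \<open>1 \<rightarrow> H\<^sup>*\<close> of a functional \<open>s\<close> on \<open>H\<close> into \<open>H\<^sup>* \<otimes> X\<^sup>* \<simeq> (X \<otimes> H)\<^sup>*\<close> dualizes the
  morphism \<open>X \<otimes> H \<rightarrow> X\<close> that applies \<open>s\<close>, since both sides pair with \<open>X \<otimes> H\<close> by evaluating \<open>s\<close> on \<open>H\<close> and
  \<open>X\<^sup>*\<close> on \<open>X\<close>. The name \<open>?K\<close> stands for the contraction \<open>X\<^sup>* \<otimes> (X \<otimes> H) \<rightarrow> H\<close>.\<close>

lemma dual_ten_functional:
  assumes s [simp]: "Src \<C> s = H" "Tgt \<C> s = Unit \<C>"
  shows "dual_ten \<C> X H \<cdot> ((DualA \<C> s \<cdot> dual_unit \<C>) \<otimes>\<^sub>a Idn \<C> (Dual \<C> X)) =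
    DualA \<C> (RUnit \<C> X \<cdot> (Idn \<C> X \<otimes>\<^sub>a s)) \<cdot> LUnit \<C> (Dual \<C> X)"
proof (rule dual_eqI)
  let ?D = "Dual \<C> X" and ?I = "Unit \<C>" and ?W = "X \<otimes>\<^sub>o H"
  let ?f = "RUnit \<C> X \<cdot> (Idn \<C> X \<otimes>\<^sub>a s)"
  let ?K = "LUnit \<C> H \<cdot> (Ev \<C> X \<otimes>\<^sub>a Idn \<C> H) \<cdot> Inv \<C> (Assoc \<C> ?D X H)"
  define p where "p = DualA \<C> s \<cdot> dual_unit \<C>"
  have p [simp]: "Src \<C> p = ?I" "Tgt \<C> p = Dual \<C> H"
    by (simp_all add: p_def)
  have Ev_p: "Ev \<C> H \<cdot> (p \<otimes>\<^sub>a Idn \<C> H) = s \<cdot> LUnit \<C> H"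
    by (simp add: p_def Ev_dual_functional)
  have "s \<cdot> ?K = LUnit \<C> ?I \<cdot> (Idn \<C> ?I \<otimes>\<^sub>a s) \<cdot> (Ev \<C> X \<otimes>\<^sub>a Idn \<C> H) \<cdot> Inv \<C> (Assoc \<C> ?D X H)"
    by (simp add: Cmp_reassoc[OF LUnit_natural[of s, unfolded s]])
  also have "\<dots> = RUnit \<C> ?I \<cdot> (Ev \<C> X \<otimes>\<^sub>a Idn \<C> ?I) \<cdot> (Idn \<C> (?D \<otimes>\<^sub>o X) \<otimes>\<^sub>a s) \<cdot> Inv \<C> (Assoc \<C> ?D X H)"
    by (simp add: Ten_Cmp_Cmp LUnit_Unit)
  also have "\<dots> = Ev \<C> X \<cdot> (RUnit \<C> (?D \<otimes>\<^sub>o X) \<cdot> Inv \<C> (Assoc \<C> ?D X ?I)) \<cdot> (Idn \<C> ?D \<otimes>\<^sub>a (Idn \<C> X \<otimes>\<^sub>a s))"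
    using Inv_Assoc_natural[of "Idn \<C> ?D" "Idn \<C> X" s]
    by (simp add: Cmp_reassoc[OF RUnit_natural[of "Ev \<C> X", symmetric, simplified]])
  also have "\<dots> = Ev \<C> X \<cdot> (Idn \<C> ?D \<otimes>\<^sub>a ?f)"
    by (simp only: RUnit_Assoc) (simp add: Ten_Cmp)
  finally have sK: "s \<cdot> ?K = Ev \<C> X \<cdot> (Idn \<C> ?D \<otimes>\<^sub>a ?f)" .
  have "Ev \<C> ?W \<cdot> ((dual_ten \<C> X H \<cdot> (p \<otimes>\<^sub>a Idn \<C> ?D)) \<otimes>\<^sub>a Idn \<C> ?W)
      = (Ev \<C> ?W \<cdot> (dual_ten \<C> X H \<otimes>\<^sub>a Idn \<C> ?W)) \<cdot> ((p \<otimes>\<^sub>a Idn \<C> ?D) \<otimes>\<^sub>a Idn \<C> ?W)"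
    by (simp add: Ten_Cmp)
  also have "\<dots> = Ev \<C> H \<cdot> (Idn \<C> (Dual \<C> H) \<otimes>\<^sub>a ?K) \<cdot> (p \<otimes>\<^sub>a Idn \<C> (?D \<otimes>\<^sub>o ?W)) \<cdot> Assoc \<C> ?I ?D ?W"
    using Assoc_natural[of p "Idn \<C> ?D" "Idn \<C> ?W"] by (simp add: Ev_dual_ten)
  also have "\<dots> = (Ev \<C> H \<cdot> (p \<otimes>\<^sub>a Idn \<C> H)) \<cdot> (Idn \<C> ?I \<otimes>\<^sub>a ?K) \<cdot> Assoc \<C> ?I ?D ?W"
    by (simp add: Ten_Cmp_Cmp)
  also have "\<dots> = s \<cdot> (LUnit \<C> H \<cdot> (Idn \<C> ?I \<otimes>\<^sub>a ?K)) \<cdot> Assoc \<C> ?I ?D ?W"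
    by (simp only: Ev_p) simp
  also have "LUnit \<C> H \<cdot> (Idn \<C> ?I \<otimes>\<^sub>a ?K) = ?K \<cdot> LUnit \<C> (?D \<otimes>\<^sub>o ?W)"
    using LUnit_natural[of ?K] by simp
  also have "s \<cdot> (?K \<cdot> LUnit \<C> (?D \<otimes>\<^sub>o ?W)) \<cdot> Assoc \<C> ?I ?D ?W = (s \<cdot> ?K) \<cdot> (LUnit \<C> ?D \<otimes>\<^sub>a Idn \<C> ?W)"
    by (simp add: LUnit_Assoc)
  also have "\<dots> = Ev \<C> X \<cdot> (LUnit \<C> ?D \<otimes>\<^sub>a ?f)"
    by (simp only: sK) (simp add: Ten_Cmp)
  also have "\<dots> = Ev \<C> ?W \<cdot> ((DualA \<C> ?f \<cdot> LUnit \<C> ?D) \<otimes>\<^sub>a Idn \<C> ?W)"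
    using Ev_DualA[of "LUnit \<C> ?D" ?f "Idn \<C> ?W"] by simp
  finally show "Ev \<C> ?W \<cdot> ((dual_ten \<C> X H \<cdot> ((DualA \<C> s \<cdot> dual_unit \<C>) \<otimes>\<^sub>a Idn \<C> ?D)) \<otimes>\<^sub>a Idn \<C> ?W) =
      Ev \<C> ?W \<cdot> ((DualA \<C> ?f \<cdot> LUnit \<C> ?D) \<otimes>\<^sub>a Idn \<C> ?W)"
    by (simp only: p_def)
qed simp_all

text \<open>In string diagrams, the pairing of the left-hand side with \<open>V \<otimes> X\<^sup>*\<close> contains \<open>coev_X\<close> joined to
  \<open>ev_X\<close> along \<open>X\<^sup>*\<close>, after \<open>f\<^sup>*\<close> has been moved across \<open>ev_V\<close> to become \<open>f\<close>. Straightening this strand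
  leaves \<open>ev \<cdot> (j f \<otimes> id)\<close>. For \<open>j\<close> the pivotal structure and \<open>f = id\<close> this computes the dual of
  the trace of \<open>X\<close>.\<close>

lemma dual_ten_Coev:
  fixes X defines "P \<equiv> Dual \<C> X"
  assumes f [simp]: "Src \<C> f = V" "Tgt \<C> f = X" and j [simp]: "Src \<C> j = X" "Tgt \<C> j = Dual \<C> P"
  shows "dual_ten \<C> V P \<cdot> (j \<otimes>\<^sub>a DualA \<C> f) \<cdot> Coev \<C> X =
    DualA \<C> (Ev \<C> P \<cdot> ((j \<cdot> f) \<otimes>\<^sub>a Idn \<C> P)) \<cdot> dual_unit \<C>"
proof (rule dual_eqI)
  have P [simp]: "Dual \<C> X = P"
    by (simp add: P_def)
  let ?W = "V \<otimes>\<^sub>o P" and ?U = "X \<otimes>\<^sub>o P" and ?I = "Unit \<C>"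
  let ?KV = "LUnit \<C> P \<cdot> (Ev \<C> V \<otimes>\<^sub>a Idn \<C> P) \<cdot> Inv \<C> (Assoc \<C> (Dual \<C> V) V P)"
  let ?KX = "LUnit \<C> P \<cdot> (Ev \<C> X \<otimes>\<^sub>a Idn \<C> P) \<cdot> Inv \<C> (Assoc \<C> P X P)"
  let ?t = "Ev \<C> P \<cdot> ((j \<cdot> f) \<otimes>\<^sub>a Idn \<C> P)"
  have "?KV \<cdot> (DualA \<C> f \<otimes>\<^sub>a Idn \<C> ?W)
      = LUnit \<C> P \<cdot> ((Ev \<C> V \<cdot> (DualA \<C> f \<otimes>\<^sub>a Idn \<C> V)) \<otimes>\<^sub>a Idn \<C> P) \<cdot> Inv \<C> (Assoc \<C> P V P)"
    using Inv_Assoc_natural[of "DualA \<C> f" "Idn \<C> V" "Idn \<C> P"] by (simp add: Ten_Cmp_Cmp)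
  also have "Ev \<C> V \<cdot> (DualA \<C> f \<otimes>\<^sub>a Idn \<C> V) = Ev \<C> X \<cdot> (Idn \<C> P \<otimes>\<^sub>a f)"
    using Ev_DualA_Idn[of "Idn \<C> V" f] by simp
  also have "LUnit \<C> P \<cdot> ((Ev \<C> X \<cdot> (Idn \<C> P \<otimes>\<^sub>a f)) \<otimes>\<^sub>a Idn \<C> P) \<cdot> Inv \<C> (Assoc \<C> P V P)
      = ?KX \<cdot> (Idn \<C> P \<otimes>\<^sub>a (f \<otimes>\<^sub>a Idn \<C> P))"
    using Inv_Assoc_natural[of "Idn \<C> P" f "Idn \<C> P"] by (simp add: Ten_Cmp_Cmp)
  finally have K: "?KV \<cdot> (DualA \<C> f \<otimes>\<^sub>a Idn \<C> ?W) = ?KX \<cdot> (Idn \<C> P \<otimes>\<^sub>a (f \<otimes>\<^sub>a Idn \<C> P))" .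
  have "((Idn \<C> X \<otimes>\<^sub>a ?KX) \<cdot> Assoc \<C> X P ?U \<cdot> (Coev \<C> X \<otimes>\<^sub>a Idn \<C> ?U) \<cdot> Inv \<C> (LUnit \<C> ?U)) \<cdot> LUnit \<C> ?U
      = LUnit \<C> ?U"
    using left_transpose_inverse[OF left_dual[of X], of "Idn \<C> ?U" ?U P] by simp
  then have straighten: "(Idn \<C> X \<otimes>\<^sub>a ?KX) \<cdot> Assoc \<C> X P ?U \<cdot> (Coev \<C> X \<otimes>\<^sub>a Idn \<C> ?U) = LUnit \<C> ?U"
    by simp
  have "Ev \<C> ?W \<cdot> ((dual_ten \<C> V P \<cdot> (j \<otimes>\<^sub>a DualA \<C> f) \<cdot> Coev \<C> X) \<otimes>\<^sub>a Idn \<C> ?W)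
      = (Ev \<C> ?W \<cdot> (dual_ten \<C> V P \<otimes>\<^sub>a Idn \<C> ?W)) \<cdot> ((j \<otimes>\<^sub>a DualA \<C> f) \<otimes>\<^sub>a Idn \<C> ?W) \<cdot> (Coev \<C> X \<otimes>\<^sub>a Idn \<C> ?W)"
    by (simp add: Ten_Cmp)
  also have "\<dots> = Ev \<C> P \<cdot> (Idn \<C> (Dual \<C> P) \<otimes>\<^sub>a ?KV) \<cdot> (j \<otimes>\<^sub>a (DualA \<C> f \<otimes>\<^sub>a Idn \<C> ?W)) \<cdot> Assoc \<C> X P ?W \<cdot>
        (Coev \<C> X \<otimes>\<^sub>a Idn \<C> ?W)"
    by (simp add: Ev_dual_ten Cmp_reassoc[OF Assoc_natural[of j "DualA \<C> f" "Idn \<C> ?W", simplified]])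
  also have "\<dots> = Ev \<C> P \<cdot> (j \<otimes>\<^sub>a (?KV \<cdot> (DualA \<C> f \<otimes>\<^sub>a Idn \<C> ?W))) \<cdot> Assoc \<C> X P ?W \<cdot> (Coev \<C> X \<otimes>\<^sub>a Idn \<C> ?W)"
    by (simp add: Ten_Cmp_Cmp)
  also have "\<dots> = Ev \<C> P \<cdot> (j \<otimes>\<^sub>a (?KX \<cdot> (Idn \<C> P \<otimes>\<^sub>a (f \<otimes>\<^sub>a Idn \<C> P)))) \<cdot> Assoc \<C> X P ?W \<cdot> (Coev \<C> X \<otimes>\<^sub>a Idn \<C> ?W)"
    by (simp only: K)
  also have "\<dots> = Ev \<C> P \<cdot> (j \<otimes>\<^sub>a Idn \<C> P) \<cdot> (Idn \<C> X \<otimes>\<^sub>a ?KX) \<cdot> (Idn \<C> X \<otimes>\<^sub>a (Idn \<C> P \<otimes>\<^sub>a (f \<otimes>\<^sub>a Idn \<C> P))) \<cdot>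
        Assoc \<C> X P ?W \<cdot> (Coev \<C> X \<otimes>\<^sub>a Idn \<C> ?W)"
    by (simp add: Ten_Cmp_Cmp)
  also have "\<dots> = Ev \<C> P \<cdot> (j \<otimes>\<^sub>a Idn \<C> P) \<cdot> (Idn \<C> X \<otimes>\<^sub>a ?KX) \<cdot> Assoc \<C> X P ?U \<cdot>
        (Idn \<C> (X \<otimes>\<^sub>o P) \<otimes>\<^sub>a (f \<otimes>\<^sub>a Idn \<C> P)) \<cdot> (Coev \<C> X \<otimes>\<^sub>a Idn \<C> ?W)"
    by (simp add: Cmp_reassoc[OF Assoc_natural[of "Idn \<C> X" "Idn \<C> P" "f \<otimes>\<^sub>a Idn \<C> P", symmetric, simplified]])
  also have "\<dots> = Ev \<C> P \<cdot> (j \<otimes>\<^sub>a Idn \<C> P) \<cdot>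
        ((Idn \<C> X \<otimes>\<^sub>a ?KX) \<cdot> Assoc \<C> X P ?U \<cdot> (Coev \<C> X \<otimes>\<^sub>a Idn \<C> ?U)) \<cdot> (Idn \<C> ?I \<otimes>\<^sub>a (f \<otimes>\<^sub>a Idn \<C> P))"
    by (simp add: Ten_Cmp)
  also have "\<dots> = Ev \<C> P \<cdot> (j \<otimes>\<^sub>a Idn \<C> P) \<cdot> (f \<otimes>\<^sub>a Idn \<C> P) \<cdot> LUnit \<C> ?W"
    using LUnit_natural[of "f \<otimes>\<^sub>a Idn \<C> P"] by (simp only: straighten) simp
  also have "\<dots> = ?t \<cdot> LUnit \<C> ?W"
    by (simp add: Ten_Cmp_Cmp)
  also have "\<dots> = Ev \<C> ?W \<cdot> ((DualA \<C> ?t \<cdot> dual_unit \<C>) \<otimes>\<^sub>a Idn \<C> ?W)"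
    by (simp add: Ev_dual_functional)
  finally show "Ev \<C> ?W \<cdot> ((dual_ten \<C> V P \<cdot> (j \<otimes>\<^sub>a DualA \<C> f) \<cdot> Coev \<C> X) \<otimes>\<^sub>a Idn \<C> ?W) =
      Ev \<C> ?W \<cdot> ((DualA \<C> ?t \<cdot> dual_unit \<C>) \<otimes>\<^sub>a Idn \<C> ?W)" .
qed (simp_all add: P_def[symmetric])

end

section \<open>Internal Homs and their module structure\<close>

locale ihom_module_category = finite_module_category \<C> \<M>
  for \<C> :: "('o, 'a, 'k::field, 'z) rigid_cat_scheme" (structure)
    and \<M> :: "('p, 'b, 'k, 'o, 'a, 'y) ihom_mod_cat_scheme" (structure) +
  assumes has_ihoms: "has_internal_homs \<C> \<M>"
begin

lemma Src_IHomA [simp]: "Src \<C> (IHomA \<M> M f) = IHom \<M> M (Src \<M> f)"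
  and Tgt_IHomA [simp]: "Tgt \<C> (IHomA \<M> M f) = IHom \<M> M (Tgt \<M> f)"
  and IHomA_Idn [simp]: "IHomA \<M> M (Idn \<M> N) = Idn \<C> (IHom \<M> M N)"
  and Src_ICoev [simp]: "Src \<C> (ICoev \<M> X M) = X"
  and Tgt_ICoev [simp]: "Tgt \<C> (ICoev \<M> X M) = IHom \<M> M (X \<rhd> M)"
  and Src_IEv [simp]: "Src \<M> (IEv \<M> M N) = IHom \<M> M N \<rhd> M"
  and Tgt_IEv [simp]: "Tgt \<M> (IEv \<M> M N) = N"
  using has_ihoms
  by (auto simp: has_internal_homs_def is_adjunction_def is_functor_def is_nat_trans_def Hom_def)

lemma IHomA_Cmp: "Tgt \<M> f = Src \<M> g \<Longrightarrow> IHomA \<M> M (g \<diamond> f) = IHomA \<M> M g \<cdot> IHomA \<M> M f"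
  and ICoev_natural: "IHomA \<M> M (h \<triangleright> Idn \<M> M) \<cdot> ICoev \<M> (Src \<C> h) M = ICoev \<M> (Tgt \<C> h) M \<cdot> h"
  and IEv_natural: "f \<diamond> IEv \<M> M (Src \<M> f) = IEv \<M> M (Tgt \<M> f) \<diamond> (IHomA \<M> M f \<triangleright> Idn \<M> M)"
  and IEv_ICoev: "IEv \<M> M (X \<rhd> M) \<diamond> (ICoev \<M> X M \<triangleright> Idn \<M> M) = Idn \<M> (X \<rhd> M)"
  and ICoev_IEv: "IHomA \<M> M (IEv \<M> M N) \<cdot> ICoev \<M> (IHom \<M> M N) M = Idn \<C> (IHom \<M> M N)"
  using has_ihoms
  by (auto simp: has_internal_homs_def is_adjunction_def is_functor_def is_nat_trans_def)

lemma Src_imate [simp]: "Src \<M> f = X \<rhd> M \<Longrightarrow> Src \<C> (imate \<C> \<M> X M f) = X"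
  and Tgt_imate [simp]: "Src \<M> f = X \<rhd> M \<Longrightarrow> Tgt \<C> (imate \<C> \<M> X M f) = IHom \<M> M (Tgt \<M> f)"
  by (simp_all add: imate_def)

lemma IHomA_imate:
  "\<lbrakk>Src \<M> f = X \<rhd> M; Tgt \<M> f = Src \<M> g\<rbrakk> \<Longrightarrow> IHomA \<M> M g \<cdot> imate \<C> \<M> X M f = imate \<C> \<M> X M (g \<diamond> f)"
  by (simp add: imate_def IHomA_Cmp)

lemma imate_Cmp:
  "\<lbrakk>Src \<M> f = X \<rhd> M; Tgt \<C> h = X\<rbrakk> \<Longrightarrow>
    imate \<C> \<M> X M f \<cdot> h = imate \<C> \<M> (Src \<C> h) M (f \<diamond> (h \<triangleright> Idn \<M> M))"
  using ICoev_natural[of M h] by (simp add: imate_def IHomA_Cmp)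

lemma IEv_imate:
  assumes "Src \<M> f = X \<rhd> M" "Tgt \<M> f = N"
  shows "IEv \<M> M N \<diamond> (imate \<C> \<M> X M f \<triangleright> Idn \<M> M) = f"
proof -
  have "IEv \<M> M N \<diamond> (imate \<C> \<M> X M f \<triangleright> Idn \<M> M)
      = (IEv \<M> M N \<diamond> (IHomA \<M> M f \<triangleright> Idn \<M> M)) \<diamond> (ICoev \<M> X M \<triangleright> Idn \<M> M)"
    using assms by (simp add: imate_def Act_Cmp)
  also have "\<dots> = f \<diamond> IEv \<M> M (X \<rhd> M) \<diamond> (ICoev \<M> X M \<triangleright> Idn \<M> M)"
    using assms by (simp add: \<M>.Cmp_reassoc[OF IEv_natural[of f M, symmetric, unfolded assms]])
  finally show ?thesis
    using assms by (simp add: IEv_ICoev)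
qed

lemma imate_IEv:
  assumes "Src \<C> h = X" "Tgt \<C> h = IHom \<M> M N"
  shows "imate \<C> \<M> X M (IEv \<M> M N \<diamond> (h \<triangleright> Idn \<M> M)) = h"
proof -
  have "imate \<C> \<M> X M (IEv \<M> M N \<diamond> (h \<triangleright> Idn \<M> M)) = imate \<C> \<M> (IHom \<M> M N) M (IEv \<M> M N) \<cdot> h"
    using assms by (simp add: imate_Cmp)
  also have "imate \<C> \<M> (IHom \<M> M N) M (IEv \<M> M N) = Idn \<C> (IHom \<M> M N)"
    by (simp add: imate_def ICoev_IEv)
  finally show ?thesis
    using assms by simp
qed

lemma imate_inject:
  assumes "imate \<C> \<M> X M f = imate \<C> \<M> X M g" "Src \<M> f = X \<rhd> M" "Src \<M> g = X \<rhd> M" "Tgt \<M> f = Tgt \<M> g"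
  shows "f = g"
  by (metis assms IEv_imate)

lemma IHomBi_Idn: "IHomBi \<C> \<M> (Idn \<M> M) g = IHomA \<M> M g"
  using imate_IEv[of "Idn \<C> (IHom \<M> M (Src \<M> g))" "IHom \<M> M (Src \<M> g)" M "Src \<M> g"]
  by (simp add: IHomBi_def)

lemma Src_ihom_a [simp]: "Src \<C> (ihom_a \<C> \<M> X M N) = X \<otimes>\<^sub>o IHom \<M> M N"
  and Tgt_ihom_a [simp]: "Tgt \<C> (ihom_a \<C> \<M> X M N) = IHom \<M> M (X \<rhd> N)"
  and Src_ihom_b_nat [simp]: "Src \<C> (ihom_b_nat \<C> \<M> Y M N) = IHom \<M> (Y \<rhd> M) N \<otimes>\<^sub>o Y"
  and Tgt_ihom_b_nat [simp]: "Tgt \<C> (ihom_b_nat \<C> \<M> Y M N) = IHom \<M> M N"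
  by (simp_all add: ihom_a_def ihom_b_nat_def)

lemma ihom_a_Cmp:
  assumes [simp]: "Src \<C> f = W" "Tgt \<C> f = X \<otimes>\<^sub>o IHom \<M> M N"
  shows "ihom_a \<C> \<M> X M N \<cdot> f =
    imate \<C> \<M> W M ((Idn \<C> X \<triangleright> IEv \<M> M N) \<diamond> MAssoc \<M> X (IHom \<M> M N) M \<diamond> (f \<triangleright> Idn \<M> M))"
  by (simp add: ihom_a_def imate_Cmp)

lemma ihom_b_nat_Cmp:
  assumes [simp]: "Src \<C> f = W" "Tgt \<C> f = IHom \<M> (Y \<rhd> M) N"
  shows "ihom_b_nat \<C> \<M> Y M N \<cdot> (f \<otimes>\<^sub>a Idn \<C> Y) =
    imate \<C> \<M> (W \<otimes>\<^sub>o Y) M (IEv \<M> (Y \<rhd> M) N \<diamond> (f \<triangleright> Idn \<M> (Y \<rhd> M)) \<diamond> MAssoc \<M> W Y M)"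
  using MAssoc_natural[of f "Idn \<C> Y" "Idn \<M> M"] by (simp add: ihom_b_nat_def imate_Cmp)

lemma ihom_b_rmate:
  "ihom_b \<C> \<M> Y M N = \<C>.rmate Y (Dual \<C> Y) (Coev \<C> Y) (IHom \<M> (Y \<rhd> M) N) (ihom_b_nat \<C> \<M> Y M N)"
  by (simp add: ihom_b_def \<C>.rmate_def Let_def)

lemma Src_ihom_b [simp]: "Src \<C> (ihom_b \<C> \<M> Y M N) = IHom \<M> (Y \<rhd> M) N"
  and Tgt_ihom_b [simp]: "Tgt \<C> (ihom_b \<C> \<M> Y M N) = IHom \<M> M N \<otimes>\<^sub>o Dual \<C> Y"
  by (simp_all add: ihom_b_rmate)

lemma ihom_b_Cmp:
  assumes [simp]: "Src \<C> f = W" "Tgt \<C> f = IHom \<M> (Y \<rhd> M) N"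
  shows "ihom_b \<C> \<M> Y M N \<cdot> f =
    \<C>.rmate Y (Dual \<C> Y) (Coev \<C> Y) W
      (imate \<C> \<M> (W \<otimes>\<^sub>o Y) M (IEv \<M> (Y \<rhd> M) N \<diamond> (f \<triangleright> Idn \<M> (Y \<rhd> M)) \<diamond> MAssoc \<M> W Y M))"
  by (simp add: ihom_b_rmate \<C>.rmate_Cmp ihom_b_nat_Cmp)

text \<open>Composition with \<open>ihom_b\<close> is the composite of the bijections
  \<open>Hom(W, [Y \<rhd> M, N]) \<simeq> Hom((W \<otimes> Y) \<rhd> M, N) \<simeq> Hom(W \<otimes> Y, [M, N]) \<simeq> Hom(W, [M, N] \<otimes> Y\<^sup>*)\<close>.\<close>

lemma ihom_b_inject:
  assumes eq: "ihom_b \<C> \<M> Y M N \<cdot> f = ihom_b \<C> \<M> Y M N \<cdot> g"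
    and [simp]: "Src \<C> f = W" "Src \<C> g = W" "Tgt \<C> f = IHom \<M> (Y \<rhd> M) N" "Tgt \<C> g = IHom \<M> (Y \<rhd> M) N"
  shows "f = g"
proof -
  let ?i = "\<lambda>f. imate \<C> \<M> (W \<otimes>\<^sub>o Y) M (IEv \<M> (Y \<rhd> M) N \<diamond> (f \<triangleright> Idn \<M> (Y \<rhd> M)) \<diamond> MAssoc \<M> W Y M)"
  have r: "\<C>.runmate Y (Dual \<C> Y) (Ev \<C> Y) (IHom \<M> M N) (ihom_b \<C> \<M> Y M N \<cdot> h) = ?i h"
    if "Src \<C> h = W" "Tgt \<C> h = IHom \<M> (Y \<rhd> M) N" for h
    using that by (simp add: ihom_b_Cmp \<C>.runmate_rmate[OF \<C>.left_dual])
  have "?i f = ?i g"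
    using r[of f] r[of g] by (simp only: eq assms(2-5))
  then have "(IEv \<M> (Y \<rhd> M) N \<diamond> (f \<triangleright> Idn \<M> (Y \<rhd> M))) \<diamond> MAssoc \<M> W Y M
      = (IEv \<M> (Y \<rhd> M) N \<diamond> (g \<triangleright> Idn \<M> (Y \<rhd> M))) \<diamond> MAssoc \<M> W Y M"
    by simp (erule imate_inject, simp_all)
  then have "IEv \<M> (Y \<rhd> M) N \<diamond> (f \<triangleright> Idn \<M> (Y \<rhd> M)) = IEv \<M> (Y \<rhd> M) N \<diamond> (g \<triangleright> Idn \<M> (Y \<rhd> M))"
    by (rule \<M>.iso_cancel_right[OF MAssoc_iso]) simp_all
  from arg_cong[OF this, of "imate \<C> \<M> W (Y \<rhd> M)"] show "f = g"
    by (simp add: imate_IEv)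
qed

lemma iso_ihom_b: "is_isomorphism \<C> (ihom_b \<C> \<M> Y M N)"
proof (rule \<C>.iso_of_right_inverse)
  let ?W = "IHom \<M> M N \<otimes>\<^sub>o Dual \<C> Y"
  let ?u = "\<C>.runmate Y (Dual \<C> Y) (Ev \<C> Y) (IHom \<M> M N) (Idn \<C> ?W)"
  let ?g = "imate \<C> \<M> ?W (Y \<rhd> M) (IEv \<M> M N \<diamond> (?u \<triangleright> Idn \<M> M) \<diamond> Inv \<M> (MAssoc \<M> ?W Y M))"
  have [simp]: "Src \<C> ?u = ?W \<otimes>\<^sub>o Y" "Tgt \<C> ?u = IHom \<M> M N"
    by (simp_all add: \<C>.runmate_def)
  have "ihom_b \<C> \<M> Y M N \<cdot> ?g = \<C>.rmate Y (Dual \<C> Y) (Coev \<C> Y) ?W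
      (imate \<C> \<M> (?W \<otimes>\<^sub>o Y) M ((IEv \<M> (Y \<rhd> M) N \<diamond> (?g \<triangleright> Idn \<M> (Y \<rhd> M))) \<diamond> MAssoc \<M> ?W Y M))"
    by (simp add: ihom_b_Cmp)
  also have "\<dots> = \<C>.rmate Y (Dual \<C> Y) (Coev \<C> Y) ?W ?u"
    by (subst IEv_imate) (simp_all add: imate_IEv)
  also have "\<dots> = Idn \<C> ?W"
    by (simp add: \<C>.rmate_runmate[OF \<C>.left_dual])
  finally show "ihom_b \<C> \<M> Y M N \<cdot> ?g = Idn \<C> (Tgt \<C> (ihom_b \<C> \<M> Y M N))"
    by simp
  show "Src \<C> ?g = Tgt \<C> (ihom_b \<C> \<M> Y M N)" "Tgt \<C> ?g = Src \<C> (ihom_b \<C> \<M> Y M N)"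
    by simp_all
next
  fix h
  assume h: "Src \<C> h = Src \<C> (ihom_b \<C> \<M> Y M N)" "Tgt \<C> h = Src \<C> (ihom_b \<C> \<M> Y M N)"
    "ihom_b \<C> \<M> Y M N \<cdot> h = ihom_b \<C> \<M> Y M N"
  show "h = Idn \<C> (Src \<C> (ihom_b \<C> \<M> Y M N))"
    by (rule ihom_b_inject[of Y M N]) (use h in simp_all)
qed

text \<open>In the same way composition with \<open>ihom_a\<close> is the composite of the bijections
  \<open>Hom(W, X \<otimes> [M, N]) \<simeq> Hom(X\<^sup>* \<otimes> W, [M, N]) \<simeq> Hom(X\<^sup>* \<rhd> (W \<rhd> M), N) \<simeq> Hom(W \<rhd> M, X \<rhd> N)
  \<simeq> Hom(W, [M, X \<rhd> N])\<close>. Below, \<open>?c g\<close> is the morphism \<open>W \<rightarrow> X \<otimes> [M, N]\<close> that corresponds to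
  \<open>g : X\<^sup>* \<otimes> W \<rightarrow> [M, N]\<close>.\<close>

lemma iso_ihom_a: "is_isomorphism \<C> (ihom_a \<C> \<M> X M N)"
proof (rule \<C>.iso_of_right_inverse)
  let ?D = "Dual \<C> X" and ?H = "IHom \<M> M N" and ?W = "IHom \<M> M (X \<rhd> N)"
  let ?c = "\<lambda>W g. (Idn \<C> X \<otimes>\<^sub>a g) \<cdot> Assoc \<C> X ?D W \<cdot> (Coev \<C> X \<otimes>\<^sub>a Idn \<C> W) \<cdot> Inv \<C> (LUnit \<C> W)"
  let ?t = "\<lambda>W g. IEv \<M> M N \<diamond> (g \<triangleright> Idn \<M> M) \<diamond> Inv \<M> (MAssoc \<M> ?D W M)"
  let ?l = "lmate X ?D (Coev \<C> X)"
  have a_c: "ihom_a \<C> \<M> X M N \<cdot> ?c W g = imate \<C> \<M> W M (?l (W \<rhd> M) (?t W g))"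
    if "Src \<C> g = ?D \<otimes>\<^sub>o W" "Tgt \<C> g = ?H" for W g
    using that by (simp add: ihom_a_Cmp lmate_act[OF \<C>.left_dual, of g X W ?H "IEv \<M> M N" M, simplified])
  have l_simps [simp]: "Src \<M> (?l N' g) = N'" "Tgt \<M> (?l N' g) = X \<rhd> Tgt \<M> g"
    if "Src \<M> g = ?D \<rhd> N'" for N' g
    using that by (simp_all add: lmate_def)
  let ?v = "lunmate X ?D (Ev \<C> X) N (IEv \<M> M (X \<rhd> N))"
  have [simp]: "Src \<M> ?v = ?D \<rhd> (?W \<rhd> M)" "Tgt \<M> ?v = N"
    by (simp_all add: lunmate_def)
  let ?g = "imate \<C> \<M> (?D \<otimes>\<^sub>o ?W) M (?v \<diamond> MAssoc \<M> ?D ?W M)"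
  have "?t ?W ?g = (IEv \<M> M N \<diamond> (?g \<triangleright> Idn \<M> M)) \<diamond> Inv \<M> (MAssoc \<M> ?D ?W M)"
    by simp
  also have "\<dots> = ?v"
    by (subst IEv_imate) simp_all
  finally have "ihom_a \<C> \<M> X M N \<cdot> ?c ?W ?g = imate \<C> \<M> ?W M (?l (?W \<rhd> M) ?v)"
    by (subst a_c) simp_all
  also have "\<dots> = Idn \<C> ?W"
    using imate_IEv[of "Idn \<C> ?W" ?W M "X \<rhd> N"] by (simp add: lmate_lunmate[OF \<C>.left_dual])
  finally show "ihom_a \<C> \<M> X M N \<cdot> ?c ?W ?g = Idn \<C> (Tgt \<C> (ihom_a \<C> \<M> X M N))"
    by simp
  show "Src \<C> (?c ?W ?g) = Tgt \<C> (ihom_a \<C> \<M> X M N)" "Tgt \<C> (?c ?W ?g) = Src \<C> (ihom_a \<C> \<M> X M N)"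
    by simp_all
  fix h
  let ?V = "X \<otimes>\<^sub>o ?H"
  assume h: "Src \<C> h = Src \<C> (ihom_a \<C> \<M> X M N)" "Tgt \<C> h = Src \<C> (ihom_a \<C> \<M> X M N)"
    and a_h: "ihom_a \<C> \<M> X M N \<cdot> h = ihom_a \<C> \<M> X M N"
  let ?d = "\<lambda>h. LUnit \<C> ?H \<cdot> (Ev \<C> X \<otimes>\<^sub>a Idn \<C> ?H) \<cdot> Inv \<C> (Assoc \<C> ?D X ?H) \<cdot> (Idn \<C> ?D \<otimes>\<^sub>a h)"
  have c_d: "?c ?V (?d f) = f" if "Src \<C> f = ?V" "Tgt \<C> f = ?V" for f
    by (rule \<C>.left_transpose_inverse[OF \<C>.left_dual that])
  have d_eqI: "?d f = ?d f'"
    if "ihom_a \<C> \<M> X M N \<cdot> f = ihom_a \<C> \<M> X M N \<cdot> f'"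
      and f: "Src \<C> f = ?V" "Tgt \<C> f = ?V" "Src \<C> f' = ?V" "Tgt \<C> f' = ?V" for f f'
  proof -
    have d_simps [simp]: "Src \<C> (?d f) = ?D \<otimes>\<^sub>o ?V" "Src \<C> (?d f') = ?D \<otimes>\<^sub>o ?V" "Tgt \<C> (?d f) = ?H" "Tgt \<C> (?d f') = ?H"
      using f by simp_all
    have t: "Src \<M> (?t ?V (?d f)) = ?D \<rhd> (?V \<rhd> M)" "Src \<M> (?t ?V (?d f')) = ?D \<rhd> (?V \<rhd> M)"
        "Tgt \<M> (?t ?V (?d f)) = N" "Tgt \<M> (?t ?V (?d f')) = N"
      using f by simp_all
    have "imate \<C> \<M> ?V M (?l (?V \<rhd> M) (?t ?V (?d f))) = imate \<C> \<M> ?V M (?l (?V \<rhd> M) (?t ?V (?d f')))"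
    proof -
      have "imate \<C> \<M> ?V M (?l (?V \<rhd> M) (?t ?V (?d f))) = ihom_a \<C> \<M> X M N \<cdot> ?c ?V (?d f)"
        by (rule a_c[symmetric]) (use f in simp_all)
      also have "\<dots> = ihom_a \<C> \<M> X M N \<cdot> ?c ?V (?d f')"
        by (simp only: c_d f that(1))
      also have "\<dots> = imate \<C> \<M> ?V M (?l (?V \<rhd> M) (?t ?V (?d f')))"
        by (rule a_c) (use f in simp_all)
      finally show ?thesis .
    qed
    then have "?l (?V \<rhd> M) (?t ?V (?d f)) = ?l (?V \<rhd> M) (?t ?V (?d f'))"
      by (rule imate_inject) (use f in simp_all)
    then have "lunmate X ?D (Ev \<C> X) N (?l (?V \<rhd> M) (?t ?V (?d f))) = lunmate X ?D (Ev \<C> X) N (?l (?V \<rhd> M) (?t ?V (?d f')))"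
      by (rule arg_cong)
    then have "?t ?V (?d f) = ?t ?V (?d f')"
      by (simp only: lunmate_lmate[OF \<C>.left_dual] t)
    then have "(IEv \<M> M N \<diamond> (?d f \<triangleright> Idn \<M> M)) \<diamond> Inv \<M> (MAssoc \<M> ?D ?V M)
        = (IEv \<M> M N \<diamond> (?d f' \<triangleright> Idn \<M> M)) \<diamond> Inv \<M> (MAssoc \<M> ?D ?V M)"
      using f by simp
    then have "IEv \<M> M N \<diamond> (?d f \<triangleright> Idn \<M> M) = IEv \<M> M N \<diamond> (?d f' \<triangleright> Idn \<M> M)"
      by (rule \<M>.iso_cancel_right[OF \<M>.iso_Inv[OF MAssoc_iso]]) (use f in simp_all)
    then have "imate \<C> \<M> (?D \<otimes>\<^sub>o ?V) M (IEv \<M> M N \<diamond> (?d f \<triangleright> Idn \<M> M)) =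
        imate \<C> \<M> (?D \<otimes>\<^sub>o ?V) M (IEv \<M> M N \<diamond> (?d f' \<triangleright> Idn \<M> M))"
      by (rule arg_cong)
    then show "?d f = ?d f'"
      using imate_IEv[of "?d f" "?D \<otimes>\<^sub>o ?V" M N] imate_IEv[of "?d f'" "?D \<otimes>\<^sub>o ?V" M N]
      by (simp only: d_simps)
  qed
  have "?d h = ?d (Idn \<C> ?V)"
    by (rule d_eqI) (use h a_h in simp_all)
  then have "?c ?V (?d h) = ?c ?V (?d (Idn \<C> ?V))"
    by (rule arg_cong)
  then show "h = Idn \<C> (Src \<C> (ihom_a \<C> \<M> X M N))"
    using c_d[of h] c_d[of "Idn \<C> ?V"] h by (simp only: Src_ihom_a \<C>.Src_Idn \<C>.Tgt_Idn)
qed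

lemma Src_ihom_c [simp]: "Src \<C> (ihom_c \<C> \<M> X M N Y) = (X \<otimes>\<^sub>o IHom \<M> M N) \<otimes>\<^sub>o Dual \<C> Y"
  and Tgt_ihom_c [simp]: "Tgt \<C> (ihom_c \<C> \<M> X M N Y) = IHom \<M> (Y \<rhd> M) (X \<rhd> N)"
  and iso_ihom_c: "is_isomorphism \<C> (ihom_c \<C> \<M> X M N Y)"
  by (simp_all add: ihom_c_def \<C>.iso_simps iso_ihom_b \<C>.iso_Cmp \<C>.iso_Inv \<C>.iso_Ten iso_ihom_a \<C>.iso_Idn)

text \<open>After composing with \<open>ihom_b\<close>, both sides become \<open>coev_X\<close> followed on its left leg by the morphism
  \<open>X \<rightarrow> [M, X' \<rhd> M']\<close> that corresponds to \<open>j \<rhd> n\<close>. Hence inserting the point \<open>1 \<rightarrow> [M, M']\<close> of \<open>n\<close>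
  between the legs of \<open>coev_X\<close> produces the point of \<open>j \<rhd> n\<close>.\<close>

lemma ihom_c_point:
  assumes n [simp]: "Src \<M> n = M" "Tgt \<M> n = M'" and j [simp]: "Src \<C> j = X" "Tgt \<C> j = X'"
  shows "ihom_c \<C> \<M> X' M M' X \<cdot>
      (((Idn \<C> X' \<otimes>\<^sub>a imate \<C> \<M> (Unit \<C>) M (n \<diamond> MUnit \<M> M)) \<cdot> Inv \<C> (RUnit \<C> X') \<cdot> j) \<otimes>\<^sub>a Idn \<C> (Dual \<C> X)) \<cdot>
      Coev \<C> X =
    imate \<C> \<M> (Unit \<C>) (X \<rhd> M) ((j \<triangleright> n) \<diamond> MUnit \<M> (X \<rhd> M))"
proof (rule ihom_b_inject)
  let ?I = "Unit \<C>" and ?D = "Dual \<C> X"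
  define w where "w = imate \<C> \<M> ?I M (n \<diamond> MUnit \<M> M)"
  have w [simp]: "Src \<C> w = ?I" "Tgt \<C> w = IHom \<M> M M'"
    by (simp_all add: w_def)
  let ?p = "Inv \<C> (RUnit \<C> X') \<cdot> j"
  let ?k = "(Idn \<C> X' \<otimes>\<^sub>a w) \<cdot> ?p"
  let ?m = "imate \<C> \<M> X M (j \<triangleright> n)"
  have "(Idn \<C> X' \<triangleright> IEv \<M> M M') \<diamond> MAssoc \<M> X' (IHom \<M> M M') M \<diamond> (?k \<triangleright> Idn \<M> M)
      = (Idn \<C> X' \<triangleright> IEv \<M> M M') \<diamond> MAssoc \<M> X' (IHom \<M> M M') M \<diamond> ((Idn \<C> X' \<otimes>\<^sub>a w) \<triangleright> Idn \<M> M) \<diamond> (?p \<triangleright> Idn \<M> M)"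
    by (simp add: Act_Cmp)
  also have "\<dots> = (Idn \<C> X' \<triangleright> (IEv \<M> M M' \<diamond> (w \<triangleright> Idn \<M> M))) \<diamond> MAssoc \<M> X' ?I M \<diamond> (?p \<triangleright> Idn \<M> M)"
    by (simp add: \<M>.Cmp_reassoc[OF MAssoc_natural[of "Idn \<C> X'" w "Idn \<M> M", simplified]] Act_Cmp_Cmp)
  also have "IEv \<M> M M' \<diamond> (w \<triangleright> Idn \<M> M) = n \<diamond> MUnit \<M> M"
    by (simp add: w_def IEv_imate)
  also have "(Idn \<C> X' \<triangleright> (n \<diamond> MUnit \<M> M)) \<diamond> MAssoc \<M> X' ?I M \<diamond> (?p \<triangleright> Idn \<M> M)
      = (Idn \<C> X' \<triangleright> n) \<diamond> ((Idn \<C> X' \<triangleright> MUnit \<M> M) \<diamond> MAssoc \<M> X' ?I M) \<diamond> (?p \<triangleright> Idn \<M> M)"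
    by (simp add: Act_Cmp_Cmp)
  also have "\<dots> = j \<triangleright> n"
    by (simp only: module_triangle) (simp add: Act_Cmp)
  finally have k: "(Idn \<C> X' \<triangleright> IEv \<M> M M') \<diamond> MAssoc \<M> X' (IHom \<M> M M') M \<diamond> (?k \<triangleright> Idn \<M> M) = j \<triangleright> n" .
  have a_k: "ihom_a \<C> \<M> X' M M' \<cdot> ?k = ?m"
    by (subst ihom_a_Cmp[of ?k X]) (simp_all add: k)
  have b_c: "ihom_b \<C> \<M> X M (X' \<rhd> M') \<cdot> ihom_c \<C> \<M> X' M M' X = ihom_a \<C> \<M> X' M M' \<otimes>\<^sub>a Idn \<C> ?D"
    by (simp add: ihom_c_def \<C>.iso_simps iso_ihom_b)
  have "ihom_b \<C> \<M> X M (X' \<rhd> M') \<cdot> ihom_c \<C> \<M> X' M M' X \<cdot> (?k \<otimes>\<^sub>a Idn \<C> ?D) \<cdot> Coev \<C> X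
      = ((ihom_a \<C> \<M> X' M M' \<cdot> ?k) \<otimes>\<^sub>a Idn \<C> ?D) \<cdot> Coev \<C> X"
    by (simp add: \<C>.Cmp_reassoc1[OF b_c] \<C>.Ten_Cmp_Cmp)
  also have "\<dots> = (?m \<otimes>\<^sub>a Idn \<C> ?D) \<cdot> \<C>.rmate X ?D (Coev \<C> X) ?I (LUnit \<C> X)"
    by (simp only: a_k) (simp add: \<C>.rmate_LUnit)
  also have "\<dots> = \<C>.rmate X ?D (Coev \<C> X) ?I (?m \<cdot> LUnit \<C> X)"
    by (rule \<C>.Cmp_rmate) simp_all
  also have "?m \<cdot> LUnit \<C> X = imate \<C> \<M> (?I \<otimes>\<^sub>o X) M ((j \<triangleright> n) \<diamond> (LUnit \<C> X \<triangleright> Idn \<M> M))"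
    by (simp add: imate_Cmp)
  also have "\<dots> = imate \<C> \<M> (?I \<otimes>\<^sub>o X) M (((j \<triangleright> n) \<diamond> MUnit \<M> (X \<rhd> M)) \<diamond> MAssoc \<M> ?I X M)"
    by (simp add: MUnit_MAssoc)
  also have "(j \<triangleright> n) \<diamond> MUnit \<M> (X \<rhd> M)
      = IEv \<M> (X \<rhd> M) (X' \<rhd> M') \<diamond> (imate \<C> \<M> ?I (X \<rhd> M) ((j \<triangleright> n) \<diamond> MUnit \<M> (X \<rhd> M)) \<triangleright> Idn \<M> (X \<rhd> M))"
    by (simp add: IEv_imate)
  also have "\<C>.rmate X ?D (Coev \<C> X) ?I (imate \<C> \<M> (?I \<otimes>\<^sub>o X) M
      ((IEv \<M> (X \<rhd> M) (X' \<rhd> M') \<diamond> (imate \<C> \<M> ?I (X \<rhd> M) ((j \<triangleright> n) \<diamond> MUnit \<M> (X \<rhd> M)) \<triangleright> Idn \<M> (X \<rhd> M))) \<diamond>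
        MAssoc \<M> ?I X M))
      = ihom_b \<C> \<M> X M (X' \<rhd> M') \<cdot> imate \<C> \<M> ?I (X \<rhd> M) ((j \<triangleright> n) \<diamond> MUnit \<M> (X \<rhd> M))"
    by (simp add: ihom_b_Cmp)
  finally show "ihom_b \<C> \<M> X M (X' \<rhd> M') \<cdot> ihom_c \<C> \<M> X' M M' X \<cdot>
      (((Idn \<C> X' \<otimes>\<^sub>a imate \<C> \<M> ?I M (n \<diamond> MUnit \<M> M)) \<cdot> Inv \<C> (RUnit \<C> X') \<cdot> j) \<otimes>\<^sub>a Idn \<C> ?D) \<cdot> Coev \<C> X =
    ihom_b \<C> \<M> X M (X' \<rhd> M') \<cdot> imate \<C> \<M> ?I (X \<rhd> M) ((j \<triangleright> n) \<diamond> MUnit \<M> (X \<rhd> M))"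
    by (simp only: w_def)
qed simp_all

end

section \<open>Ends and the product of class functions\<close>

lemma end_factorization:
  assumes "is_end \<D> \<C> Q0 Q1 E \<pi>" "is_dinatural \<D> \<C> Q0 Q1 W p"
  defines "h \<equiv> (THE h. h \<in> Hom \<C> W E \<and> (\<forall>X. \<pi> X \<cdot>\<^bsub>\<C>\<^esub> h = p X))"
  shows "h \<in> Hom \<C> W E" and "\<pi> X \<cdot>\<^bsub>\<C>\<^esub> h = p X"
proof -
  have "\<exists>!h. h \<in> Hom \<C> W E \<and> (\<forall>X. \<pi> X \<cdot>\<^bsub>\<C>\<^esub> h = p X)"
    using assms(1,2) by (simp add: is_end_def)
  from theI'[OF this] show "h \<in> Hom \<C> W E" "\<pi> X \<cdot>\<^bsub>\<C>\<^esub> h = p X"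
    by (simp_all add: h_def)
qed

context finite_tensor_category
begin

lemma central_end_Hom:
  assumes "is_central_end \<C> Z \<pi>Z"
  shows "\<pi>Z V X \<in> Hom \<C> (Z V) ((X \<otimes>\<^sub>o V) \<otimes>\<^sub>o Dual \<C> X)"
  using assms by (simp add: is_central_end_def is_end_def is_dinatural_def)

lemma
  assumes Z: "is_central_end \<C> Z \<pi>Z" and g [simp]: "Src \<C> g = V" "Tgt \<C> g = V'"
  shows ZA_Hom: "ZA \<C> Z \<pi>Z g \<in> Hom \<C> (Z V) (Z V')"
    and central_end_ZA:
      "\<pi>Z V' X \<cdot> ZA \<C> Z \<pi>Z g = ((Idn \<C> X \<otimes>\<^sub>a g) \<otimes>\<^sub>a Idn \<C> (Dual \<C> X)) \<cdot> \<pi>Z V X"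
proof -
  let ?Q0 = "\<lambda>V X Y. (Y \<otimes>\<^sub>o V) \<otimes>\<^sub>o Dual \<C> X" and ?Q1 = "\<lambda>V f g. (g \<otimes>\<^sub>a Idn \<C> V) \<otimes>\<^sub>a DualA \<C> f"
  let ?p = "\<lambda>X. ((Idn \<C> X \<otimes>\<^sub>a g) \<otimes>\<^sub>a Idn \<C> (Dual \<C> X)) \<cdot> \<pi>Z V X"
  have [simp]: "Src \<C> (\<pi>Z V X) = Z V" "Tgt \<C> (\<pi>Z V X) = (X \<otimes>\<^sub>o V) \<otimes>\<^sub>o Dual \<C> X" for X
    using central_end_Hom[OF Z, of V X] by (simp_all add: Hom_def)
  have end': "is_end \<C> \<C> (?Q0 V') (?Q1 V') (Z V') (\<pi>Z V')"
    and dinat: "is_dinatural \<C> \<C> (?Q0 V) (?Q1 V) (Z V) (\<pi>Z V)"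
    using Z by (simp_all add: is_central_end_def is_end_def)
  have "is_dinatural \<C> \<C> (?Q0 V') (?Q1 V') (Z V) ?p"
    unfolding is_dinatural_def
  proof (intro conjI allI)
    show "?p X \<in> Hom \<C> (Z V) (?Q0 V' X X)" for X
      by (simp add: HomI)
    fix f
    let ?X = "Src \<C> f" and ?Y = "Tgt \<C> f"
    have "?Q1 V' (Idn \<C> ?X) f \<cdot> ?p ?X
        = ((Idn \<C> ?Y \<otimes>\<^sub>a g) \<otimes>\<^sub>a Idn \<C> (Dual \<C> ?X)) \<cdot> ?Q1 V (Idn \<C> ?X) f \<cdot> \<pi>Z V ?X"
      by (simp add: Ten_Cmp Ten_Cmp_Cmp)
    also have "?Q1 V (Idn \<C> ?X) f \<cdot> \<pi>Z V ?X = ?Q1 V f (Idn \<C> ?Y) \<cdot> \<pi>Z V ?Y"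
      using dinat by (simp add: is_dinatural_def)
    also have "((Idn \<C> ?Y \<otimes>\<^sub>a g) \<otimes>\<^sub>a Idn \<C> (Dual \<C> ?X)) \<cdot> ?Q1 V f (Idn \<C> ?Y) \<cdot> \<pi>Z V ?Y
        = ?Q1 V' f (Idn \<C> ?Y) \<cdot> ?p ?Y"
      by (simp add: Ten_Cmp Ten_Cmp_Cmp)
    finally show "?Q1 V' (Idn \<C> ?X) f \<cdot> ?p ?X = ?Q1 V' f (Idn \<C> ?Y) \<cdot> ?p ?Y" .
  qed
  from end_factorization[OF end' this]
  show "ZA \<C> Z \<pi>Z g \<in> Hom \<C> (Z V) (Z V')"
    "\<pi>Z V' X \<cdot> ZA \<C> Z \<pi>Z g = ((Idn \<C> X \<otimes>\<^sub>a g) \<otimes>\<^sub>a Idn \<C> (Dual \<C> X)) \<cdot> \<pi>Z V X"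
    by (simp_all add: ZA_def)
qed

lemma half_braiding_simps:
  assumes "half_braiding \<C> A \<sigma>"
  shows "Src \<C> (\<sigma> X) = A \<otimes>\<^sub>o X" "Tgt \<C> (\<sigma> X) = X \<otimes>\<^sub>o A"
    and "(f \<otimes>\<^sub>a Idn \<C> A) \<cdot> \<sigma> (Src \<C> f) = \<sigma> (Tgt \<C> f) \<cdot> (Idn \<C> A \<otimes>\<^sub>a f)"
  using assms by (auto simp: half_braiding_def is_nat_iso_def is_nat_trans_def Hom_def)

text \<open>The family that defines \<open>cf_delta\<close> is dinatural: a morphism \<open>f\<close> passes through the half-braiding by
  naturality and then moves from one leg of the coevaluation to the other.\<close>

lemma
  assumes Z: "is_central_end \<C> Z \<pi>Z" and \<sigma>: "half_braiding \<C> A \<sigma>"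
  shows cf_delta_Hom: "cf_delta \<C> Z \<pi>Z A \<sigma> \<in> Hom \<C> A (Z A)"
    and central_end_cf_delta: "\<pi>Z A X \<cdot> cf_delta \<C> Z \<pi>Z A \<sigma> = rmate X (Dual \<C> X) (Coev \<C> X) A (\<sigma> X)"
proof -
  let ?Q0 = "\<lambda>X Y. (Y \<otimes>\<^sub>o A) \<otimes>\<^sub>o Dual \<C> X" and ?Q1 = "\<lambda>f g. (g \<otimes>\<^sub>a Idn \<C> A) \<otimes>\<^sub>a DualA \<C> f"
  let ?p = "\<lambda>X. rmate X (Dual \<C> X) (Coev \<C> X) A (\<sigma> X)"
  note [simp] = half_braiding_simps(1,2)[OF \<sigma>]
  have end': "is_end \<C> \<C> ?Q0 ?Q1 (Z A) (\<pi>Z A)"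
    using Z by (simp add: is_central_end_def)
  have "is_dinatural \<C> \<C> ?Q0 ?Q1 A ?p"
    unfolding is_dinatural_def
  proof (intro conjI allI)
    show "?p X \<in> Hom \<C> A (?Q0 X X)" for X
      by (simp add: HomI)
    fix f
    let ?X = "Src \<C> f" and ?Y = "Tgt \<C> f"
    have "?Q1 (Idn \<C> ?X) f \<cdot> ?p ?X = rmate ?X (Dual \<C> ?X) (Coev \<C> ?X) A ((f \<otimes>\<^sub>a Idn \<C> A) \<cdot> \<sigma> ?X)"
      by (simp add: DualA_Idn Cmp_rmate)
    also have "\<dots> = (\<sigma> ?Y \<otimes>\<^sub>a Idn \<C> (Dual \<C> ?X)) \<cdot> ((Idn \<C> A \<otimes>\<^sub>a f) \<otimes>\<^sub>a Idn \<C> (Dual \<C> ?X)) \<cdot>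
        Inv \<C> (Assoc \<C> A ?X (Dual \<C> ?X)) \<cdot> (Idn \<C> A \<otimes>\<^sub>a Coev \<C> ?X) \<cdot> Inv \<C> (RUnit \<C> A)"
      by (simp add: half_braiding_simps(3)[OF \<sigma>] rmate_def Ten_Cmp_Cmp)
    also have "\<dots> = (\<sigma> ?Y \<otimes>\<^sub>a Idn \<C> (Dual \<C> ?X)) \<cdot> Inv \<C> (Assoc \<C> A ?Y (Dual \<C> ?X)) \<cdot>
        (Idn \<C> A \<otimes>\<^sub>a (f \<otimes>\<^sub>a Idn \<C> (Dual \<C> ?X))) \<cdot> (Idn \<C> A \<otimes>\<^sub>a Coev \<C> ?X) \<cdot> Inv \<C> (RUnit \<C> A)"
      by (simp add: Cmp_reassoc[OF Inv_Assoc_natural[of "Idn \<C> A" f "Idn \<C> (Dual \<C> ?X)", simplified]])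
    also have "\<dots> = (\<sigma> ?Y \<otimes>\<^sub>a Idn \<C> (Dual \<C> ?X)) \<cdot> Inv \<C> (Assoc \<C> A ?Y (Dual \<C> ?X)) \<cdot>
        (Idn \<C> A \<otimes>\<^sub>a (Idn \<C> ?Y \<otimes>\<^sub>a DualA \<C> f)) \<cdot> (Idn \<C> A \<otimes>\<^sub>a Coev \<C> ?Y) \<cdot> Inv \<C> (RUnit \<C> A)"
      by (simp add: Ten_Cmp_Cmp Coev_DualA)
    also have "\<dots> = (\<sigma> ?Y \<otimes>\<^sub>a Idn \<C> (Dual \<C> ?X)) \<cdot> (Idn \<C> (A \<otimes>\<^sub>o ?Y) \<otimes>\<^sub>a DualA \<C> f) \<cdot>
        Inv \<C> (Assoc \<C> A ?Y (Dual \<C> ?Y)) \<cdot> (Idn \<C> A \<otimes>\<^sub>a Coev \<C> ?Y) \<cdot> Inv \<C> (RUnit \<C> A)"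
      by (simp add: Cmp_reassoc[OF Inv_Assoc_natural[of "Idn \<C> A" "Idn \<C> ?Y" "DualA \<C> f", simplified]])
    also have "\<dots> = ?Q1 f (Idn \<C> ?Y) \<cdot> ?p ?Y"
      by (simp add: rmate_def Ten_Cmp_Cmp)
    finally show "?Q1 (Idn \<C> ?X) f \<cdot> ?p ?X = ?Q1 f (Idn \<C> ?Y) \<cdot> ?p ?Y" .
  qed
  from end_factorization[OF end' this]
  show "cf_delta \<C> Z \<pi>Z A \<sigma> \<in> Hom \<C> A (Z A)" "\<pi>Z A X \<cdot> cf_delta \<C> Z \<pi>Z A \<sigma> = ?p X"
    by (simp_all add: cf_delta_def rmate_def)
qed

lemma cf_star_component:
  assumes Z: "is_central_end \<C> Z \<pi>Z" and \<sigma>: "half_braiding \<C> A \<sigma>"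
    and g [simp]: "Src \<C> g = A" "Tgt \<C> g = Unit \<C>"
    and t [simp]: "Src \<C> t = X \<otimes>\<^sub>o Dual \<C> X"
  shows "cf_star \<C> Z \<pi>Z A \<sigma> (t \<cdot> pi_C \<C> \<pi>Z X) g =
    t \<cdot> ((RUnit \<C> X \<cdot> (Idn \<C> X \<otimes>\<^sub>a g)) \<otimes>\<^sub>a Idn \<C> (Dual \<C> X)) \<cdot> rmate X (Dual \<C> X) (Coev \<C> X) A (\<sigma> X)"
proof -
  let ?P = "Dual \<C> X" and ?z = "ZA \<C> Z \<pi>Z g" and ?d = "cf_delta \<C> Z \<pi>Z A \<sigma>"
  have [simp]: "Src \<C> (\<pi>Z V X) = Z V" "Tgt \<C> (\<pi>Z V X) = (X \<otimes>\<^sub>o V) \<otimes>\<^sub>o ?P" for V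
    using central_end_Hom[OF Z, of V X] by (simp_all add: Hom_def)
  have [simp]: "Src \<C> ?z = Z A" "Tgt \<C> ?z = Z (Unit \<C>)" "Src \<C> ?d = A" "Tgt \<C> ?d = Z A"
    using ZA_Hom[OF Z g] cf_delta_Hom[OF Z \<sigma>] by (simp_all add: Hom_def)
  have "cf_star \<C> Z \<pi>Z A \<sigma> (t \<cdot> pi_C \<C> \<pi>Z X) g
      = t \<cdot> (RUnit \<C> X \<otimes>\<^sub>a Idn \<C> ?P) \<cdot> (\<pi>Z (Unit \<C>) X \<cdot> ?z) \<cdot> ?d"
    by (simp add: cf_star_def pi_C_def)
  also have "\<pi>Z (Unit \<C>) X \<cdot> ?z = ((Idn \<C> X \<otimes>\<^sub>a g) \<otimes>\<^sub>a Idn \<C> ?P) \<cdot> \<pi>Z A X"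
    by (rule central_end_ZA[OF Z g])
  also have "t \<cdot> (RUnit \<C> X \<otimes>\<^sub>a Idn \<C> ?P) \<cdot> (((Idn \<C> X \<otimes>\<^sub>a g) \<otimes>\<^sub>a Idn \<C> ?P) \<cdot> \<pi>Z A X) \<cdot> ?d
      = t \<cdot> ((RUnit \<C> X \<cdot> (Idn \<C> X \<otimes>\<^sub>a g)) \<otimes>\<^sub>a Idn \<C> ?P) \<cdot> (\<pi>Z A X \<cdot> ?d)"
    by (simp add: Ten_Cmp_Cmp)
  also have "\<pi>Z A X \<cdot> ?d = rmate X ?P (Coev \<C> X) A (\<sigma> X)"
    by (rule central_end_cf_delta[OF Z \<sigma>])
  finally show ?thesis .
qed

end

section \<open>Multiplicativity of the trace and of the internal character\<close>

context pivotal_finite_tensor_category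
begin

lemma Src_Piv [simp]: "Src \<C> (Piv \<C> X) = X" and Tgt_Piv [simp]: "Tgt \<C> (Piv \<C> X) = Dual \<C> (Dual \<C> X)"
  using Piv_nat_iso by (auto simp: is_nat_iso_def is_nat_trans_def Hom_def)

lemma Src_tr_C [simp]: "Src \<C> (tr_C \<C> X) = X \<otimes>\<^sub>o Dual \<C> X" and Tgt_tr_C [simp]: "Tgt \<C> (tr_C \<C> X) = Unit \<C>"
  by (simp_all add: tr_C_def)

end

sublocale relative_serre_functor \<subseteq> ihom_module_category \<C> \<M>
  by unfold_locales (rule internal_homs)

context pivotal_module_category
begin

lemma Src_MPiv [simp]: "Src \<M> (MPiv \<M> M) = M" and Tgt_MPiv [simp]: "Tgt \<M> (MPiv \<M> M) = SerO \<M> M"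
  using MPiv_nat_iso by (auto simp: is_nat_iso_def is_nat_trans_def Hom_def)

lemma Src_SerD [simp]: "Src \<C> (SerD \<M> M N) = Dual \<C> (IHom \<M> M N)"
  and Tgt_SerD [simp]: "Tgt \<C> (SerD \<M> M N) = IHom \<M> N (SerO \<M> M)"
  using SerD_Hom by (auto simp: Hom_def)

lemma Src_SerZ [simp]: "Src \<M> (SerZ \<M> X M) = Dual \<C> (Dual \<C> X) \<rhd> SerO \<M> M"
  and Tgt_SerZ [simp]: "Tgt \<M> (SerZ \<M> X M) = SerO \<M> (X \<rhd> M)"
  using SerZ_Hom by (auto simp: Hom_def)

text \<open>Since \<open>SerD\<close> is invertible and functionals on \<open>H\<close> correspond to morphisms \<open>1 \<rightarrow> H\<^sup>*\<close>, the
  trace exists and is characterized by its defining equation.\<close>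

lemma
  shows Src_tr_M [simp]: "Src \<C> (tr_M \<C> \<M> M) = IHom \<M> M M"
    and Tgt_tr_M [simp]: "Tgt \<C> (tr_M \<C> \<M> M) = Unit \<C>"
    and SerD_tr_M: "SerD \<M> M M \<cdot> DualA \<C> (tr_M \<C> \<M> M) \<cdot> dual_unit \<C> =
      imate \<C> \<M> (Unit \<C>) M (MPiv \<M> M \<diamond> MUnit \<M> M)"
proof -
  let ?w = "imate \<C> \<M> (Unit \<C>) M (MPiv \<M> M \<diamond> MUnit \<M> M)" and ?H = "IHom \<M> M M"
  let ?P = "\<lambda>t. t \<in> Hom \<C> ?H (Unit \<C>) \<and> SerD \<M> M M \<cdot> DualA \<C> t \<cdot> dual_unit \<C> = ?w"
  have w: "IHomBi \<C> \<M> (Idn \<M> M) (MPiv \<M> M) \<cdot> IHomA \<M> M (MUnit \<M> M) \<cdot> ICoev \<M> (Unit \<C>) M = ?w"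
    using IHomA_imate[of "MUnit \<M> M" "Unit \<C>" M "MPiv \<M> M"] by (simp add: IHomBi_Idn imate_def)
  let ?\<phi> = "Inv \<C> (SerD \<M> M M) \<cdot> ?w"
  note [simp] = \<C>.iso_simps[OF SerD_iso, simplified]
  have "\<exists>!t. t \<in> Hom \<C> ?H (Unit \<C>) \<and> DualA \<C> t \<cdot> dual_unit \<C> = ?\<phi>"
    by (rule \<C>.dual_functional_unique) simp_all
  moreover have "DualA \<C> t \<cdot> dual_unit \<C> = ?\<phi> \<longleftrightarrow> SerD \<M> M M \<cdot> DualA \<C> t \<cdot> dual_unit \<C> = ?w"
    if "t \<in> Hom \<C> ?H (Unit \<C>)" for t
  proof
    have [simp]: "Src \<C> t = ?H" "Tgt \<C> t = Unit \<C>"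
      using that by (simp_all add: Hom_def)
    show "SerD \<M> M M \<cdot> DualA \<C> t \<cdot> dual_unit \<C> = ?w" if "DualA \<C> t \<cdot> dual_unit \<C> = ?\<phi>"
      by (simp add: that)
    show "DualA \<C> t \<cdot> dual_unit \<C> = ?\<phi>" if "SerD \<M> M M \<cdot> DualA \<C> t \<cdot> dual_unit \<C> = ?w"
      by (simp flip: that)
  qed
  ultimately have "\<exists>!t. ?P t"
    by (smt (verit))
  from theI'[OF this] have "?P (tr_M \<C> \<M> M)"
    by (simp only: tr_M_def w)
  then show "Src \<C> (tr_M \<C> \<M> M) = ?H" "Tgt \<C> (tr_M \<C> \<M> M) = Unit \<C>"
    "SerD \<M> M M \<cdot> DualA \<C> (tr_M \<C> \<M> M) \<cdot> dual_unit \<C> = ?w"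
    by (simp_all add: Hom_def)
qed

text \<open>Both sides are functionals on \<open>(X \<otimes> [M, M]) \<otimes> X\<^sup>*\<close> and are compared as points of its dual. The
  bimodule compatibility of \<open>SerD\<close> turns the point of the right-hand side into the point
  \<open>1 \<rightarrow> [X \<rhd> M, S (X \<rhd> M)]\<close> of \<open>SerZ \<cdot> (Piv X \<rhd> MPiv M)\<close>, and this is the point of
  \<open>MPiv (X \<rhd> M)\<close> that defines the trace of \<open>X \<rhd> M\<close>.\<close>

lemma tr_M_act:
  "tr_M \<C> \<M> (X \<rhd> M) \<cdot> ihom_c \<C> \<M> X M M X =
    tr_C \<C> X \<cdot> ((RUnit \<C> X \<cdot> (Idn \<C> X \<otimes>\<^sub>a tr_M \<C> \<M> M)) \<otimes>\<^sub>a Idn \<C> (Dual \<C> X))"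
proof -
  let ?I = "Unit \<C>" and ?P = "Dual \<C> X" and ?PP = "Dual \<C> (Dual \<C> X)" and ?H = "IHom \<M> M M"
  let ?XM = "X \<rhd> M" and ?S = "SerO \<M> M" and ?j = "Piv \<C> X" and ?u = "dual_unit \<C>"
  let ?V = "X \<otimes>\<^sub>o ?H"
  define c where "c = ihom_c \<C> \<M> X M M X"
  define s where "s = tr_M \<C> \<M> M"
  define \<tau> where "\<tau> = tr_M \<C> \<M> ?XM"
  define p where "p = DualA \<C> s \<cdot> ?u"
  define f where "f = RUnit \<C> X \<cdot> (Idn \<C> X \<otimes>\<^sub>a s)"
  define t where "t = Ev \<C> ?P \<cdot> ((?j \<cdot> f) \<otimes>\<^sub>a Idn \<C> ?P)"
  let ?r = "Inv \<C> (RUnit \<C> ?PP) \<cdot> ?j"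
  \<comment> \<open>\<open>q\<close> is the point of \<open>(X\<^sup>*\<^sup>* \<otimes> H\<^sup>*) \<otimes> X\<^sup>*\<close> that corresponds to the functional \<open>t\<close> on \<open>(X \<otimes> H) \<otimes> X\<^sup>*\<close>.\<close>
  define q where "q = (((Idn \<C> ?PP \<otimes>\<^sub>a p) \<cdot> ?r) \<otimes>\<^sub>a Idn \<C> ?P) \<cdot> Coev \<C> X"
  have [simp]: "Src \<C> c = ?V \<otimes>\<^sub>o ?P" "Tgt \<C> c = IHom \<M> ?XM ?XM" "Src \<C> s = ?H" "Tgt \<C> s = ?I"
      "Src \<C> \<tau> = IHom \<M> ?XM ?XM" "Tgt \<C> \<tau> = ?I"
    by (simp_all add: c_def s_def \<tau>_def)
  have [simp]: "Src \<C> p = ?I" "Tgt \<C> p = Dual \<C> ?H" "Src \<C> f = ?V" "Tgt \<C> f = X"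
    by (simp_all add: p_def f_def)
  have [simp]: "Src \<C> t = ?V \<otimes>\<^sub>o ?P" "Tgt \<C> t = ?I"
      "Src \<C> q = ?I" "Tgt \<C> q = (?PP \<otimes>\<^sub>o Dual \<C> ?H) \<otimes>\<^sub>o ?P"
    by (simp_all add: t_def q_def)
  have iso_c: "is_isomorphism \<C> (DualA \<C> c)"
    by (simp add: c_def \<C>.iso_DualA iso_ihom_c)
  note [simp] = \<C>.iso_simps[OF iso_c, simplified]
  have dual_ten3_q: "dual_ten3 \<C> X ?H X \<cdot> q = DualA \<C> t \<cdot> ?u"
  proof -
    have "dual_ten3 \<C> X ?H X \<cdot> q
        = dual_ten \<C> ?V ?P \<cdot> (Idn \<C> ?PP \<otimes>\<^sub>a dual_ten \<C> X ?H) \<cdot> Assoc \<C> ?PP (Dual \<C> ?H) ?P \<cdot>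
          ((Idn \<C> ?PP \<otimes>\<^sub>a p) \<otimes>\<^sub>a Idn \<C> ?P) \<cdot> (?r \<otimes>\<^sub>a Idn \<C> ?P) \<cdot> Coev \<C> X"
      by (simp add: dual_ten3_def q_def \<C>.Ten_Cmp_Cmp)
    also have "\<dots> = dual_ten \<C> ?V ?P \<cdot> (Idn \<C> ?PP \<otimes>\<^sub>a (dual_ten \<C> X ?H \<cdot> (p \<otimes>\<^sub>a Idn \<C> ?P))) \<cdot> Assoc \<C> ?PP ?I ?P \<cdot>
          (?r \<otimes>\<^sub>a Idn \<C> ?P) \<cdot> Coev \<C> X"
    proof -
      have "Assoc \<C> ?PP (Dual \<C> ?H) ?P \<cdot> ((Idn \<C> ?PP \<otimes>\<^sub>a p) \<otimes>\<^sub>a Idn \<C> ?P) \<cdot> (?r \<otimes>\<^sub>a Idn \<C> ?P) \<cdot> Coev \<C> X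
          = (Idn \<C> ?PP \<otimes>\<^sub>a (p \<otimes>\<^sub>a Idn \<C> ?P)) \<cdot> Assoc \<C> ?PP ?I ?P \<cdot> (?r \<otimes>\<^sub>a Idn \<C> ?P) \<cdot> Coev \<C> X"
        by (simp add: \<C>.Cmp_reassoc[OF \<C>.Assoc_natural[of "Idn \<C> ?PP" p "Idn \<C> ?P", simplified]])
      then show ?thesis
        by (simp only:) (simp add: \<C>.Ten_Cmp_Cmp)
    qed
    also have "dual_ten \<C> X ?H \<cdot> (p \<otimes>\<^sub>a Idn \<C> ?P) = DualA \<C> f \<cdot> LUnit \<C> ?P"
      by (simp add: p_def f_def \<C>.dual_ten_functional)
    also have "dual_ten \<C> ?V ?P \<cdot> (Idn \<C> ?PP \<otimes>\<^sub>a (DualA \<C> f \<cdot> LUnit \<C> ?P)) \<cdot> Assoc \<C> ?PP ?I ?P \<cdot>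
          (?r \<otimes>\<^sub>a Idn \<C> ?P) \<cdot> Coev \<C> X
        = dual_ten \<C> ?V ?P \<cdot> (Idn \<C> ?PP \<otimes>\<^sub>a DualA \<C> f) \<cdot> ((Idn \<C> ?PP \<otimes>\<^sub>a LUnit \<C> ?P) \<cdot> Assoc \<C> ?PP ?I ?P) \<cdot>
          (?r \<otimes>\<^sub>a Idn \<C> ?P) \<cdot> Coev \<C> X"
      by (simp add: \<C>.Ten_Cmp_Cmp)
    also have "\<dots> = dual_ten \<C> ?V ?P \<cdot> (?j \<otimes>\<^sub>a DualA \<C> f) \<cdot> Coev \<C> X"
      by (simp only: \<C>.triangle) (simp add: \<C>.Ten_Cmp_Cmp)
    also have "\<dots> = DualA \<C> t \<cdot> ?u"
      by (simp add: t_def \<C>.dual_ten_Coev)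
    finally show ?thesis .
  qed
  have "SerD \<M> ?XM ?XM \<cdot> Inv \<C> (DualA \<C> c) \<cdot> DualA \<C> t \<cdot> ?u
      = (SerD \<M> ?XM ?XM \<cdot> Inv \<C> (DualA \<C> c) \<cdot> dual_ten3 \<C> X ?H X) \<cdot> q"
    by (simp add: dual_ten3_q dual_ten3_def flip: dual_ten3_q)
  also have "\<dots> = (IHomA \<M> ?XM (SerZ \<M> X M) \<cdot> ihom_c \<C> \<M> ?PP M ?S X \<cdot>
      ((Idn \<C> ?PP \<otimes>\<^sub>a SerD \<M> M M) \<otimes>\<^sub>a Idn \<C> ?P)) \<cdot> q"
    by (simp only: SerD_bimodule c_def IHomBi_Idn)
  also have "\<dots> = IHomA \<M> ?XM (SerZ \<M> X M) \<cdot> ihom_c \<C> \<M> ?PP M ?S X \<cdot>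
      (((Idn \<C> ?PP \<otimes>\<^sub>a (SerD \<M> M M \<cdot> p)) \<cdot> ?r) \<otimes>\<^sub>a Idn \<C> ?P) \<cdot> Coev \<C> X"
    by (simp add: q_def \<C>.Ten_Cmp_Cmp)
  also have "SerD \<M> M M \<cdot> p = imate \<C> \<M> ?I M (MPiv \<M> M \<diamond> MUnit \<M> M)"
    by (simp add: p_def s_def SerD_tr_M)
  also have "IHomA \<M> ?XM (SerZ \<M> X M) \<cdot> ihom_c \<C> \<M> ?PP M ?S X \<cdot>
      (((Idn \<C> ?PP \<otimes>\<^sub>a imate \<C> \<M> ?I M (MPiv \<M> M \<diamond> MUnit \<M> M)) \<cdot> ?r) \<otimes>\<^sub>a Idn \<C> ?P) \<cdot> Coev \<C> X
      = IHomA \<M> ?XM (SerZ \<M> X M) \<cdot> imate \<C> \<M> ?I ?XM ((?j \<triangleright> MPiv \<M> M) \<diamond> MUnit \<M> ?XM)"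
    by (simp add: ihom_c_point)
  also have "\<dots> = imate \<C> \<M> ?I ?XM (MPiv \<M> ?XM \<diamond> MUnit \<M> ?XM)"
    by (simp add: IHomA_imate MPiv_act)
  also have "\<dots> = SerD \<M> ?XM ?XM \<cdot> DualA \<C> \<tau> \<cdot> ?u"
    by (simp add: \<tau>_def SerD_tr_M)
  finally have "Inv \<C> (DualA \<C> c) \<cdot> DualA \<C> t \<cdot> ?u = DualA \<C> \<tau> \<cdot> ?u"
    by (rule \<C>.iso_cancel_left[OF SerD_iso]) simp_all
  then have "DualA \<C> c \<cdot> Inv \<C> (DualA \<C> c) \<cdot> DualA \<C> t \<cdot> ?u = DualA \<C> c \<cdot> DualA \<C> \<tau> \<cdot> ?u"
    by simp
  then have eq: "DualA \<C> t \<cdot> ?u = DualA \<C> (\<tau> \<cdot> c) \<cdot> ?u"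
    by (simp add: \<C>.DualA_Cmp)
  have "\<exists>!t'. t' \<in> Hom \<C> (?V \<otimes>\<^sub>o ?P) ?I \<and> DualA \<C> t' \<cdot> ?u = DualA \<C> t \<cdot> ?u"
    by (rule \<C>.dual_functional_unique) simp_all
  moreover have "\<tau> \<cdot> c \<in> Hom \<C> (?V \<otimes>\<^sub>o ?P) ?I" "t \<in> Hom \<C> (?V \<otimes>\<^sub>o ?P) ?I"
    by (simp_all add: \<C>.HomI)
  ultimately have "\<tau> \<cdot> c = t"
    using eq by metis
  also have "t = tr_C \<C> X \<cdot> (f \<otimes>\<^sub>a Idn \<C> ?P)"
    by (simp add: t_def tr_C_def \<C>.Ten_Cmp)
  finally show ?thesis
    by (simp only: \<tau>_def c_def f_def s_def)
qed

text \<open>Evaluating the product at the component \<open>X\<close> of the end leaves the trace of \<open>M\<close> inside the trace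
  of \<open>X\<close>, applied to the half-braiding. The defining equation of the half-braiding rewrites this with
  \<open>ihom_b\<close>, which cancels the inverse of \<open>ihom_b\<close> in \<open>ihom_c\<close>.\<close>

lemma ch_C_star_ch_M:
  assumes Z: "is_central_end \<C> Z \<pi>Z" and A: "is_class_function_end \<C> \<M> A \<pi> \<sigma>"
  shows "cf_star \<C> Z \<pi>Z A \<sigma> (ch_C \<C> \<pi>Z X) (ch_M \<C> \<M> \<pi> M) = ch_M \<C> \<M> \<pi> (X \<rhd> M)"
    and "ch_M \<C> \<M> \<pi> M \<in> CF \<C> A"
proof -
  let ?P = "Dual \<C> X" and ?XM = "X \<rhd> M" and ?s = "tr_M \<C> \<M> M" and ?a = "ihom_a \<C> \<M> X M M"
  let ?b = "ihom_b \<C> \<M> X M (X \<rhd> M)"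
  let ?\<rho> = "\<C>.rmate X ?P (Coev \<C> X) A (\<sigma> X)"
  have \<sigma>: "half_braiding \<C> A \<sigma>"
    and \<sigma>\<pi>: "?a \<cdot> (Idn \<C> X \<otimes>\<^sub>a \<pi> M) \<cdot> \<sigma> X = ihom_b_nat \<C> \<M> X M ?XM \<cdot> (\<pi> ?XM \<otimes>\<^sub>a Idn \<C> X)"
    using A by (simp_all add: is_class_function_end_def)
  note [simp] = \<C>.half_braiding_simps(1,2)[OF \<sigma>] \<C>.iso_simps[OF iso_ihom_b, simplified]
  have [simp]: "Src \<C> (\<pi> N) = A" "Tgt \<C> (\<pi> N) = IHom \<M> N N" for N
    using A by (auto simp: is_class_function_end_def is_end_def is_dinatural_def Hom_def)
  show "ch_M \<C> \<M> \<pi> M \<in> CF \<C> A"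
    by (simp add: ch_M_def CF_def \<C>.HomI)
  have "cf_star \<C> Z \<pi>Z A \<sigma> (ch_C \<C> \<pi>Z X) (ch_M \<C> \<M> \<pi> M)
      = tr_C \<C> X \<cdot> ((RUnit \<C> X \<cdot> (Idn \<C> X \<otimes>\<^sub>a ch_M \<C> \<M> \<pi> M)) \<otimes>\<^sub>a Idn \<C> ?P) \<cdot> ?\<rho>"
    unfolding ch_C_def by (rule \<C>.cf_star_component[OF Z \<sigma>]) (simp_all add: ch_M_def)
  also have "\<dots> = (tr_C \<C> X \<cdot> ((RUnit \<C> X \<cdot> (Idn \<C> X \<otimes>\<^sub>a ?s)) \<otimes>\<^sub>a Idn \<C> ?P)) \<cdot>
      ((Idn \<C> X \<otimes>\<^sub>a \<pi> M) \<otimes>\<^sub>a Idn \<C> ?P) \<cdot> ?\<rho>"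
    by (simp add: ch_M_def \<C>.Ten_Cmp \<C>.Ten_Cmp_Cmp)
  also have "\<dots> = tr_M \<C> \<M> ?XM \<cdot> ihom_c \<C> \<M> X M M X \<cdot> ((Idn \<C> X \<otimes>\<^sub>a \<pi> M) \<otimes>\<^sub>a Idn \<C> ?P) \<cdot> ?\<rho>"
    by (simp flip: tr_M_act)
  also have "\<dots> = tr_M \<C> \<M> ?XM \<cdot> Inv \<C> ?b \<cdot> (?a \<otimes>\<^sub>a Idn \<C> ?P) \<cdot> ((Idn \<C> X \<otimes>\<^sub>a \<pi> M) \<otimes>\<^sub>a Idn \<C> ?P) \<cdot> ?\<rho>"
    by (simp add: ihom_c_def)
  also have "\<dots> = tr_M \<C> \<M> ?XM \<cdot> Inv \<C> ?b \<cdot> \<C>.rmate X ?P (Coev \<C> X) A (?a \<cdot> (Idn \<C> X \<otimes>\<^sub>a \<pi> M) \<cdot> \<sigma> X)"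
    by (simp add: \<C>.Cmp_rmate)
  also have "\<dots> = tr_M \<C> \<M> ?XM \<cdot> Inv \<C> ?b \<cdot> ?b \<cdot> \<pi> ?XM"
    by (simp only: \<sigma>\<pi>) (simp add: ihom_b_rmate \<C>.rmate_Cmp)
  also have "\<dots> = ch_M \<C> \<M> \<pi> ?XM"
    by (simp add: ch_M_def)
  finally show "cf_star \<C> Z \<pi>Z A \<sigma> (ch_C \<C> \<pi>Z X) (ch_M \<C> \<M> \<pi> M) = ch_M \<C> \<M> \<pi> ?XM" .
qed

end

theorem lemma5p9:
  fixes \<C> :: "('o, 'a, 'k::alg_closed_field) pivotal_cat"
    and \<M> :: "('p, 'b, 'k, 'o, 'a) pivotal_mod_cat"
    and Z :: "'o \<Rightarrow> 'o" and \<pi>Z :: "'o \<Rightarrow> 'o \<Rightarrow> 'a"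
    and A :: 'o and \<pi> :: "'p \<Rightarrow> 'a" and \<sigma> :: "'o \<Rightarrow> 'a"
    and X :: 'o and M :: 'p
  assumes "pivotal_finite_tensor_category \<C>"
    and "pivotal_module_category \<C> \<M>"
    and "is_central_end \<C> Z \<pi>Z"
    and "is_class_function_end \<C> \<M> A \<pi> \<sigma>"
  shows "cf_star \<C> Z \<pi>Z A \<sigma> (ch_C \<C> \<pi>Z X) (ch_M \<C> \<M> \<pi> M) \<in> CF \<C> A \<and>
    cf_star \<C> Z \<pi>Z A \<sigma> (ch_C \<C> \<pi>Z X) (ch_M \<C> \<M> \<pi> M) = ch_M \<C> \<M> \<pi> (X \<rhd>\<^sub>o\<^bsub>\<M>\<^esub> M)"
  using pivotal_module_category.ch_C_star_ch_M[OF assms(2-4)] by simp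

end
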